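(* There is an absolute constant $C>0$ such that, for every integer $m\ge 1$, \[ 1\le \mathcal C^{\mathrm{BW}}_{m,2m}\le 1+\frac{C}{m}. \] Moreover, there are absolute constants $A>0$ and $m_0\in\mathbb N$ such that, for every integer $m\ge m_0$ and every $p\in[2m+A,\infty]$, \[ \mathcal C^{\mathrm{BW}}_{m,p}=1, \] and in this regime ($m\ge m_0$, $p\in[2m+A,\infty]$) equality is rigid: for every $n\ge1$, a nonzero complex $m$-homogeneous polynomial $P:\mathbb C^n\to\mathbb C$ satisfies $\|P\|_{\mathrm{BW}}=\|P\|_p$ if and only if $P(z)=c\,z_j^m$ for some $j\in\{1,\dots,n\}$ and some $c\in\mathbb C\setminus\{0\}$.
   Context: For $m,n\in\mathbb N$, $\mathcal P_m(\mathbb C^n)$ is the space of complex $m$-homogeneous polynomials $P(z)=\sum_{|\alpha|=m}b_\alpha z^\alpha$ on $\mathbb C^n$, where $\alpha\in\mathbb N_0^n$, $|\alpha|=\alpha_1+\cdots+\alpha_n$, $\alpha!=\alpha_1!\cdots\alpha_n!$, $z^\alpha=z_1^{\alpha_1}\cdots z_n^{\alpha_n}$. The Bombieri--Weyl norm is \[ \|P\|_{\mathrm{BW}}=\Bigl(\sum_{|\alpha|=m}\frac{\alpha!}{m!}|b_\alpha|^2\Bigr)^{1/2}. \] For $1\le p\le\infty$, $\|P\|_p=\sup\{|P(z)|: z\in\mathbb C^n,\ \|z\|_p\le1\}$, where $\|z\|_p$ is the $\ell_p^n$ norm. Finally \[ \mathcal C^{\mathrm{BW}}_{m,p}=\sup_{n\ge1}\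 \sup_{0\ne P\in\mathcal P_m(\mathbb C^n)}\frac{\|P\|_{\mathrm{BW}}}{\|P\|_p}. \] "Absolute constant" means independent of all other quantities ($m$, $n$, $p$, $P$). *)

theory Defs
  imports Complex_Main "HOL-Library.Poly_Mapping" "HOL-Library.Extended_Real"
begin

text \<open>
  A polynomial in the variables \<open>z 0, \<dots>, z (n - 1)\<close> is a finitely supported map from
  exponents \<open>\<alpha>\<close> to coefficients, an exponent being a finitely supported map from variable
  indices to powers. The number of variables \<open>n\<close> is a term, since a supremum over it is taken
  below. A point of \<open>n\<close>-dimensional complex space is a function \<open>nat \<Rightarrow> complex\<close> of which only
  the values at \<open>i < n\<close> matter.
\<close>

type_synonym multi_index = "nat \<Rightarrow>\<^sub>0 nat"
type_synonym cpoly = "multi_index \<Rightarrow>\<^sub>0 complex"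

definition mi_degree :: "multi_index \<Rightarrow> nat" where
  "mi_degree \<alpha> = (\<Sum>i\<in>Poly_Mapping.keys \<alpha>. Poly_Mapping.lookup \<alpha> i)"

definition mi_fact :: "multi_index \<Rightarrow> nat" where
  "mi_fact \<alpha> = (\<Prod>i\<in>Poly_Mapping.keys \<alpha>. fact (Poly_Mapping.lookup \<alpha> i))"

definition mi_power :: "(nat \<Rightarrow> complex) \<Rightarrow> multi_index \<Rightarrow> complex" where
  "mi_power z \<alpha> = (\<Prod>i\<in>Poly_Mapping.keys \<alpha>. z i ^ Poly_Mapping.lookup \<alpha> i)"

definition multi_indices :: "nat \<Rightarrow> nat \<Rightarrow> multi_index set" where
  "multi_indices m n = {\<alpha>. Poly_Mapping.keys \<alpha> \<subseteq> {..<n} \<and> mi_degree \<alpha> = m}"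

definition homogeneous_polys :: "nat \<Rightarrow> nat \<Rightarrow> cpoly set" where
  "homogeneous_polys m n = {P. Poly_Mapping.keys P \<subseteq> multi_indices m n}"

definition poly_eval :: "cpoly \<Rightarrow> (nat \<Rightarrow> complex) \<Rightarrow> complex" where
  "poly_eval P z = (\<Sum>\<alpha>\<in>Poly_Mapping.keys P. Poly_Mapping.lookup P \<alpha> * mi_power z \<alpha>)"

text \<open>
  For \<open>P \<in> homogeneous_polys m n\<close>, summing over the support of \<open>P\<close> is the same as summing over
  all of \<open>multi_indices m n\<close>, since the other coefficients vanish.
\<close>

definition bw_norm :: "nat \<Rightarrow> cpoly \<Rightarrow> real" where
  "bw_norm m P =
     sqrt (\<Sum>\<alpha>\<in>Poly_Mapping.keys P. real (mi_fact \<alpha>) / fact m * (cmod (Poly_Mapping.lookup P \<alpha>))\<^sup>2)"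

text \<open>The exponent \<open>p\<close> ranges over \<open>1 \<le> p \<le> \<infinity>\<close>, and \<open>n \<ge> 1\<close>.\<close>

definition lp_norm :: "ereal \<Rightarrow> nat \<Rightarrow> (nat \<Rightarrow> complex) \<Rightarrow> real" where
  "lp_norm p n z =
     (if p = \<infinity> then Max ((\<lambda>i. cmod (z i)) ` {..<n})
      else (\<Sum>i<n. cmod (z i) powr real_of_ereal p) powr (1 / real_of_ereal p))"

text \<open>
  The supremum below is over a nonempty set, bounded above for \<open>P \<in> homogeneous_polys m n\<close>
  because every coordinate of a point of the unit ball has modulus at most one.
\<close>

definition sup_norm :: "ereal \<Rightarrow> nat \<Rightarrow> cpoly \<Rightarrow> real" where
  "sup_norm p n P = (SUP z\<in>{z. lp_norm p n z \<le> 1}. cmod (poly_eval P z))"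

text \<open>The constant is extended-real valued, so that no finiteness is presupposed.\<close>

definition C_BW :: "nat \<Rightarrow> ereal \<Rightarrow> ereal" where
  "C_BW m p =
     (SUP n\<in>{1..}. SUP P\<in>homogeneous_polys m n - {0}. ereal (bw_norm m P / sup_norm p n P))"

end

theory Submission
  imports Defs "HOL-Complex_Analysis.Complex_Analysis"
begin

text \<open>
  The pure powers \<open>z\<^sub>i\<^sup>m\<close> are separated from all other monomials. Averaging over \<open>m\<close>-th roots of
  unity in each variable isolates the pure part, whose squared coefficients sum to at most
  \<open>\<parallel>P\<parallel>\<^sub>p\<^sup>2\<close> for \<open>p \<ge> 2 m\<close>. The mixed part contributes only \<open>O(1/m)\<close>: polarize in one slot, so that
  \<open>e \<parallel>P\<parallel> \<ge> \<Sum>\<^sub>i r\<^sub>i |\<partial>\<^sub>i P(z)| / m\<close> on the polydisc of radii \<open>r\<close>, average over the torus, and bound the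
  \<open>L\<^sup>1\<close> averages below by weighted \<open>L\<^sup>2\<close> norms whose weights lose only polynomially in
  \<open>min k (m - k)\<close> per variable. When the \<open>r\<^sub>i\<^sup>2\<^sup>m\<close> are the shares of the Bombieri--Weyl mass, AM-GM
  leaves for each monomial a factor \<open>m! / \<alpha>!\<close> up to that loss, which is of order at least \<open>m\<close> for
  every mixed monomial. The bound \<open>1 + C/m\<close> follows.

  For \<open>p = 2 m + A\<close> the pure part gains a factor of order \<open>1 + A/m\<close> unless a single power
  dominates. Near a dominant power \<open>b z\<^sub>j\<^sup>m\<close> the coefficient estimate \<open>|c\<^sub>k| \<le> 2 (M - |c\<^sub>0|)\<close> for
  polynomials on the circle bounds everything else by the excess \<open>E = M\<^sup>2 - |b|\<^sup>2\<close>, and for large \<open>A\<close>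
  this forces \<open>E = 0\<close>. Larger \<open>p\<close> follow by monotonicity of the norms.
\<close>

section \<open>Averages over roots of unity\<close>

text \<open>The obstacle is dimension. Orthogonality on a polydisc alone bounds the sum of
  |a_\<gamma>|^2 r^(2\<gamma>), and equal radii with r_1^(2m) + ... + r_n^(2m) = 1 make
  r^(2\<gamma>) = 1/n. Differentiating in one slot gives instead an l1 sum over the variables of l2
  norms, as in the Bohnenblust-Hille inequality; Cauchy-Schwarz on slice i then returns a factor
  1/sqrt(s_i), and AM-GM cancels the shares and with them n. The price is the passage from L1 to L2.
  A constant raised to the degree, as hypercontractivity gives, would swamp the gain m of z_i^(m-1)
  z_j; so the loss has to stay bounded at the exponents 1, m-1 and m, and an absent variable must
  cost exactly 1. Rigidity compares two quantities of order 1/m: the relative pure gain A/m and the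
  mixed part, which is O(1/m) times the excess. This is why a constant shift A of the exponent 2m
  suffices. The mixed part is linear in the excess because a defect of order s bounds the slices by
  a multiple of sqrt(s), and their norms enter squared.\<close>

definition exps :: "nat \<Rightarrow> nat \<Rightarrow> (nat \<Rightarrow> nat) set" where
  "exps m n = {\<gamma>. (\<forall>j\<ge>n. \<gamma> j = 0) \<and> (\<Sum>j<n. \<gamma> j) = m}"

definition exp_box :: "nat \<Rightarrow> nat \<Rightarrow> (nat \<Rightarrow> nat) set" where
  "exp_box n d = {\<gamma>. (\<forall>j\<ge>n. \<gamma> j = 0) \<and> (\<forall>j<n. \<gamma> j \<le> d)}"

definition monom_val :: "nat \<Rightarrow> (nat \<Rightarrow> 'a) \<Rightarrow> (nat \<Rightarrow> nat) \<Rightarrow> 'a::comm_semiring_1" where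
  "monom_val n z \<gamma> = (\<Prod>j<n. z j ^ \<gamma> j)"

text \<open>A finite substitute for Haar measure on the torus. The order N is left free: N = m
  isolates the pure powers, and N > 2d separates frequencies between -d and d. The polyradius is
  carried by the base point.\<close>

primrec torus_avg :: "nat \<Rightarrow> nat \<Rightarrow> ((nat \<Rightarrow> complex) \<Rightarrow> 'a) \<Rightarrow> (nat \<Rightarrow> complex) \<Rightarrow> 'a::real_vector" where
  "torus_avg N 0 F z = F z"
| "torus_avg N (Suc n) F z =
     (1 / real N) *\<^sub>R (\<Sum>t<N. torus_avg N n F (z(n := cis (2 * pi * real t / real N) * z n)))"

lemma sum_cis_powers:
  assumes "N > 0"
  shows "(\<Sum>t<N. cis (2 * pi * real t / real N) ^ k) = (if N dvd k then of_nat N else 0)"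
proof -
  define w where "w = cis (2 * pi * real k / real N)"
  have eq: "cis (2 * pi * real t / real N) ^ k = w ^ t" for t
    unfolding w_def by (simp only: Complex.DeMoivre) (simp add: mult_ac)
  have wN: "w ^ N = 1"
    using assms cis_multiple_2pi[of "real k"] unfolding w_def by (simp only: Complex.DeMoivre) (simp add: mult_ac)
  show ?thesis
  proof (cases "N dvd k")
    case True
    then obtain q where q: "k = N * q" by blast
    have "w = cis (2 * pi * real q)"
      unfolding w_def q using assms by (simp add: field_simps)
    then have "w = 1" by (simp add: cis_multiple_2pi)
    then show ?thesis using True unfolding eq by simp
  next
    case False
    have "w \<noteq> 1"
    proof
      assume "w = 1"
      then have "cos (2 * pi * real k / real N) = 1" unfolding w_def by (simp add: complex_eq_iff)
      then obtain x :: int where "2 * pi * real k / real N = of_int x * 2 * pi"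
        using cos_one_2pi_int by auto
      then have "2 * pi * real k = 2 * pi * (of_int x * real N)"
        using assms by (simp add: field_simps)
      then have "real k = of_int x * real N" by simp
      then have "int k = x * int N"
        by (metis of_int_eq_iff of_int_mult of_int_of_nat_eq)
      then have "int N dvd int k" by simp
      then show False using False by simp
    qed
    then show ?thesis using False wN unfolding eq by (simp add: geometric_sum)
  qed
qed

lemma torus_avg_sum: "torus_avg N n (\<lambda>z. \<Sum>i\<in>I. f i z) z = (\<Sum>i\<in>I. torus_avg N n (f i) z)"
proof (induction n arbitrary: z)
  case (Suc n)
  show ?case
    unfolding torus_avg.simps Suc scaleR_sum_right by (rule sum.swap)
qed simp

lemma torus_avg_cmult:
  fixes f :: "(nat \<Rightarrow> complex) \<Rightarrow> 'a::real_algebra"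
  shows "torus_avg N n (\<lambda>z. c * f z) z = c * torus_avg N n f z"
  by (induction n arbitrary: z) (simp_all add: sum_distrib_left)

text \<open>The two premises record what rotation preserves: all moduli, and all coordinates from n
  on. The second allows an induction on the variables in which the next coordinate is
  frozen.\<close>

lemma torus_avg_cong:
  assumes "\<And>z'. (\<And>j. n \<le> j \<Longrightarrow> z' j = z j) \<Longrightarrow> (\<And>j. cmod (z' j) = cmod (z j)) \<Longrightarrow> F z' = G z'"
  shows "torus_avg N n F z = torus_avg N n G z"
  using assms
proof (induction n arbitrary: z)
  case (Suc n)
  have "torus_avg N n F (z(n := cis a * z n)) = torus_avg N n G (z(n := cis a * z n))" for a
  proof (rule Suc.IH)
    fix z' assume 1: "\<And>j. n \<le> j \<Longrightarrow> z' j = (z(n := cis a * z n)) j"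
      and 2: "\<And>j. cmod (z' j) = cmod ((z(n := cis a * z n)) j)"
    show "F z' = G z'"
      using 1 2 by (intro Suc.prems) (auto simp: norm_mult)
  qed
  then show ?case by simp
qed simp

lemma torus_avg_mono:
  fixes F G :: "(nat \<Rightarrow> complex) \<Rightarrow> real"
  assumes "\<And>z'. (\<And>j. n \<le> j \<Longrightarrow> z' j = z j) \<Longrightarrow> (\<And>j. cmod (z' j) = cmod (z j)) \<Longrightarrow> F z' \<le> G z'"
  shows "torus_avg N n F z \<le> torus_avg N n G z"
  using assms
proof (induction n arbitrary: z)
  case (Suc n)
  have "torus_avg N n F (z(n := cis a * z n)) \<le> torus_avg N n G (z(n := cis a * z n))" for a
  proof (rule Suc.IH)
    fix z' assume 1: "\<And>j. n \<le> j \<Longrightarrow> z' j = (z(n := cis a * z n)) j"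
      and 2: "\<And>j. cmod (z' j) = cmod ((z(n := cis a * z n)) j)"
    show "F z' \<le> G z'"
      using 1 2 by (intro Suc.prems) (auto simp: norm_mult)
  qed
  then show ?case by (auto intro!: divide_right_mono sum_mono)
qed simp

lemma torus_avg_const: "N > 0 \<Longrightarrow> torus_avg N n (\<lambda>_. c) z = c"
  by (induction n arbitrary: z) (simp_all add: sum_constant_scaleR)

lemma norm_torus_avg_le:
  fixes F :: "(nat \<Rightarrow> complex) \<Rightarrow> 'a::real_normed_vector"
  shows "norm (torus_avg N n F z) \<le> torus_avg N n (\<lambda>z. norm (F z)) z"
proof (induction n arbitrary: z)
  case (Suc n)
  show ?case
    by (auto intro!: divide_right_mono order.trans[OF norm_sum] sum_mono Suc)
qed simp

lemma torus_avg_le_bound: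
  fixes F :: "(nat \<Rightarrow> complex) \<Rightarrow> real"
  assumes "N > 0" "\<And>z'. (\<And>j. cmod (z' j) = cmod (z j)) \<Longrightarrow> F z' \<le> M"
  shows "torus_avg N n F z \<le> M"
  using torus_avg_mono[of n z F "\<lambda>_. M" N] torus_avg_const[OF assms(1), of n M z] assms(2) by simp

lemma monom_val_upd:
  assumes "k < n"
  shows "monom_val n (z(k := a * z k)) \<gamma> = a ^ \<gamma> k * monom_val n z \<gamma>"
proof -
  have "monom_val n (z(k := a * z k)) \<gamma> = (\<Prod>j<n. (if j = k then a ^ \<gamma> k else 1) * z j ^ \<gamma> j)"
    unfolding monom_val_def by (rule prod.cong) (auto simp: power_mult_distrib)
  also have "\<dots> = a ^ \<gamma> k * monom_val n z \<gamma>"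
    using assms by (simp add: prod.distrib monom_val_def)
  finally show ?thesis .
qed

lemma torus_avg_monom:
  assumes "N > 0" "n \<le> n'"
  shows "torus_avg N n (\<lambda>z. monom_val n' z \<gamma>) z = (if \<forall>j<n. N dvd \<gamma> j then monom_val n' z \<gamma> else 0)"
  using assms(2)
proof (induction n arbitrary: z)
  case (Suc n)
  have IH: "torus_avg N n (\<lambda>z. monom_val n' z \<gamma>) z =
      (if \<forall>j<n. N dvd \<gamma> j then monom_val n' z \<gamma> else 0)" for z
    using Suc by simp
  have "torus_avg N (Suc n) (\<lambda>z. monom_val n' z \<gamma>) z =
     (if \<forall>j<n. N dvd \<gamma> j
      then (1 / real N) *\<^sub>R (\<Sum>t<N. cis (2 * pi * real t / real N) ^ \<gamma> n * monom_val n' z \<gamma>) else 0)"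
  proof (cases "\<forall>j<n. N dvd \<gamma> j")
    case True
    then show ?thesis using Suc.prems by (simp add: IH monom_val_upd)
  next
    case False
    show ?thesis unfolding torus_avg.simps IH if_not_P[OF False] by simp
  qed
  also have "\<dots> = (if \<forall>j<Suc n. N dvd \<gamma> j then monom_val n' z \<gamma> else 0)"
    using assms(1) by (simp add: sum_cis_powers less_Suc_eq flip: sum_distrib_right)
      (auto simp: scaleR_conv_of_real)
  finally show ?case .
qed simp

section \<open>One-variable inequalities\<close>

text \<open>A conjugate k-th power of an N-th root of unity is its power N - k, and j + (N - k) lies
  strictly between 0 and 2N, so N divides it only if it equals N.\<close>

lemma sum_cis_mixed:
  assumes "j \<le> d" "k \<le> d" "2 * d < N"
  shows "(\<Sum>t<N. cis (2 * pi * real t / real N) ^ j * cnj (cis (2 * pi * real t / real N)) ^ k)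
      = (if j = k then of_nat N else 0)"
proof -
  have N: "N > 0" using assms by simp
  have eq: "cis (2 * pi * real t / real N) ^ j * cnj (cis (2 * pi * real t / real N)) ^ k =
       cis (2 * pi * real t / real N) ^ (j + (N - k))" for t
  proof -
    define w where "w = cis (2 * pi * real t / real N)"
    have wN: "w ^ N = 1"
      using N cis_multiple_2pi[of "real t"] unfolding w_def by (simp only: Complex.DeMoivre) (simp add: mult_ac)
    have w1: "cnj w * w = 1" unfolding w_def by (simp add: cis_cnj cis_mult)
    have "w ^ (j + (N - k)) = w ^ j * (cnj w * w) ^ k * w ^ (N - k)"
      by (simp add: w1 power_add)
    also have "\<dots> = w ^ j * cnj w ^ k * (w ^ k * w ^ (N - k))"
      by (simp add: power_mult_distrib mult_ac)
    also have "w ^ k * w ^ (N - k) = 1"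
      using wN assms by (simp flip: power_add)
    finally show ?thesis unfolding w_def by simp
  qed
  have "N dvd j + (N - k) \<longleftrightarrow> j = k"
  proof
    assume "N dvd j + (N - k)"
    then obtain q where q: "j + (N - k) = N * q" by blast
    have "q < 2"
    proof (rule ccontr)
      assume "\<not> q < 2"
      then have "N * 2 \<le> N * q" by simp
      moreover have "N * 2 > j + (N - k)" using assms by simp
      ultimately show False using q by linarith
    qed
    moreover have "q \<noteq> 0" using q assms by (intro notI) simp
    ultimately have "q = 1" by simp
    then show "j = k" using q assms by simp
  qed (use assms in simp)
  then show ?thesis unfolding eq sum_cis_powers[OF N] by simp
qed

lemma sum_roots_coeff:
  fixes c :: "nat \<Rightarrow> complex"
  assumes i: "i \<le> d" and N: "2 * d < N"
  shows "(\<Sum>t<N. (\<Sum>j\<le>d. c j * cis (2 * pi * real t / real N) ^ j) * cnj (cis (2 * pi * real t / real N)) ^ i)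
    = of_nat N * c i"
proof -
  define w where "w t = cis (2 * pi * real t / real N)" for t
  have "(\<Sum>t<N. (\<Sum>j\<le>d. c j * w t ^ j) * cnj (w t) ^ i) = (\<Sum>j\<le>d. c j * (\<Sum>t<N. w t ^ j * cnj (w t) ^ i))"
    unfolding sum_distrib_right sum_distrib_left by (subst sum.swap) (simp add: mult_ac)
  also have "\<dots> = (\<Sum>j\<le>d. c j * (if j = i then of_nat N else 0))"
    unfolding w_def by (intro sum.cong refl) (use i N in \<open>simp add: sum_cis_mixed\<close>)
  finally show ?thesis using i by (simp add: w_def mult_ac if_distrib[where f="\<lambda>x. _ * x"] cong: if_cong)
qed

text \<open>An analytic polynomial has no negative frequencies. On N-th roots of unity this is
  aliasing-safe because 0 < j + k \<le> 2d < N.\<close>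

lemma sum_roots_conj_coeff:
  fixes c :: "nat \<Rightarrow> complex"
  assumes k: "1 \<le> k" "k \<le> d" and N: "2 * d < N"
  shows "(\<Sum>t<N. (\<Sum>j\<le>d. c j * cis (2 * pi * real t / real N) ^ j) * cis (2 * pi * real t / real N) ^ k) = 0"
proof -
  define w where "w t = cis (2 * pi * real t / real N)" for t
  have "(\<Sum>t<N. (\<Sum>j\<le>d. c j * w t ^ j) * w t ^ k) = (\<Sum>j\<le>d. c j * (\<Sum>t<N. w t ^ (j + k)))"
    unfolding sum_distrib_right sum_distrib_left
    by (subst sum.swap) (simp add: mult_ac power_add)
  also have "\<dots> = 0"
  proof (rule sum.neutral, rule ballI)
    fix j assume "j \<in> {..d}"
    then have "\<not> N dvd j + k" using k N by (auto dest: dvd_imp_le)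
    then show "c j * (\<Sum>t<N. w t ^ (j + k)) = 0"
      using sum_cis_powers[of N "j + k"] N by (simp add: w_def)
  qed
  finally show ?thesis by (simp add: w_def)
qed

text \<open>Testing against the function \<open>1 + \<delta> (e x\<^sup>k - cnj (e x\<^sup>k))\<close>, whose modulus is at most
  \<open>sqrt (1 + 4 \<delta>\<^sup>2)\<close> because the perturbation is purely imaginary; the conjugate
  term pairs to zero with an analytic polynomial.\<close>

lemma L1_avg_two_coeffs:
  fixes c :: "nat \<Rightarrow> complex"
  assumes k: "1 \<le> k" "k \<le> d" and N: "2 * d < N"
  defines "A \<equiv> (\<Sum>t<N. cmod (\<Sum>j\<le>d. c j * cis (2 * pi * real t / real N) ^ j)) / real N"
  shows "(cmod (c 0))\<^sup>2 + (cmod (c k))\<^sup>2 / 4 \<le> A\<^sup>2"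
proof -
  define w where "w t = cis (2 * pi * real t / real N)" for t
  define f where "f t = (\<Sum>j\<le>d. c j * w t ^ j)" for t
  have N0: "N > 0" using N by simp
  have A: "A * real N = (\<Sum>t<N. cmod (f t))"
    unfolding A_def f_def w_def using N0 by simp
  have A0: "A \<ge> 0" unfolding A_def by (simp add: sum_nonneg)
  have coeff: "(\<Sum>t<N. f t * cnj (w t) ^ i) = of_nat N * c i" if "i \<le> d" for i
    unfolding f_def w_def by (rule sum_roots_coeff[OF that N])
  have coeff': "(\<Sum>t<N. f t * w t ^ k) = 0"
    unfolding f_def w_def by (rule sum_roots_conj_coeff[OF k N])
  have key: "cmod (c 0) + \<delta> * cmod (c k) \<le> A * sqrt (1 + 4 * \<delta>\<^sup>2)" if "\<delta> \<ge> 0" for \<delta>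
  proof -
    obtain u where u: "cmod u = 1" "c 0 = of_real (cmod (c 0)) * u"
      by (metis cis_rcis_eq norm_cis rcis_cmod_Arg rcis_def)
    obtain v where v: "cmod v = 1" "c k = of_real (cmod (c k)) * v"
      by (metis cis_rcis_eq norm_cis rcis_cmod_Arg rcis_def)
    have uu: "u * cnj u = 1" and vv: "v * cnj v = 1"
      using u(1) v(1) by (simp_all add: complex_norm_square[symmetric])
    \<comment> \<open>This phase turns the contribution of \<open>c k\<close> onto the direction of
      \<open>c 0\<close>, so that the two moduli add.\<close>
    define e where "e = u * cnj v"
    define h where "h t = e * cnj (w t) ^ k - cnj e * w t ^ k" for t
    have bd: "cmod (1 + of_real \<delta> * h t) \<le> sqrt (1 + 4 * \<delta>\<^sup>2)" for t
    proof -
      define q where "q = e * cnj (w t) ^ k"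
      have "cmod q = 1" unfolding q_def e_def w_def by (simp add: norm_mult norm_power u v)
      have "h t = q - cnj q" unfolding h_def q_def by simp
      then have re: "Re (h t) = 0" and im: "Im (h t) = 2 * Im q" by simp_all
      have "(Im q)\<^sup>2 \<le> 1"
        using \<open>cmod q = 1\<close> cmod_power2[of q] by (smt (verit) one_power2 zero_le_power2)
      then have "(cmod (1 + of_real \<delta> * h t))\<^sup>2 \<le> 1 + 4 * \<delta>\<^sup>2"
        unfolding cmod_power2 by (simp add: re im power_mult_distrib mult_left_le)
      then show ?thesis by (simp add: real_le_rsqrt)
    qed
    have "(\<Sum>t<N. f t * (1 + of_real \<delta> * h t)) =
        (\<Sum>t<N. f t) + of_real \<delta> * e * (\<Sum>t<N. f t * cnj (w t) ^ k)
          - of_real \<delta> * cnj e * (\<Sum>t<N. f t * w t ^ k)"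
      unfolding h_def sum_distrib_left by (simp add: algebra_simps sum.distrib sum_subtractf)
    also have "\<dots> = of_nat N * (c 0 + of_real \<delta> * e * c k)"
      using coeff[of 0] coeff[of k] coeff' k by (simp add: algebra_simps)
    also have "c 0 + of_real \<delta> * e * c k = of_real (cmod (c 0) + \<delta> * cmod (c k)) * u"
      using vv u(2) v(2) unfolding e_def by (simp add: algebra_simps) (metis (no_types, lifting) mult.assoc mult.commute mult.right_neutral)
    finally have "real N * (cmod (c 0) + \<delta> * cmod (c k)) = cmod (\<Sum>t<N. f t * (1 + of_real \<delta> * h t))"
      using that u(1) by (simp add: norm_mult del: of_real_add of_real_mult)
    also have "\<dots> \<le> (\<Sum>t<N. cmod (f t) * sqrt (1 + 4 * \<delta>\<^sup>2))"
      by (rule order.trans[OF norm_sum]) (auto intro!: sum_mono mult_left_mono bd simp: norm_mult)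
    also have "\<dots> = real N * (A * sqrt (1 + 4 * \<delta>\<^sup>2))"
      unfolding sum_distrib_right[symmetric] A[symmetric] by (simp only: mult_ac)
    finally show ?thesis using N0 by simp
  qed
  show ?thesis
  proof (cases "c 0 = 0")
    \<comment> \<open>The optimal \<delta> used below would be infinite here; the plain coefficient
      bound replaces it.\<close>
    case True
    have "real N * cmod (c k) = cmod (\<Sum>t<N. f t * cnj (w t) ^ k)"
      using coeff[of k] k by (simp add: norm_mult)
    also have "\<dots> \<le> (\<Sum>t<N. cmod (f t))"
      by (rule order.trans[OF norm_sum]) (simp add: norm_mult norm_power w_def)
    also have "\<dots> = real N * A" using A by (simp only: mult.commute)
    finally have "cmod (c k) \<le> A" using N0 by simp
    then have "(cmod (c k))\<^sup>2 \<le> A\<^sup>2" by (simp add: power_mono)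
    moreover have "(cmod (c k))\<^sup>2 / 4 \<le> (cmod (c k))\<^sup>2" by simp
    ultimately have "(cmod (c k))\<^sup>2 / 4 \<le> A\<^sup>2" by (rule order.trans[rotated])
    then show ?thesis using True by simp
  next
    case False
    define a where "a = cmod (c 0)"
    define b where "b = cmod (c k)"
    have a: "a > 0" using False by (simp add: a_def)
    \<comment> \<open>The maximizer of (a + \<delta> b) / sqrt(1 + 4 \<delta>^2); the maximum is
      sqrt(a^2 + b^2/4).\<close>
    define \<delta> where "\<delta> = b / (4 * a)"
    define S where "S = a\<^sup>2 + b\<^sup>2 / 4"
    have S: "S > 0" unfolding S_def using a by (simp add: add_pos_nonneg)
    have e1: "a + \<delta> * b = S / a" unfolding \<delta>_def S_def using a by (simp add: field_simps power2_eq_square)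
    have e2: "1 + 4 * \<delta>\<^sup>2 = S / a\<^sup>2" unfolding \<delta>_def S_def using a by (simp add: field_simps power2_eq_square)
    have "a + \<delta> * b \<le> A * sqrt (1 + 4 * \<delta>\<^sup>2)"
      unfolding a_def b_def by (rule key) (use a in \<open>simp add: \<delta>_def b_def\<close>)
    then have "S / a \<le> A * sqrt S / a" unfolding e1 e2 using a by (simp add: real_sqrt_divide)
    then have "S \<le> A * sqrt S" using a by (simp add: divide_le_cancel)
    then have "sqrt S * sqrt S \<le> A * sqrt S" using S by simp
    then have "sqrt S \<le> A" by (rule mult_right_le_imp_le) (use S in simp)
    then have "S \<le> A\<^sup>2" using S by (simp add: sqrt_le_D)
    then show ?thesis by (simp add: S_def a_def b_def)
  qed
qed

text \<open>Test against the nonnegative kernel 1 + Re(e x^k), which has mean 1. The pairing is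
  therefore at most M in modulus, and with the phase e chosen to align \<open>c k\<close> with
  \<open>c 0\<close> it has modulus |c_0| + |c_k|/2.\<close>

lemma coeff_le_twice_defect:
  fixes c :: "nat \<Rightarrow> complex"
  assumes k: "1 \<le> k" "k \<le> d"
    and bd: "\<And>l. cmod l = 1 \<Longrightarrow> cmod (\<Sum>j\<le>d. c j * l ^ j) \<le> M"
  shows "cmod (c k) \<le> 2 * (M - cmod (c 0))"
proof -
  define N where "N = Suc (2 * d)"
  have N: "2 * d < N" by (simp add: N_def)
  define w where "w t = cis (2 * pi * real t / real N)" for t
  define f where "f t = (\<Sum>j\<le>d. c j * w t ^ j)" for t
  have coeff: "(\<Sum>t<N. f t * cnj (w t) ^ i) = of_nat N * c i" if "i \<le> d" for i
    unfolding f_def w_def by (rule sum_roots_coeff[OF that N])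
  have coeff': "(\<Sum>t<N. f t * w t ^ k) = 0"
    unfolding f_def w_def by (rule sum_roots_conj_coeff[OF k N])
  obtain u where u: "cmod u = 1" "c 0 = of_real (cmod (c 0)) * u"
    by (metis cis_rcis_eq norm_cis rcis_cmod_Arg rcis_def)
  obtain v where v: "cmod v = 1" "c k = of_real (cmod (c k)) * v"
    by (metis cis_rcis_eq norm_cis rcis_cmod_Arg rcis_def)
  have vv: "v * cnj v = 1" using v(1) by (simp add: complex_norm_square[symmetric])
  define e where "e = u * cnj v"
  define q where "q t = e * cnj (w t) ^ k" for t
  have q1: "cmod (q t) = 1" for t
    by (simp add: q_def e_def w_def norm_mult norm_power u v)
  have pos: "1 + Re (q t) \<ge> 0" for t
    using abs_Re_le_cmod[of "q t"] q1[of t] by linarith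
  have sum_q: "(\<Sum>t<N. q t) = 0"
  proof -
    have "\<not> N dvd k" using k by (auto simp: N_def dest: dvd_imp_le)
    then have "(\<Sum>t<N. w t ^ k) = 0" using sum_cis_powers[of N k] N by (simp add: w_def)
    then have "cnj (\<Sum>t<N. w t ^ k) = 0" by simp
    then show ?thesis unfolding q_def sum_distrib_left[symmetric] by simp
  qed
  have kernel: "of_real (1 + Re (q t)) = 1 + e / 2 * cnj (w t) ^ k + cnj e / 2 * w t ^ k" for t
  proof -
    have "complex_of_real (Re (q t)) = (q t + cnj (q t)) / 2" by (simp add: complex_add_cnj)
    then show ?thesis by (simp add: q_def add_divide_distrib)
  qed
  have "(\<Sum>t<N. f t * of_real (1 + Re (q t))) =
      (\<Sum>t<N. f t) + e / 2 * (\<Sum>t<N. f t * cnj (w t) ^ k) + cnj e / 2 * (\<Sum>t<N. f t * w t ^ k)"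
    unfolding kernel sum_distrib_left by (simp add: algebra_simps sum.distrib)
  also have "\<dots> = of_nat N * (c 0 + e / 2 * c k)"
    using coeff[of 0] coeff[of k] coeff' k by (simp add: algebra_simps)
  also have "c 0 + e / 2 * c k = of_real (cmod (c 0) + cmod (c k) / 2) * u"
  proof -
    have "e * c k = of_real (cmod (c k)) * u * (v * cnj v)"
      using v(2) unfolding e_def by (simp add: mult_ac)
    then show ?thesis using u(2) vv by (simp add: algebra_simps)
  qed
  finally have "real N * (cmod (c 0) + cmod (c k) / 2) = cmod (\<Sum>t<N. f t * of_real (1 + Re (q t)))"
    using u(1) by (simp add: norm_mult del: of_real_add)
  also have "\<dots> \<le> (\<Sum>t<N. M * (1 + Re (q t)))"
  proof (rule order.trans[OF norm_sum], rule sum_mono)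
    fix t
    have "cmod (f t) \<le> M" unfolding f_def by (rule bd) (simp add: w_def)
    then show "cmod (f t * of_real (1 + Re (q t))) \<le> M * (1 + Re (q t))"
      using pos[of t] by (simp add: norm_mult mult_right_mono del: of_real_add)
  qed
  also have "\<dots> = M * (real N + Re (\<Sum>t<N. q t))"
    by (simp only: sum_distrib_left[symmetric] sum.distrib Re_sum) simp
  finally have "real N * (cmod (c 0) + cmod (c k) / 2) \<le> real N * M" by (simp add: sum_q mult.commute)
  then have "cmod (c 0) + cmod (c k) / 2 \<le> M" using N by simp
  then show ?thesis by simp
qed

text \<open>The weights are summable uniformly in \<open>m\<close> and, being symmetric under \<open>k \<mapsto> m - k\<close>, are of
  order one at both ends; a weight decaying in \<open>k\<close> alone would cost too much on monomials such as
  \<open>z\<^sub>i\<^sup>m\<^sup>-\<^sup>1 z\<^sub>j\<close>.\<close>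

definition fold_deg :: "nat \<Rightarrow> nat \<Rightarrow> nat" where
  "fold_deg m k = max 1 (min k (m - k))"

definition wt :: "nat \<Rightarrow> nat \<Rightarrow> real" where
  "wt m k = (if k = 0 then 1 else 1 / (16 * (real (fold_deg m k))\<^sup>2))"

lemma wt_pos: "wt m k > 0"
  by (simp add: wt_def fold_deg_def)

lemma sum_inverse_squares_le: "(\<Sum>k=1..d. 1 / (real k)\<^sup>2) \<le> 2"
proof -
  have "(\<Sum>k=1..Suc e. 1 / (real k)\<^sup>2) \<le> 2 - 1 / real (Suc e)" for e
  proof (induction e)
    case (Suc e)
    have "1 / (real (Suc (Suc e)))\<^sup>2 + 1 / real (Suc (Suc e)) \<le> 1 / real (Suc e)"
      by (simp add: divide_simps power2_eq_square) (simp add: algebra_simps)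
    then show ?case using Suc by simp
  qed simp
  then show ?thesis
    by (cases d) (simp, smt (verit) divide_nonneg_nonneg of_nat_0_le_iff)
qed

text \<open>This fixes the constant 16 in \<open>wt\<close>: 4 \<open>wt\<close> is at most a
  quarter of 1/k^2 + 1/(m-k)^2, and each of the two sums is at most 2.\<close>

lemma sum_wt_le: "(\<Sum>k=1..d. 4 * wt (Suc d) k) \<le> 1"
proof -
  have "(\<Sum>k=1..d. 4 * wt (Suc d) k) \<le> (\<Sum>k=1..d. 1 / 4 * (1 / (real k)\<^sup>2 + 1 / (real (Suc d - k))\<^sup>2))"
  proof (rule sum_mono)
    fix k assume k: "k \<in> {1..d}"
    then have "fold_deg (Suc d) k = k \<or> fold_deg (Suc d) k = Suc d - k"
      by (auto simp: fold_deg_def)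
    then show "4 * wt (Suc d) k \<le> 1 / 4 * (1 / (real k)\<^sup>2 + 1 / (real (Suc d - k))\<^sup>2)"
      using k by (auto simp: wt_def)
  qed
  also have "\<dots> = 1 / 4 * ((\<Sum>k=1..d. 1 / (real k)\<^sup>2) + (\<Sum>k=1..d. 1 / (real (Suc d - k))\<^sup>2))"
    by (simp only: sum_distrib_left[symmetric] sum.distrib)
  also have "(\<Sum>k=1..d. 1 / (real (Suc d - k))\<^sup>2) = (\<Sum>k=1..d. 1 / (real k)\<^sup>2)"
    by (rule sum.reindex_bij_witness[of _ "\<lambda>k. Suc d - k" "\<lambda>k. Suc d - k"]) auto
  finally show ?thesis using sum_inverse_squares_le[of d] by simp
qed

text \<open>A convex combination of the two-coefficient inequalities with masses \<open>p k\<close>;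
  the remaining mass is put on |c_0| \<le> A. In this way c_0 keeps its full weight 1, so a variable
  that does not occur costs nothing.\<close>

lemma L1_avg_ge_weighted_L2:
  fixes c :: "nat \<Rightarrow> complex"
  assumes N: "2 * d < N"
  shows "sqrt (\<Sum>j\<le>d. wt (Suc d) j * (cmod (c j * x ^ j))\<^sup>2) \<le>
    (\<Sum>t<N. cmod (\<Sum>j\<le>d. c j * (cis (2 * pi * real t / real N) * x) ^ j)) / real N"
proof -
  define b where "b j = c j * x ^ j" for j
  define A where "A = (\<Sum>t<N. cmod (\<Sum>j\<le>d. b j * cis (2 * pi * real t / real N) ^ j)) / real N"
  have A_eq: "A = (\<Sum>t<N. cmod (\<Sum>j\<le>d. c j * (cis (2 * pi * real t / real N) * x) ^ j)) / real N"
    unfolding A_def b_def by (simp add: power_mult_distrib mult_ac)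
  have A0: "A \<ge> 0" unfolding A_def by (simp add: sum_nonneg)
  define p where "p k = 4 * wt (Suc d) k" for k
  have p0: "p k \<ge> 0" for k unfolding p_def using wt_pos[of "Suc d" k] by simp
  have p1: "(\<Sum>k=1..d. p k) \<le> 1" unfolding p_def by (rule sum_wt_le)
  have b0: "(cmod (b 0))\<^sup>2 \<le> A\<^sup>2"
  proof -
    have "real N * cmod (b 0) = cmod (\<Sum>t<N. \<Sum>j\<le>d. b j * cis (2 * pi * real t / real N) ^ j)"
      using sum_roots_coeff[of 0 d N b] N by (simp add: norm_mult)
    also have "\<dots> \<le> real N * A"
      unfolding A_def using N by (auto intro: order.trans[OF norm_sum])
    finally have "cmod (b 0) \<le> A" using N by simp
    then show ?thesis by (simp add: power_mono)
  qed
  have "(\<Sum>j\<le>d. wt (Suc d) j * (cmod (b j))\<^sup>2) = (cmod (b 0))\<^sup>2 + (\<Sum>j=1..d. wt (Suc d) j * (cmod (b j))\<^sup>2)"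
    by (simp add: sum.atMost_shift sum.atLeast1_atMost_eq lessThan_Suc_atMost wt_def)
  also have "\<dots> = (1 - (\<Sum>k=1..d. p k)) * (cmod (b 0))\<^sup>2
      + (\<Sum>k=1..d. p k * ((cmod (b 0))\<^sup>2 + (cmod (b k))\<^sup>2 / 4))"
    by (simp add: p_def algebra_simps sum.distrib sum_distrib_left)
  also have "\<dots> \<le> (1 - (\<Sum>k=1..d. p k)) * A\<^sup>2 + (\<Sum>k=1..d. p k * A\<^sup>2)"
  proof (intro add_mono mult_left_mono sum_mono b0 p0)
    fix k assume "k \<in> {1..d}"
    then show "(cmod (b 0))\<^sup>2 + (cmod (b k))\<^sup>2 / 4 \<le> A\<^sup>2"
      unfolding A_def using L1_avg_two_coeffs[of k d N b] N by simp
  qed (use p1 in simp)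
  also have "\<dots> = A\<^sup>2" by (simp add: algebra_simps sum_distrib_left sum_distrib_right)
  finally have "sqrt (\<Sum>j\<le>d. wt (Suc d) j * (cmod (b j))\<^sup>2) \<le> A"
    using A0 by (simp add: real_le_lsqrt sum_nonneg wt_pos less_imp_le)
  then show ?thesis unfolding A_eq b_def .
qed

section \<open>Weighted square functions on the torus\<close>

lemma exp_box_0: "exp_box 0 d = {\<lambda>_. 0}"
  by (auto simp: exp_box_def)

lemma exp_box_Suc: "exp_box (Suc n) d = (\<lambda>(\<gamma>, k). \<gamma>(n := k)) ` (exp_box n d \<times> {..d})"
proof (intro equalityI subsetI)
  fix \<gamma> assume "\<gamma> \<in> exp_box (Suc n) d"
  then have "(\<gamma>(n := 0), \<gamma> n) \<in> exp_box n d \<times> {..d}"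
    by (auto simp: exp_box_def)
  then show "\<gamma> \<in> (\<lambda>(\<gamma>, k). \<gamma>(n := k)) ` (exp_box n d \<times> {..d})"
    by (intro rev_image_eqI) auto
qed (auto simp: exp_box_def less_Suc_eq)

lemma inj_on_exp_box_Suc: "inj_on (\<lambda>(\<gamma>, k). \<gamma>(n := k)) (exp_box n d \<times> {..d})"
proof (rule inj_onI, clarsimp)
  fix \<gamma> \<gamma>' k k' assume 1: "\<gamma> \<in> exp_box n d" "\<gamma>' \<in> exp_box n d" and 2: "\<gamma>(n := k) = \<gamma>'(n := k')"
  have "\<gamma> j = \<gamma>' j" for j
    using 1 fun_cong[OF 2, of j] by (cases "j = n") (auto simp: exp_box_def)
  then show "\<gamma> = \<gamma>' \<and> k = k'" using fun_cong[OF 2, of n] by auto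
qed

lemma finite_exp_box [simp]: "finite (exp_box n d)"
  by (induction n) (auto simp: exp_box_0 exp_box_Suc)

lemma sum_exp_box_Suc: "(\<Sum>\<gamma>\<in>exp_box (Suc n) d. f \<gamma>) = (\<Sum>\<gamma>\<in>exp_box n d. \<Sum>k\<le>d. f (\<gamma>(n := k)))"
  unfolding exp_box_Suc
  by (subst sum.reindex[OF inj_on_exp_box_Suc]) (simp add: sum.cartesian_product case_prod_unfold o_def)

lemma monom_val_Suc_upd:
  "monom_val (Suc n) z (\<gamma>(n := k)) = monom_val n z \<gamma> * z n ^ k"
  by (simp add: monom_val_def)

lemma L2_set_sum_le:
  assumes "\<And>i t. i \<in> A \<Longrightarrow> t \<in> T \<Longrightarrow> 0 \<le> f i t"
  shows "L2_set (\<lambda>i. \<Sum>t\<in>T. f i t) A \<le> (\<Sum>t\<in>T. L2_set (\<lambda>i. f i t) A)"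
proof (induction T rule: infinite_finite_induct)
  case (insert t T)
  have "L2_set (\<lambda>i. \<Sum>t\<in>insert t T. f i t) A = L2_set (\<lambda>i. f i t + (\<Sum>t\<in>T. f i t)) A"
    using insert by simp
  also have "\<dots> \<le> L2_set (\<lambda>i. f i t) A + L2_set (\<lambda>i. \<Sum>t\<in>T. f i t) A"
    by (rule L2_set_triangle_ineq)
  finally show ?case using insert by simp
qed (simp_all add: L2_set_0')

text \<open>Tensorization by induction on the variables: the one-variable inequality has constant 1,
  so only the weights multiply. With the last variable frozen, the induction hypothesis applies to
  coefficients that are polynomials in it, and Minkowski's inequality interchanges the l2 sum over
  \<gamma> with the average over its rotations.\<close>

lemma torus_L1_ge_weighted_L2:
  fixes c :: "(nat \<Rightarrow> nat) \<Rightarrow> complex"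
  assumes N: "2 * d < N"
  shows "sqrt (\<Sum>\<gamma>\<in>exp_box n d. (\<Prod>j<n. wt (Suc d) (\<gamma> j)) * (cmod (c \<gamma> * monom_val n z \<gamma>))\<^sup>2)
    \<le> torus_avg N n (\<lambda>z. cmod (\<Sum>\<gamma>\<in>exp_box n d. c \<gamma> * monom_val n z \<gamma>)) z"
proof (induction n arbitrary: z c)
  case 0
  show ?case by (simp add: exp_box_0)
next
  case (Suc n)
  define W where "W \<gamma> = (\<Prod>j<n. wt (Suc d) (\<gamma> j))" for \<gamma>
  have W0: "W \<gamma> \<ge> 0" for \<gamma> unfolding W_def by (simp add: prod_nonneg wt_pos less_imp_le)
  define \<zeta> where "\<zeta> t = cis (2 * pi * real t / real N)" for t
  define C where "C \<gamma> x = (\<Sum>k\<le>d. c (\<gamma>(n := k)) * x ^ k)" for \<gamma> x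
  define m where "m \<gamma> = cmod (monom_val n z \<gamma>)" for \<gamma>
  have mon_indep: "monom_val n (z(n := x)) \<gamma> = monom_val n z \<gamma>" for x \<gamma>
    by (simp add: monom_val_def)
  have upd: "(\<Prod>j<Suc n. wt (Suc d) ((\<gamma>(n := k)) j)) = W \<gamma> * wt (Suc d) k" for \<gamma> k
    by (simp add: W_def)
  have inner: "sqrt (\<Sum>\<gamma>\<in>exp_box n d. W \<gamma> * (cmod (C \<gamma> (\<zeta> t * z n)) * m \<gamma>)\<^sup>2)
    \<le> torus_avg N n (\<lambda>z. cmod (\<Sum>\<gamma>\<in>exp_box (Suc n) d. c \<gamma> * monom_val (Suc n) z \<gamma>)) (z(n := \<zeta> t * z n))"
    for t
  proof -
    have "torus_avg N n (\<lambda>z. cmod (\<Sum>\<gamma>\<in>exp_box (Suc n) d. c \<gamma> * monom_val (Suc n) z \<gamma>)) (z(n := \<zeta> t * z n))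
      = torus_avg N n (\<lambda>z'. cmod (\<Sum>\<gamma>\<in>exp_box n d. C \<gamma> (\<zeta> t * z n) * monom_val n z' \<gamma>)) (z(n := \<zeta> t * z n))"
    proof (rule torus_avg_cong)
      fix z' assume "\<And>j. n \<le> j \<Longrightarrow> z' j = (z(n := \<zeta> t * z n)) j"
      then have "z' n = \<zeta> t * z n" by simp
      then show "cmod (\<Sum>\<gamma>\<in>exp_box (Suc n) d. c \<gamma> * monom_val (Suc n) z' \<gamma>) =
         cmod (\<Sum>\<gamma>\<in>exp_box n d. C \<gamma> (\<zeta> t * z n) * monom_val n z' \<gamma>)"
        unfolding sum_exp_box_Suc C_def monom_val_Suc_upd by (simp add: sum_distrib_left sum_distrib_right mult_ac)
    qed
    then show ?thesis
      using Suc[of "\<lambda>\<gamma>. C \<gamma> (\<zeta> t * z n)" "z(n := \<zeta> t * z n)"]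
      by (simp add: W_def m_def mon_indep norm_mult del: fun_upd_apply)
  qed
  have "(\<Sum>\<gamma>\<in>exp_box (Suc n) d. (\<Prod>j<Suc n. wt (Suc d) (\<gamma> j)) * (cmod (c \<gamma> * monom_val (Suc n) z \<gamma>))\<^sup>2)
      = (\<Sum>\<gamma>\<in>exp_box n d. W \<gamma> * (m \<gamma>)\<^sup>2 * (\<Sum>k\<le>d. wt (Suc d) k * (cmod (c (\<gamma>(n := k)) * z n ^ k))\<^sup>2))"
    unfolding sum_exp_box_Suc upd monom_val_Suc_upd m_def
    by (simp add: sum_distrib_left norm_mult power_mult_distrib mult_ac)
  also have "\<dots> \<le> (\<Sum>\<gamma>\<in>exp_box n d. W \<gamma> * (m \<gamma>)\<^sup>2 * ((\<Sum>t<N. cmod (C \<gamma> (\<zeta> t * z n))) / real N)\<^sup>2)"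
  proof (intro sum_mono mult_left_mono)
    fix \<gamma> 
    show "(\<Sum>k\<le>d. wt (Suc d) k * (cmod (c (\<gamma>(n := k)) * z n ^ k))\<^sup>2)
        \<le> ((\<Sum>t<N. cmod (C \<gamma> (\<zeta> t * z n))) / real N)\<^sup>2"
      using L1_avg_ge_weighted_L2[OF N, of "\<lambda>k. c (\<gamma>(n := k))" "z n"]
      unfolding C_def \<zeta>_def by (rule sqrt_le_D)
  qed (simp add: W0)
  also have "\<dots> = (L2_set (\<lambda>\<gamma>. \<Sum>t<N. sqrt (W \<gamma>) * (m \<gamma> * cmod (C \<gamma> (\<zeta> t * z n)) / real N)) (exp_box n d))\<^sup>2"
    unfolding L2_set_def
    by (subst real_sqrt_pow2)
      (auto intro!: sum_nonneg sum.cong divide_nonneg_nonneg mult_nonneg_nonneg simp: W0 power_mult_distrib power_divide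
        simp flip: sum_distrib_left sum_divide_distrib)
  finally have "sqrt (\<Sum>\<gamma>\<in>exp_box (Suc n) d. (\<Prod>j<Suc n. wt (Suc d) (\<gamma> j)) * (cmod (c \<gamma> * monom_val (Suc n) z \<gamma>))\<^sup>2)
      \<le> L2_set (\<lambda>\<gamma>. \<Sum>t<N. sqrt (W \<gamma>) * (m \<gamma> * cmod (C \<gamma> (\<zeta> t * z n)) / real N)) (exp_box n d)"
    by (intro real_le_lsqrt) auto
  \<comment> \<open>Minkowski: the l2 norm of an average is at most the average of the l2
    norms.\<close>
  also have "\<dots> \<le> (\<Sum>t<N. L2_set (\<lambda>\<gamma>. sqrt (W \<gamma>) * (m \<gamma> * cmod (C \<gamma> (\<zeta> t * z n)) / real N)) (exp_box n d))"
    by (rule L2_set_sum_le) (simp add: W0 m_def)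
  also have "\<dots> = (\<Sum>t<N. (1 / real N) * sqrt (\<Sum>\<gamma>\<in>exp_box n d. W \<gamma> * (cmod (C \<gamma> (\<zeta> t * z n)) * m \<gamma>)\<^sup>2))"
  proof (rule sum.cong[OF refl])
    fix t
    have "L2_set (\<lambda>\<gamma>. sqrt (W \<gamma>) * (m \<gamma> * cmod (C \<gamma> (\<zeta> t * z n)) / real N)) (exp_box n d)
       = L2_set (\<lambda>\<gamma>. (1 / real N) * (sqrt (W \<gamma>) * (cmod (C \<gamma> (\<zeta> t * z n)) * m \<gamma>))) (exp_box n d)"
      by (simp add: mult_ac)
    also have "\<dots> = (1 / real N) * L2_set (\<lambda>\<gamma>. sqrt (W \<gamma>) * (cmod (C \<gamma> (\<zeta> t * z n)) * m \<gamma>)) (exp_box n d)"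
      by (simp only: L2_set_right_distrib[symmetric] zero_le_divide_1_iff of_nat_0_le_iff)
    also have "L2_set (\<lambda>\<gamma>. sqrt (W \<gamma>) * (cmod (C \<gamma> (\<zeta> t * z n)) * m \<gamma>)) (exp_box n d)
       = sqrt (\<Sum>\<gamma>\<in>exp_box n d. W \<gamma> * (cmod (C \<gamma> (\<zeta> t * z n)) * m \<gamma>)\<^sup>2)"
      unfolding L2_set_def by (simp add: W0 power_mult_distrib)
    finally show "L2_set (\<lambda>\<gamma>. sqrt (W \<gamma>) * (m \<gamma> * cmod (C \<gamma> (\<zeta> t * z n)) / real N)) (exp_box n d)
       = (1 / real N) * sqrt (\<Sum>\<gamma>\<in>exp_box n d. W \<gamma> * (cmod (C \<gamma> (\<zeta> t * z n)) * m \<gamma>)\<^sup>2)" .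
  qed
  also have "\<dots> \<le> (\<Sum>t<N. (1 / real N) * torus_avg N n
      (\<lambda>z. cmod (\<Sum>\<gamma>\<in>exp_box (Suc n) d. c \<gamma> * monom_val (Suc n) z \<gamma>)) (z(n := \<zeta> t * z n)))"
    by (intro sum_mono mult_left_mono inner) simp
  also have "\<dots> = torus_avg N (Suc n) (\<lambda>z. cmod (\<Sum>\<gamma>\<in>exp_box (Suc n) d. c \<gamma> * monom_val (Suc n) z \<gamma>)) z"
    by (simp add: \<zeta>_def sum_distrib_left)
  finally show ?case .
qed

section \<open>Polarization\<close>

definition hpoly :: "nat \<Rightarrow> nat \<Rightarrow> ((nat \<Rightarrow> nat) \<Rightarrow> complex) \<Rightarrow> (nat \<Rightarrow> complex) \<Rightarrow> complex" where
  "hpoly m n a z = (\<Sum>\<gamma>\<in>exps m n. a \<gamma> * monom_val n z \<gamma>)"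

definition multinom :: "nat \<Rightarrow> nat \<Rightarrow> (nat \<Rightarrow> nat) \<Rightarrow> real" where
  "multinom m n \<gamma> = fact m / (\<Prod>j<n. fact (\<gamma> j))"

definition bw_sq :: "nat \<Rightarrow> nat \<Rightarrow> ((nat \<Rightarrow> nat) \<Rightarrow> complex) \<Rightarrow> real" where
  "bw_sq m n a = (\<Sum>\<gamma>\<in>exps m n. (cmod (a \<gamma>))\<^sup>2 / multinom m n \<gamma>)"

text \<open>If \<gamma> i = 0, truncated subtraction leaves \<gamma> unchanged; such terms carry the
  factor \<gamma> i = 0 in \<open>hpoly_partial\<close>.\<close>

definition lower :: "nat \<Rightarrow> (nat \<Rightarrow> nat) \<Rightarrow> nat \<Rightarrow> nat" where
  "lower i \<gamma> = \<gamma>(i := \<gamma> i - 1)"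

text \<open>With the factor 1/m this is the symmetric m-linear form of the polynomial with one slot
  e_i and m - 1 slots z.\<close>

definition hpoly_partial :: "nat \<Rightarrow> nat \<Rightarrow> ((nat \<Rightarrow> nat) \<Rightarrow> complex) \<Rightarrow> nat \<Rightarrow> (nat \<Rightarrow> complex) \<Rightarrow> complex" where
  "hpoly_partial m n a i z =
     (\<Sum>\<gamma>\<in>exps m n. of_real (real (\<gamma> i) / real m) * a \<gamma> * monom_val n z (lower i \<gamma>))"

lemma exps_le: "\<gamma> \<in> exps m n \<Longrightarrow> \<gamma> j \<le> m"
  using member_le_sum[of j "{..<n}" \<gamma>] by (cases "j < n") (auto simp: exps_def)

lemma exps_subset_box: "exps m n \<subseteq> exp_box n m"
  using exps_le by (auto simp: exps_def exp_box_def)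

lemma finite_exps [simp]: "finite (exps m n)"
  using exps_subset_box finite_exp_box by (rule finite_subset)

lemma multinom_pos: "multinom m n \<gamma> > 0"
  unfolding multinom_def by (simp add: prod_pos)

lemma lower_exps: "\<gamma> \<in> exps m n \<Longrightarrow> \<gamma> i > 0 \<Longrightarrow> lower i \<gamma> \<in> exps (m - 1) n"
proof -
  assume g: "\<gamma> \<in> exps m n" "\<gamma> i > 0"
  then have i: "i < n" unfolding exps_def by (cases "i < n") auto
  have "(\<Sum>j<n. \<gamma> j) = \<gamma> i + (\<Sum>j\<in>{..<n} - {i}. \<gamma> j)"
    "(\<Sum>j<n. lower i \<gamma> j) = (\<gamma> i - 1) + (\<Sum>j\<in>{..<n} - {i}. \<gamma> j)"
    using i by (subst sum.remove[of _ i]; simp add: lower_def)+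
  then show ?thesis using g by (auto simp: exps_def lower_def)
qed

lemma inj_on_lower: "inj_on (lower i) {\<gamma>. \<gamma> i > 0}"
proof (rule inj_onI)
  fix \<gamma> \<gamma>' assume 1: "\<gamma> \<in> {\<gamma>. \<gamma> i > 0}" "\<gamma>' \<in> {\<gamma>. \<gamma> i > 0}" and 2: "lower i \<gamma> = lower i \<gamma>'"
  have "\<gamma> j = \<gamma>' j" for j
    using 1 fun_cong[OF 2, of j] by (cases "j = i") (auto simp: lower_def)
  then show "\<gamma> = \<gamma>'" by auto
qed

lemma monom_val_lower:
  assumes "i < n" "\<gamma> i > 0"
  shows "z i * monom_val n z (lower i \<gamma>) = monom_val n z \<gamma>"
proof -
  have "monom_val n z (lower i \<gamma>) = z i ^ (\<gamma> i - 1) * (\<Prod>j\<in>{..<n} - {i}. z j ^ \<gamma> j)"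
    "monom_val n z \<gamma> = z i ^ \<gamma> i * (\<Prod>j\<in>{..<n} - {i}. z j ^ \<gamma> j)"
    unfolding monom_val_def using assms
    by (subst prod.remove[of _ i]; simp add: lower_def)+
  then show ?thesis using assms(2) by (cases "\<gamma> i") (auto simp: mult.assoc)
qed

lemma monom_val_scale:
  "monom_val n (\<lambda>j. c * z j) \<gamma> = c ^ (\<Sum>j<n. \<gamma> j) * monom_val n z \<gamma>"
  by (simp add: monom_val_def power_mult_distrib prod.distrib power_sum)

lemma cmod_monom_val: "cmod (monom_val n z \<gamma>) = monom_val n (\<lambda>j. cmod (z j)) \<gamma>"
  by (simp add: monom_val_def prod_norm[symmetric] norm_power)

text \<open>The partial derivative has degree m - 1 = d, so the weights \<open>wt (Suc d)\<close> of
  the torus inequality are \<open>wt m\<close>, taken at the lowered exponents.\<close>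

lemma hpoly_partial_L1:
  assumes "2 * m < N" "m \<ge> 1" "i < n"
  shows "sqrt (\<Sum>\<gamma>\<in>{\<gamma>\<in>exps m n. \<gamma> i > 0}. (\<Prod>j<n. wt m (lower i \<gamma> j)) *
       (real (\<gamma> i) / real m * cmod (a \<gamma>) * monom_val n (\<lambda>j. cmod (z j)) (lower i \<gamma>))\<^sup>2)
     \<le> torus_avg N n (\<lambda>z. cmod (hpoly_partial m n a i z)) z"
proof -
  obtain d where d: "m = Suc d" using assms by (cases m) auto
  define G where "G = {\<gamma>\<in>exps m n. \<gamma> i > 0}"
  define b where "b \<gamma> = of_real (real (\<gamma> i) / real m) * a \<gamma>" for \<gamma>
  have cb: "cmod (b \<gamma>) = real (\<gamma> i) / real m * cmod (a \<gamma>)" for \<gamma>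
    by (simp only: b_def norm_mult norm_of_real) simp
  have inj: "inj_on (lower i) G"
    by (rule inj_on_subset[OF inj_on_lower]) (auto simp: G_def)
  \<comment> \<open>Coefficients indexed by lowered exponents: \<open>lower i\<close> is injective
    on exponents containing i, and everything outside its image gets 0.\<close>
  define c where "c \<gamma>' = (if \<gamma>' \<in> lower i ` G then b (inv_into G (lower i) \<gamma>') else 0)" for \<gamma>'
  have c: "c (lower i \<gamma>) = b \<gamma>" if "\<gamma> \<in> G" for \<gamma>
    using that inj by (simp add: c_def)
  have sub: "lower i ` G \<subseteq> exp_box n d"
    using lower_exps[of _ m n i] exps_subset_box[of d n] by (auto simp: G_def d)
  have reidx: "(\<Sum>\<gamma>'\<in>exp_box n d. f \<gamma>') = (\<Sum>\<gamma>\<in>G. f (lower i \<gamma>))"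
    if "\<And>\<gamma>'. \<gamma>' \<notin> lower i ` G \<Longrightarrow> f \<gamma>' = 0" for f :: "_ \<Rightarrow> 'b::comm_monoid_add"
  proof -
    have "(\<Sum>\<gamma>'\<in>exp_box n d. f \<gamma>') = (\<Sum>\<gamma>'\<in>lower i ` G. f \<gamma>')"
      by (rule sum.mono_neutral_right) (use sub that in auto)
    then show ?thesis by (simp add: sum.reindex[OF inj])
  qed
  have D: "hpoly_partial m n a i z = (\<Sum>\<gamma>'\<in>exp_box n d. c \<gamma>' * monom_val n z \<gamma>')" for z
  proof -
    have "hpoly_partial m n a i z = (\<Sum>\<gamma>\<in>G. b \<gamma> * monom_val n z (lower i \<gamma>))"
      unfolding hpoly_partial_def G_def b_def by (rule sum.mono_neutral_right) auto
    also have "\<dots> = (\<Sum>\<gamma>'\<in>exp_box n d. c \<gamma>' * monom_val n z \<gamma>')"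
    proof (subst reidx)
      show "(\<Sum>\<gamma>\<in>G. b \<gamma> * monom_val n z (lower i \<gamma>)) = (\<Sum>\<gamma>\<in>G. c (lower i \<gamma>) * monom_val n z (lower i \<gamma>))"
        by (simp add: c)
    qed (simp add: c_def)
    finally show ?thesis .
  qed
  have "(\<Sum>\<gamma>\<in>exp_box n d. (\<Prod>j<n. wt (Suc d) (\<gamma> j)) * (cmod (c \<gamma> * monom_val n z \<gamma>))\<^sup>2)
     = (\<Sum>\<gamma>\<in>G. (\<Prod>j<n. wt m (lower i \<gamma> j)) *
       (real (\<gamma> i) / real m * cmod (a \<gamma>) * monom_val n (\<lambda>j. cmod (z j)) (lower i \<gamma>))\<^sup>2)"
  proof (subst reidx)
    show "(\<Sum>\<gamma>\<in>G. (\<Prod>j<n. wt (Suc d) (lower i \<gamma> j)) * (cmod (c (lower i \<gamma>) * monom_val n z (lower i \<gamma>)))\<^sup>2) =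
      (\<Sum>\<gamma>\<in>G. (\<Prod>j<n. wt m (lower i \<gamma> j)) *
       (real (\<gamma> i) / real m * cmod (a \<gamma>) * monom_val n (\<lambda>j. cmod (z j)) (lower i \<gamma>))\<^sup>2)"
      by (rule sum.cong[OF refl]) (simp add: c cb norm_mult cmod_monom_val flip: d)
  qed (simp add: c_def)
  then show ?thesis
    using torus_L1_ge_weighted_L2[of d N n c z] assms(1) d unfolding D G_def by simp
qed

text \<open>Polarization in one slot by Cauchy's estimate for
  \<open>\<lambda> \<mapsto> F ((1 - 1/m) z + (\<lambda>/m) x)\<close>; these points stay in the polydisc containing \<open>z\<close> and \<open>x\<close>.\<close>

lemma hpoly_partial_polarization:
  assumes m: "m \<ge> 1"
    and bound: "\<And>y. (\<And>j. j < n \<Longrightarrow> cmod (y j) \<le> r j) \<Longrightarrow> cmod (hpoly m n a y) \<le> M"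
    and z: "\<And>j. j < n \<Longrightarrow> cmod (z j) \<le> r j" and x: "\<And>j. j < n \<Longrightarrow> cmod (x j) \<le> r j"
  shows "cmod (\<Sum>i<n. x i * hpoly_partial m n a i z) \<le> exp 1 * M"
proof -
  define b where "b = (1 - 1 / real m)"
  have b0: "b \<ge> 0" using m by (simp add: b_def)
  define h where "h l = hpoly m n a (\<lambda>j. of_real b * z j + l * (x j / of_nat m))" for l
  define h' where "h' = (\<Sum>\<gamma>\<in>exps m n. a \<gamma> * (\<Sum>i<n. of_nat (\<gamma> i) * (of_real b * z i) ^ (\<gamma> i - 1) * (x i / of_nat m) *
      (\<Prod>j\<in>{..<n} - {i}. (of_real b * z j) ^ \<gamma> j)))"
  have dm: "((\<lambda>l. \<Prod>j<n. (of_real b * z j + l * (x j / of_nat m)) ^ \<gamma> j) has_field_derivative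
      (\<Sum>i<n. of_nat (\<gamma> i) * (of_real b * z i) ^ (\<gamma> i - 1) * (x i / of_nat m) *
        (\<Prod>j\<in>{..<n} - {i}. (of_real b * z j + 0 * (x j / of_nat m)) ^ \<gamma> j))) (at 0)" for \<gamma>
    by (rule has_field_derivative_prod) (use m in \<open>auto intro!: derivative_eq_intros\<close>)
  have dh: "(h has_field_derivative h') (at 0)"
    unfolding h_def hpoly_def monom_val_def h'_def
    by (intro DERIV_sum DERIV_cmult) (use dm in simp)
  have h'_eq: "h' = of_real (b ^ (m - 1)) * (\<Sum>i<n. x i * hpoly_partial m n a i z)"
  proof -
    have "h' = (\<Sum>\<gamma>\<in>exps m n. \<Sum>i<n. of_real (b ^ (m - 1)) * (x i * (of_real (real (\<gamma> i) / real m) * a \<gamma> * monom_val n z (lower i \<gamma>))))"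
      unfolding h'_def sum_distrib_left
    proof (intro sum.cong refl)
      fix \<gamma> i assume g: "\<gamma> \<in> exps m n" and i: "i \<in> {..<n}"
      show "a \<gamma> * (of_nat (\<gamma> i) * (of_real b * z i) ^ (\<gamma> i - 1) * (x i / of_nat m) * (\<Prod>j\<in>{..<n} - {i}. (of_real b * z j) ^ \<gamma> j))
        = of_real (b ^ (m - 1)) * (x i * (of_real (real (\<gamma> i) / real m) * a \<gamma> * monom_val n z (lower i \<gamma>)))"
      proof (cases "\<gamma> i = 0")
        case False
        have "(of_real b * z i) ^ (\<gamma> i - 1) * (\<Prod>j\<in>{..<n} - {i}. (of_real b * z j) ^ \<gamma> j)
            = monom_val n (\<lambda>j. of_real b * z j) (lower i \<gamma>)"
          unfolding monom_val_def using i by (subst prod.remove[of _ i]) (auto simp: lower_def)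
        also have "\<dots> = of_real b ^ (m - 1) * monom_val n z (lower i \<gamma>)"
          using lower_exps[OF g, of i] False by (simp add: monom_val_scale exps_def)
        finally show ?thesis by (simp add: mult_ac)
      qed simp
    qed
    also have "\<dots> = of_real (b ^ (m - 1)) * (\<Sum>i<n. x i * hpoly_partial m n a i z)"
      unfolding hpoly_partial_def sum_distrib_left by (rule sum.swap)
    finally show ?thesis .
  qed
  have holo: "h holomorphic_on UNIV"
    unfolding h_def hpoly_def monom_val_def by (intro holomorphic_intros)
  have "norm ((deriv ^^ 1) h 0) \<le> fact 1 * M / 1 ^ 1"
  proof (rule Cauchy_inequality)
    show "h holomorphic_on ball 0 1" "continuous_on (cball 0 1) h"
      using holo holomorphic_on_subset holomorphic_on_imp_continuous_on by blast+
    fix l :: complex assume "norm (0 - l) = 1"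
    then have l: "cmod l = 1" by simp
    show "norm (h l) \<le> M"
      unfolding h_def
    proof (rule bound)
      fix j assume j: "j < n"
      have "cmod (of_real b * z j + l * (x j / of_nat m)) \<le> b * cmod (z j) + cmod (x j) / m"
        by (rule order.trans[OF norm_triangle_ineq]) (simp add: norm_mult norm_divide l b0)
      also have "\<dots> \<le> b * r j + r j / m"
        using z[OF j] x[OF j] b0 by (intro add_mono mult_left_mono divide_right_mono) auto
      also have "\<dots> = r j" using m by (simp add: b_def field_simps)
      finally show "cmod (of_real b * z j + l * (x j / of_nat m)) \<le> r j" .
    qed
  qed simp
  then have 1: "b ^ (m - 1) * cmod (\<Sum>i<n. x i * hpoly_partial m n a i z) \<le> M"
    using DERIV_imp_deriv[OF dh] h'_eq b0 by (simp add: norm_mult norm_power)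
  \<comment> \<open>Source of the constant e: (1 - 1/m)^(-(m-1)) = (1 + 1/(m-1))^(m-1) \<le> e,
    independently of m.\<close>
  have 2: "exp 1 * b ^ (m - 1) \<ge> 1"
  proof (cases "m = 1")
    case False
    then have m2: "m \<ge> 2" using m by simp
    have "inverse b = 1 + 1 / real (m - 1)" using m2 by (simp add: b_def field_simps of_nat_diff)
    also have "\<dots> \<le> exp (1 / real (m - 1))" by (rule exp_ge_add_one_self)
    finally have "inverse b ^ (m - 1) \<le> exp (1 / real (m - 1)) ^ (m - 1)"
      using b0 by (intro power_mono) auto
    also have "\<dots> = exp 1" using m2 by (simp flip: exp_of_nat_mult)
    finally have "inverse b ^ (m - 1) \<le> exp 1" .
    moreover have "b > 0" using m2 by (simp add: b_def)
    ultimately show ?thesis by (simp add: field_simps)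
  qed simp
  have "cmod (\<Sum>i<n. x i * hpoly_partial m n a i z) \<le>
      exp 1 * b ^ (m - 1) * cmod (\<Sum>i<n. x i * hpoly_partial m n a i z)"
    using 2 by (simp add: mult_le_cancel_right1)
  also have "\<dots> \<le> exp 1 * M" using 1 by simp
  finally show ?thesis .
qed

text \<open>The free slot x enters linearly and ranges over the whole polydisc, so choosing its
  phases coordinate by coordinate turns polarization into an l1 sum over i.\<close>

lemma sum_norm_partial_le:
  assumes m: "m \<ge> 1"
    and bound: "\<And>y. (\<And>j. j < n \<Longrightarrow> cmod (y j) \<le> r j) \<Longrightarrow> cmod (hpoly m n a y) \<le> M"
    and z: "\<And>j. j < n \<Longrightarrow> cmod (z j) \<le> r j" and r: "\<And>j. j < n \<Longrightarrow> 0 \<le> r j"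
  shows "(\<Sum>i<n. r i * cmod (hpoly_partial m n a i z)) \<le> exp 1 * M"
proof -
  define x where "x i = of_real (r i) * cnj (sgn (hpoly_partial m n a i z))" for i
  have "x i * hpoly_partial m n a i z = of_real (r i * cmod (hpoly_partial m n a i z))" for i
  proof -
    have "cnj (sgn w) * w = of_real (cmod w)" for w
      by (cases "w = 0") (simp_all add: sgn_eq mult.commute[of "cnj w"] complex_norm_square[symmetric] power2_eq_square)
    then show ?thesis by (simp add: x_def)
  qed
  then have "cmod (\<Sum>i<n. x i * hpoly_partial m n a i z) = \<bar>\<Sum>i<n. r i * cmod (hpoly_partial m n a i z)\<bar>"
    by (simp only: of_real_sum[symmetric] norm_of_real)
  then have "(\<Sum>i<n. r i * cmod (hpoly_partial m n a i z)) = cmod (\<Sum>i<n. x i * hpoly_partial m n a i z)"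
    using r by (subst (asm) abs_of_nonneg) (auto intro!: sum_nonneg)
  also have "\<dots> \<le> exp 1 * M"
    by (rule hpoly_partial_polarization[OF m bound z])
      (auto simp: x_def norm_mult norm_sgn r)
  finally show ?thesis .
qed

lemma weighted_slices_le:
  assumes m: "m \<ge> 1"
    and bound: "\<And>y. (\<And>j. j < n \<Longrightarrow> cmod (y j) \<le> r j) \<Longrightarrow> cmod (hpoly m n a y) \<le> M"
    and r: "\<And>j. 0 \<le> r j"
  shows "(\<Sum>i<n. r i * sqrt (\<Sum>\<gamma>\<in>{\<gamma>\<in>exps m n. \<gamma> i > 0}. (\<Prod>j<n. wt m (lower i \<gamma> j)) *
       (real (\<gamma> i) / real m * cmod (a \<gamma>) * monom_val n r (lower i \<gamma>))\<^sup>2)) \<le> exp 1 * M"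
proof -
  define N where "N = Suc (2 * m)"
  define z where "z j = complex_of_real (r j)" for j
  have rz: "(\<lambda>j. cmod (z j)) = r" using r by (auto simp: z_def)
  have "(\<Sum>i<n. r i * sqrt (\<Sum>\<gamma>\<in>{\<gamma>\<in>exps m n. \<gamma> i > 0}. (\<Prod>j<n. wt m (lower i \<gamma> j)) *
       (real (\<gamma> i) / real m * cmod (a \<gamma>) * monom_val n r (lower i \<gamma>))\<^sup>2))
     \<le> (\<Sum>i<n. r i * torus_avg N n (\<lambda>z. cmod (hpoly_partial m n a i z)) z)"
    using hpoly_partial_L1[of m N _ n a z] m unfolding rz
    by (intro sum_mono mult_left_mono r) (auto simp: N_def)
  also have "\<dots> = torus_avg N n (\<lambda>z. \<Sum>i<n. r i * cmod (hpoly_partial m n a i z)) z"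
    by (simp only: torus_avg_sum torus_avg_cmult)
  also have "\<dots> \<le> exp 1 * M"
  proof (rule torus_avg_le_bound)
    fix z' assume "\<And>j. cmod (z' j) = cmod (z j)"
    then have "cmod (z' j) \<le> r j" for j using r by (simp add: z_def)
    then show "(\<Sum>i<n. r i * cmod (hpoly_partial m n a i z')) \<le> exp 1 * M"
      by (intro sum_norm_partial_le[OF m bound] r)
  qed (simp add: N_def)
  finally show ?thesis .
qed

section \<open>The Bombieri--Weyl norm and monomial gains\<close>

text \<open>One weight that serves all slots i at once: it must lie below \<open>wt m\<close> at
  both k and k - 1. Lowering k by one at most doubles \<open>fold_deg\<close>, which turns 16 into
  64.\<close>

definition loss_wt :: "nat \<Rightarrow> nat \<Rightarrow> (nat \<Rightarrow> nat) \<Rightarrow> real" where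
  "loss_wt m n \<gamma> = (\<Prod>j<n. if \<gamma> j = 0 then 1 else 1 / (64 * (real (fold_deg m (\<gamma> j)))\<^sup>2))"

lemma fold_deg_ge1: "fold_deg m k \<ge> 1"
  by (simp add: fold_deg_def)

lemma wt_lower_ge:
  assumes "0 < k" "k \<le> m"
  shows "1 / (64 * (real (fold_deg m k))\<^sup>2) \<le> wt m (k - 1)"
    "1 / (64 * (real (fold_deg m k))\<^sup>2) \<le> wt m k"
proof -
  have f1: "real (fold_deg m k) \<ge> 1" using fold_deg_ge1[of m k] by simp
  show "1 / (64 * (real (fold_deg m k))\<^sup>2) \<le> wt m k"
    using assms f1 by (auto simp: wt_def frac_le)
  show "1 / (64 * (real (fold_deg m k))\<^sup>2) \<le> wt m (k - 1)"
  proof (cases "k = 1")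
    case True
    have "1 \<le> (real (fold_deg m k))\<^sup>2" using f1 by simp
    then have "1 \<le> 64 * (real (fold_deg m k))\<^sup>2" by linarith
    then show ?thesis using True by (auto simp: wt_def divide_le_eq_1)
  next
    case False
    have "fold_deg m (k - 1) \<le> 2 * fold_deg m k"
      using assms False by (auto simp: fold_deg_def)
    then have "(real (fold_deg m (k - 1)))\<^sup>2 \<le> (2 * real (fold_deg m k))\<^sup>2"
      by (intro power_mono) linarith+
    then have "16 * (real (fold_deg m (k - 1)))\<^sup>2 \<le> 64 * (real (fold_deg m k))\<^sup>2"
      by (simp add: power_mult_distrib)
    moreover have "16 * (real (fold_deg m (k - 1)))\<^sup>2 > 0"
      using fold_deg_ge1[of m "k - 1"] by simp
    ultimately show ?thesis
      using assms False by (simp add: wt_def frac_le)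
  qed
qed

lemma loss_wt_le:
  assumes "\<gamma> \<in> exps m n" "\<gamma> i > 0"
  shows "loss_wt m n \<gamma> \<le> (\<Prod>j<n. wt m (lower i \<gamma> j))"
  unfolding loss_wt_def
proof (rule prod_mono, intro conjI)
  fix j assume "j \<in> {..<n}"
  show "(if \<gamma> j = 0 then 1 else 1 / (64 * (real (fold_deg m (\<gamma> j)))\<^sup>2)) \<le> wt m (lower i \<gamma> j)"
    using wt_lower_ge[of "\<gamma> j" m] exps_le[OF assms(1), of j] assms(2)
    by (auto simp: lower_def wt_def[of m 0])
qed simp

lemma loss_wt_pos: "loss_wt m n \<gamma> > 0"
  unfolding loss_wt_def
  by (rule prod_pos) (use fold_deg_ge1[of m] in \<open>simp add: Suc_le_eq\<close>)

text \<open>The factor \<open>1 / sqrt (card I)\<close> bounds the exponential of minus half the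
  entropy of \<open>\<theta>\<close> from below.\<close>

lemma weighted_amgm:
  fixes \<theta> \<rho> :: "'a \<Rightarrow> real"
  assumes fin: "finite I" and \<theta>: "\<And>i. i \<in> I \<Longrightarrow> \<theta> i > 0" and \<rho>: "\<And>i. i \<in> I \<Longrightarrow> \<rho> i > 0"
    and sum1: "(\<Sum>i\<in>I. \<theta> i) = 1"
  shows "1 / sqrt (card I) \<le> (\<Sum>i\<in>I. \<theta> i * sqrt (\<theta> i / \<rho> i)) * (\<Prod>i\<in>I. \<rho> i powr (\<theta> i / 2))"
proof -
  have ne: "I \<noteq> {}" using sum1 by auto
  define q where "q = real (card I)"
  have q: "q > 0" using fin ne by (simp add: q_def card_gt_0_iff)
  define L where "L = (\<Sum>i\<in>I. \<theta> i * ln (\<rho> i))"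
  have P: "(\<Prod>i\<in>I. \<rho> i powr (\<theta> i / 2)) = exp (L / 2)"
    unfolding L_def sum_divide_distrib exp_sum[OF fin]
    by (rule prod.cong[OF refl]) (use \<rho> in \<open>force simp: powr_def\<close>)
  \<comment> \<open>After multiplication by exp(L/2) sqrt(q) the summands are exponentials. Bounding
    them by 1 + x, and ln by its tangent, leaves expressions whose \<theta>-mean is exactly
    1.\<close>
  have "1 \<le> (\<Sum>i\<in>I. \<theta> i * (sqrt (\<theta> i / \<rho> i) * exp (L / 2) * sqrt q))"
  proof -
    have split: "(\<Sum>i\<in>I. \<theta> i * (1 + 1/2 * (1 - u i - v i + L)))
        = (\<Sum>i\<in>I. \<theta> i) * (3/2 + L/2) - (\<Sum>i\<in>I. \<theta> i * u i) / 2 - (\<Sum>i\<in>I. \<theta> i * v i) / 2"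
      for u v :: "'a \<Rightarrow> real"
      by (simp add: algebra_simps sum.distrib sum_subtractf sum_distrib_left sum_distrib_right sum_divide_distrib add_divide_distrib diff_divide_distrib)
    have "(\<Sum>i\<in>I. \<theta> i * (1 + 1/2 * (1 - 1 / (\<theta> i * q) - ln (\<rho> i) + L)))
        = (\<Sum>i\<in>I. \<theta> i) * (3/2 + L/2) - (\<Sum>i\<in>I. \<theta> i * (1 / (\<theta> i * q))) / 2 - (\<Sum>i\<in>I. \<theta> i * ln (\<rho> i)) / 2"
      by (rule split)
    also have "(\<Sum>i\<in>I. \<theta> i * (1 / (\<theta> i * q))) = (\<Sum>i\<in>I. 1 / q)"
      by (rule sum.cong[OF refl]) (use \<theta> in force)
    also have "\<dots> = 1" using q by (simp add: q_def)
    finally have "1 = (\<Sum>i\<in>I. \<theta> i * (1 + 1/2 * (1 - 1 / (\<theta> i * q) - ln (\<rho> i) + L)))"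
      using sum1 by (simp add: L_def)
    also have "\<dots> \<le> (\<Sum>i\<in>I. \<theta> i * (sqrt (\<theta> i / \<rho> i) * exp (L / 2) * sqrt q))"
    proof (intro sum_mono mult_left_mono)
      fix i assume i: "i \<in> I"
      have pos: "\<theta> i > 0" "\<rho> i > 0" using i \<theta> \<rho> by auto
      have "ln (1 / (\<theta> i * q)) \<le> 1 / (\<theta> i * q) - 1"
        using pos q by (intro ln_le_minus_one) auto
      then have "1 - 1 / (\<theta> i * q) \<le> ln (\<theta> i * q)" using pos q by (simp add: ln_div)
      then have "1 + 1/2 * (1 - 1 / (\<theta> i * q) - ln (\<rho> i) + L) \<le> 1 + 1/2 * (ln (\<theta> i * q) - ln (\<rho> i) + L)"
        by simp
      also have "\<dots> \<le> exp (1/2 * (ln (\<theta> i * q) - ln (\<rho> i) + L))" by (rule exp_ge_add_one_self)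
      also have "\<dots> = exp (1/2 * ln (\<theta> i * q / \<rho> i)) * exp (L / 2)"
        using pos q by (simp add: ln_div flip: exp_add)
      also have "exp (1/2 * ln (\<theta> i * q / \<rho> i)) = sqrt (\<theta> i * q / \<rho> i)"
        using pos q by (simp add: powr_half_sqrt[symmetric] powr_def)
      also have "\<dots> = sqrt (\<theta> i / \<rho> i) * sqrt q" by (simp add: real_sqrt_mult real_sqrt_divide)
      finally show "1 + 1/2 * (1 - 1 / (\<theta> i * q) - ln (\<rho> i) + L) \<le> sqrt (\<theta> i / \<rho> i) * exp (L / 2) * sqrt q"
        by (simp add: mult_ac)
    qed (use \<theta> in force)
    finally show ?thesis .
  qed
  also have "\<dots> = (\<Sum>i\<in>I. \<theta> i * sqrt (\<theta> i / \<rho> i)) * exp (L / 2) * sqrt q"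
    by (simp only: sum_distrib_right mult.assoc)
  finally show ?thesis unfolding P using q by (simp add: field_simps q_def)
qed

definition exp_supp :: "nat \<Rightarrow> (nat \<Rightarrow> nat) \<Rightarrow> nat set" where
  "exp_supp n \<gamma> = {j. j < n \<and> \<gamma> j > 0}"

text \<open>The polydisc radii are chosen with \<open>r\<^sub>i\<^sup>2\<^sup>m\<close> equal to the share \<open>s\<^sub>i\<close> of the
  Bombieri--Weyl mass carried by the \<open>i\<close>-th slice. With this choice the radii cancel in the
  geometric mean over the slots of each single monomial.\<close>

lemma bw_sq_le_of_gain:
  assumes m: "m \<ge> 1"
    and bound: "\<And>y. (\<Sum>j<n. cmod (y j) ^ (2 * m)) \<le> 1 \<Longrightarrow> cmod (hpoly m n a y) \<le> M"
    and \<kappa>: "\<kappa> \<ge> 0"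
    and gain: "\<And>\<gamma>. \<gamma> \<in> exps m n \<Longrightarrow> a \<gamma> \<noteq> 0 \<Longrightarrow>
        \<kappa> \<le> multinom m n \<gamma> * loss_wt m n \<gamma> / card (exp_supp n \<gamma>)"
  shows "\<kappa> * bw_sq m n a \<le> (exp 1 * M)\<^sup>2"
proof -
  define w where "w \<gamma> = (cmod (a \<gamma>))\<^sup>2 / multinom m n \<gamma>" for \<gamma>
  have w0: "w \<gamma> \<ge> 0" for \<gamma> unfolding w_def using multinom_pos[of m n \<gamma>] by simp
  define S where "S = (\<Sum>\<gamma>\<in>exps m n. w \<gamma>)"
  have S_eq: "S = bw_sq m n a" by (simp add: S_def w_def bw_sq_def)
  have "S \<ge> 0" unfolding S_def by (simp add: sum_nonneg w0)
  show ?thesis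
  proof (cases "S = 0")
    case True
    then show ?thesis by (simp add: S_eq)
  next
    case False
    then have S: "S > 0" using \<open>S \<ge> 0\<close> by simp
    define \<theta> where "\<theta> \<gamma> i = real (\<gamma> i) / real m" for \<gamma> :: "nat \<Rightarrow> nat" and i
    have \<theta>0: "\<theta> \<gamma> i \<ge> 0" for \<gamma> i by (simp add: \<theta>_def)
    have \<theta>1: "(\<Sum>i<n. \<theta> \<gamma> i) = 1" if "\<gamma> \<in> exps m n" for \<gamma>
      using that m unfolding \<theta>_def sum_divide_distrib[symmetric]
      by (simp add: exps_def flip: of_nat_sum)
    define s where "s i = (\<Sum>\<gamma>\<in>exps m n. w \<gamma> * \<theta> \<gamma> i) / S" for i
    have s0: "s i \<ge> 0" for i unfolding s_def using S by (auto intro!: divide_nonneg_pos sum_nonneg mult_nonneg_nonneg w0 \<theta>0)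
    have s1: "(\<Sum>i<n. s i) = 1"
    proof -
      have "(\<Sum>i<n. s i) = (\<Sum>\<gamma>\<in>exps m n. w \<gamma> * (\<Sum>i<n. \<theta> \<gamma> i)) / S"
        unfolding s_def sum_divide_distrib[symmetric] sum_distrib_left by (subst sum.swap) simp
      then show ?thesis using S \<theta>1 by (simp add: S_def)
    qed
    define r where "r i = s i powr (1 / (2 * real m))" for i
    have r0: "r i \<ge> 0" for i by (simp add: r_def)
    have r2m: "r i ^ (2 * m) = s i" for i
      using s0[of i] m by (cases "s i = 0") (simp_all add: r_def powr_power power_0_left)
    define G where "G i = {\<gamma>\<in>exps m n. \<gamma> i > 0}" for i
    have key: "(\<Sum>i<n. r i * sqrt (\<Sum>\<gamma>\<in>G i. (\<Prod>j<n. wt m (lower i \<gamma> j)) *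
       (real (\<gamma> i) / real m * cmod (a \<gamma>) * monom_val n r (lower i \<gamma>))\<^sup>2)) \<le> exp 1 * M"
      unfolding G_def
    proof (rule weighted_slices_le[OF m _ r0])
      fix y assume y: "\<And>j. j < n \<Longrightarrow> cmod (y j) \<le> r j"
      have "(\<Sum>j<n. cmod (y j) ^ (2 * m)) \<le> (\<Sum>j<n. r j ^ (2 * m))"
        using y by (intro sum_mono power_mono) auto
      then show "cmod (hpoly m n a y) \<le> M" using s1 by (intro bound) (simp add: r2m)
    qed
    define Q where "Q \<gamma> = multinom m n \<gamma> * loss_wt m n \<gamma>" for \<gamma>
    have Q0: "Q \<gamma> > 0" for \<gamma> unfolding Q_def using multinom_pos loss_wt_pos by simp
    define R where "R \<gamma> = monom_val n r \<gamma>" for \<gamma>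
    have R0: "R \<gamma> \<ge> 0" for \<gamma> unfolding R_def monom_val_def using r0 by (simp add: prod_nonneg)
    \<comment> \<open>Cauchy-Schwarz on one slice: its total mass is S * s i, so linearizing the l2
      norm produces the factor 1 / sqrt(s i). Writing |a_\<gamma>|^2 as w \<gamma> times the
      multinomial coefficient is what creates the gain Q.\<close>
    have slice: "(\<Sum>\<gamma>\<in>G i. w \<gamma> * \<theta> \<gamma> i * (sqrt (Q \<gamma> * \<theta> \<gamma> i) * R \<gamma> / sqrt (s i))) / sqrt S
        \<le> r i * sqrt (\<Sum>\<gamma>\<in>G i. (\<Prod>j<n. wt m (lower i \<gamma> j)) *
           (real (\<gamma> i) / real m * cmod (a \<gamma>) * monom_val n r (lower i \<gamma>))\<^sup>2)" if i: "i < n" for i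
    proof -
      define X where "X = (\<Sum>\<gamma>\<in>G i. w \<gamma> * \<theta> \<gamma> i * (Q \<gamma> * \<theta> \<gamma> i * (R \<gamma>)\<^sup>2))"
      have "X = (\<Sum>\<gamma>\<in>G i. loss_wt m n \<gamma> * (r i)\<^sup>2 * (\<theta> \<gamma> i * cmod (a \<gamma>) * monom_val n r (lower i \<gamma>))\<^sup>2)"
        unfolding X_def
      proof (rule sum.cong[OF refl])
        fix \<gamma> assume "\<gamma> \<in> G i"
        then have "R \<gamma> = r i * monom_val n r (lower i \<gamma>)"
          using i monom_val_lower[of i n \<gamma> r] by (simp add: G_def R_def)
        then show "w \<gamma> * \<theta> \<gamma> i * (Q \<gamma> * \<theta> \<gamma> i * (R \<gamma>)\<^sup>2) =
            loss_wt m n \<gamma> * (r i)\<^sup>2 * (\<theta> \<gamma> i * cmod (a \<gamma>) * monom_val n r (lower i \<gamma>))\<^sup>2"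
          using multinom_pos[of m n \<gamma>] by (simp add: w_def Q_def power2_eq_square)
      qed
      also have "\<dots> \<le> (\<Sum>\<gamma>\<in>G i. (\<Prod>j<n. wt m (lower i \<gamma> j)) * (r i)\<^sup>2 * (\<theta> \<gamma> i * cmod (a \<gamma>) * monom_val n r (lower i \<gamma>))\<^sup>2)"
        by (intro sum_mono mult_right_mono loss_wt_le) (auto simp: G_def)
      also have "\<dots> = (r i)\<^sup>2 * (\<Sum>\<gamma>\<in>G i. (\<Prod>j<n. wt m (lower i \<gamma> j)) *
           (real (\<gamma> i) / real m * cmod (a \<gamma>) * monom_val n r (lower i \<gamma>))\<^sup>2)"
        by (simp add: sum_distrib_left mult_ac \<theta>_def)
      finally have "X \<le> (r i)\<^sup>2 * (\<Sum>\<gamma>\<in>G i. (\<Prod>j<n. wt m (lower i \<gamma> j)) *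
           (real (\<gamma> i) / real m * cmod (a \<gamma>) * monom_val n r (lower i \<gamma>))\<^sup>2)" .
      from real_sqrt_le_mono[OF this] have X_le: "sqrt X \<le> r i * sqrt (\<Sum>\<gamma>\<in>G i. (\<Prod>j<n. wt m (lower i \<gamma> j)) *
           (real (\<gamma> i) / real m * cmod (a \<gamma>) * monom_val n r (lower i \<gamma>))\<^sup>2)"
        using r0[of i] by (simp only: real_sqrt_mult real_sqrt_abs abs_of_nonneg)
      have sG: "(\<Sum>\<gamma>\<in>G i. w \<gamma> * \<theta> \<gamma> i) = S * s i"
      proof -
        have "(\<Sum>\<gamma>\<in>G i. w \<gamma> * \<theta> \<gamma> i) = (\<Sum>\<gamma>\<in>exps m n. w \<gamma> * \<theta> \<gamma> i)"
          unfolding G_def by (rule sum.mono_neutral_left) (auto simp: \<theta>_def)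
        then show ?thesis using S by (simp add: s_def)
      qed
      have "(\<Sum>\<gamma>\<in>G i. w \<gamma> * \<theta> \<gamma> i * (sqrt (Q \<gamma> * \<theta> \<gamma> i) * R \<gamma>)) \<le> sqrt (S * s i) * sqrt X"
      proof -
        have "(\<Sum>\<gamma>\<in>G i. w \<gamma> * \<theta> \<gamma> i * (sqrt (Q \<gamma> * \<theta> \<gamma> i) * R \<gamma>))
          = (\<Sum>\<gamma>\<in>G i. \<bar>sqrt (w \<gamma> * \<theta> \<gamma> i)\<bar> * \<bar>sqrt (w \<gamma> * \<theta> \<gamma> i * (Q \<gamma> * \<theta> \<gamma> i)) * R \<gamma>\<bar>)"
        proof (rule sum.cong[OF refl])
          fix \<gamma>
          define v where "v = w \<gamma> * \<theta> \<gamma> i"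
          have v: "v \<ge> 0" by (simp add: v_def w0 \<theta>0)
          have "0 \<le> Q \<gamma> * \<theta> \<gamma> i" using Q0[of \<gamma>] \<theta>0[of \<gamma> i] by simp
          then show "w \<gamma> * \<theta> \<gamma> i * (sqrt (Q \<gamma> * \<theta> \<gamma> i) * R \<gamma>) =
            \<bar>sqrt (w \<gamma> * \<theta> \<gamma> i)\<bar> * \<bar>sqrt (w \<gamma> * \<theta> \<gamma> i * (Q \<gamma> * \<theta> \<gamma> i)) * R \<gamma>\<bar>"
            unfolding v_def[symmetric] real_sqrt_mult[of v] using v R0[of \<gamma>]
            by (simp add: abs_mult)
        qed
        also have "\<dots> \<le> L2_set (\<lambda>\<gamma>. sqrt (w \<gamma> * \<theta> \<gamma> i)) (G i) *
            L2_set (\<lambda>\<gamma>. sqrt (w \<gamma> * \<theta> \<gamma> i * (Q \<gamma> * \<theta> \<gamma> i)) * R \<gamma>) (G i)"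
          by (rule L2_set_mult_ineq)
        also have "L2_set (\<lambda>\<gamma>. sqrt (w \<gamma> * \<theta> \<gamma> i)) (G i) = sqrt (S * s i)"
          unfolding L2_set_def sG[symmetric] by (simp add: w0 \<theta>0)
        also have "L2_set (\<lambda>\<gamma>. sqrt (w \<gamma> * \<theta> \<gamma> i * (Q \<gamma> * \<theta> \<gamma> i)) * R \<gamma>) (G i) = sqrt X"
          unfolding L2_set_def X_def
          by (simp add: w0 \<theta>0 Q0 less_imp_le power_mult_distrib mult_ac)
        finally show ?thesis .
      qed
      then have "(\<Sum>\<gamma>\<in>G i. w \<gamma> * \<theta> \<gamma> i * (sqrt (Q \<gamma> * \<theta> \<gamma> i) * R \<gamma>)) / (sqrt S * sqrt (s i)) \<le> sqrt X"
      \<comment> \<open>For an empty slice the quotient has denominator 0 and hence the value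
        0.\<close>
      proof (cases "s i = 0")
        case True
        have "X \<ge> 0" unfolding X_def using w0 \<theta>0 Q0 by (intro sum_nonneg) (simp add: less_imp_le)
        then show ?thesis using True by simp
      next
        case False
        assume "(\<Sum>\<gamma>\<in>G i. w \<gamma> * \<theta> \<gamma> i * (sqrt (Q \<gamma> * \<theta> \<gamma> i) * R \<gamma>)) \<le> sqrt (S * s i) * sqrt X"
        then show ?thesis using S s0[of i] False by (simp add: field_simps real_sqrt_mult)
      qed
      also have "(\<Sum>\<gamma>\<in>G i. w \<gamma> * \<theta> \<gamma> i * (sqrt (Q \<gamma> * \<theta> \<gamma> i) * R \<gamma>)) / (sqrt S * sqrt (s i))
        = (\<Sum>\<gamma>\<in>G i. w \<gamma> * \<theta> \<gamma> i * (sqrt (Q \<gamma> * \<theta> \<gamma> i) * R \<gamma> / sqrt (s i))) / sqrt S"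
        by (simp add: sum_divide_distrib mult_ac)
      finally show ?thesis using X_le by simp
    qed
    have term_bound: "w \<gamma> * sqrt \<kappa> \<le> (\<Sum>i\<in>exp_supp n \<gamma>. w \<gamma> * \<theta> \<gamma> i * (sqrt (Q \<gamma> * \<theta> \<gamma> i) * R \<gamma> / sqrt (s i)))"
      if g: "\<gamma> \<in> exps m n" for \<gamma>
    proof (cases "a \<gamma> = 0")
      case False
      have fin: "finite (exp_supp n \<gamma>)" by (simp add: exp_supp_def)
      have wp: "w \<gamma> > 0" unfolding w_def using False multinom_pos[of m n \<gamma>] by simp
      have \<theta>p: "\<theta> \<gamma> i > 0" if "i \<in> exp_supp n \<gamma>" for i
        using that m by (simp add: exp_supp_def \<theta>_def)
      \<comment> \<open>The monomial under consideration contributes to the share of each of its own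
        variables.\<close>
      have sp: "s i > 0" if "i \<in> exp_supp n \<gamma>" for i
      proof -
        have "w \<gamma> * \<theta> \<gamma> i \<le> (\<Sum>\<gamma>\<in>exps m n. w \<gamma> * \<theta> \<gamma> i)"
          by (rule member_le_sum[OF g]) (simp_all add: w0 \<theta>0)
        moreover have "w \<gamma> * \<theta> \<gamma> i > 0" using wp \<theta>p[OF that] by simp
        ultimately show ?thesis unfolding s_def using S by simp
      qed
      have "R \<gamma> = (\<Prod>i\<in>exp_supp n \<gamma>. r i ^ \<gamma> i)"
        unfolding R_def monom_val_def by (rule prod.mono_neutral_right) (auto simp: exp_supp_def)
      also have "\<dots> = (\<Prod>i\<in>exp_supp n \<gamma>. s i powr (\<theta> \<gamma> i / 2))"
        by (rule prod.cong[OF refl]) (auto simp: r_def \<theta>_def powr_power mult.commute dest!: sp)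
      finally have R_eq: "R \<gamma> = (\<Prod>i\<in>exp_supp n \<gamma>. s i powr (\<theta> \<gamma> i / 2))" .
      have "(\<Sum>i\<in>exp_supp n \<gamma>. \<theta> \<gamma> i) = (\<Sum>i<n. \<theta> \<gamma> i)"
        by (rule sum.mono_neutral_left) (auto simp: exp_supp_def \<theta>_def)
      then have "1 / sqrt (card (exp_supp n \<gamma>)) \<le> (\<Sum>i\<in>exp_supp n \<gamma>. \<theta> \<gamma> i * sqrt (\<theta> \<gamma> i / s i)) * R \<gamma>"
        unfolding R_eq using weighted_amgm[OF fin \<theta>p sp] \<theta>1[OF g] by simp
      then have "sqrt (Q \<gamma>) * (1 / sqrt (card (exp_supp n \<gamma>))) \<le> sqrt (Q \<gamma>) * ((\<Sum>i\<in>exp_supp n \<gamma>. \<theta> \<gamma> i * sqrt (\<theta> \<gamma> i / s i)) * R \<gamma>)"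
        using Q0[of \<gamma>] by (intro mult_left_mono) auto
      moreover have "sqrt \<kappa> \<le> sqrt (Q \<gamma>) * (1 / sqrt (card (exp_supp n \<gamma>)))"
        using gain[OF g False] by (simp add: Q_def real_sqrt_divide[symmetric] real_sqrt_mult[symmetric])
      ultimately have "w \<gamma> * sqrt \<kappa> \<le> w \<gamma> * (sqrt (Q \<gamma>) * ((\<Sum>i\<in>exp_supp n \<gamma>. \<theta> \<gamma> i * sqrt (\<theta> \<gamma> i / s i)) * R \<gamma>))"
        using w0[of \<gamma>] by (intro mult_left_mono) auto
      also have "\<dots> = (\<Sum>i\<in>exp_supp n \<gamma>. w \<gamma> * (sqrt (Q \<gamma>) * (\<theta> \<gamma> i * sqrt (\<theta> \<gamma> i / s i) * R \<gamma>)))"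
        by (simp only: sum_distrib_left sum_distrib_right)
      also have "\<dots> = (\<Sum>i\<in>exp_supp n \<gamma>. w \<gamma> * \<theta> \<gamma> i * (sqrt (Q \<gamma> * \<theta> \<gamma> i) * R \<gamma> / sqrt (s i)))"
        by (rule sum.cong[OF refl]) (simp add: real_sqrt_mult real_sqrt_divide)
      finally show ?thesis .
    qed (simp add: w_def)
    have "S * sqrt \<kappa> = (\<Sum>\<gamma>\<in>exps m n. w \<gamma> * sqrt \<kappa>)"
      by (simp add: S_def sum_distrib_right)
    also have "\<dots> \<le> (\<Sum>\<gamma>\<in>exps m n. \<Sum>i\<in>exp_supp n \<gamma>. w \<gamma> * \<theta> \<gamma> i * (sqrt (Q \<gamma> * \<theta> \<gamma> i) * R \<gamma> / sqrt (s i)))"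
      by (rule sum_mono[OF term_bound])
    also have "\<dots> = (\<Sum>i<n. \<Sum>\<gamma>\<in>G i. w \<gamma> * \<theta> \<gamma> i * (sqrt (Q \<gamma> * \<theta> \<gamma> i) * R \<gamma> / sqrt (s i)))"
      unfolding exp_supp_def G_def by (subst sum.swap_restrict) (auto intro!: sum.cong)
    also have "\<dots> \<le> sqrt S * (exp 1 * M)"
    proof -
      have "(\<Sum>i<n. (\<Sum>\<gamma>\<in>G i. w \<gamma> * \<theta> \<gamma> i * (sqrt (Q \<gamma> * \<theta> \<gamma> i) * R \<gamma> / sqrt (s i))) / sqrt S) \<le> exp 1 * M"
        by (rule order.trans[OF sum_mono key]) (rule slice, simp)
      then have "(\<Sum>i<n. \<Sum>\<gamma>\<in>G i. w \<gamma> * \<theta> \<gamma> i * (sqrt (Q \<gamma> * \<theta> \<gamma> i) * R \<gamma> / sqrt (s i))) / sqrt S \<le> exp 1 * M"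
        by (simp only: sum_divide_distrib)
      then show ?thesis using S by (simp only: pos_divide_le_eq real_sqrt_gt_zero mult.commute)
    qed
    \<comment> \<open>The mass S on the left is quadratic in the norm, while the right side contains
      only sqrt(S); one factor cancels.\<close>
    finally have "sqrt S * (sqrt S * sqrt \<kappa>) \<le> sqrt S * (exp 1 * M)"
      using S by (simp flip: mult.assoc)
    then have "sqrt S * sqrt \<kappa> \<le> exp 1 * M" using S by simp
    then have "(sqrt S * sqrt \<kappa>)\<^sup>2 \<le> (exp 1 * M)\<^sup>2"
      using S \<kappa> by (intro power_mono) auto
    then show ?thesis using S \<kappa> by (simp add: power_mult_distrib S_eq mult.commute)
  qed
qed

section \<open>Lower bounds for the gains\<close>

lemma power_le_fact_exp: "(E::real) \<ge> 0 \<Longrightarrow> E ^ k \<le> exp E * fact k"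
proof -
  assume E: "E \<ge> 0"
  have "(\<Sum>n\<in>{k}. E ^ n /\<^sub>R fact n) \<le> suminf (\<lambda>n. E ^ n /\<^sub>R fact n)"
    by (rule sum_le_suminf) (use E summable_exp_generic[of E] in auto)
  then show ?thesis by (simp add: exp_def field_simps)
qed

text \<open>The exponent 5 is 4 for the quartic bound below plus 1 for the factor k in the
  absorption identity used there.\<close>

lemma ex_power5_le_exp2: "\<exists>c>0. \<forall>k\<ge>1. c * real k ^ 5 \<le> 2 ^ (k - 1)"
proof -
  have "ln 2 ^ 5 / 240 * real k ^ 5 \<le> 2 ^ (k - 1)" if "k \<ge> 1" for k
  proof -
    have "(real k * ln 2) ^ 5 \<le> exp (real k * ln 2) * fact 5"
      by (rule power_le_fact_exp) simp
    also have "exp (real k * ln 2) = 2 ^ k" by (simp add: exp_of_nat_mult)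
    also have "(2::real) ^ k = 2 * 2 ^ (k - 1)" using that by (cases k) auto
    finally show ?thesis by (simp add: power_mult_distrib fact_numeral mult_ac)
  qed
  then show ?thesis by (intro exI[of _ "ln 2 ^ 5 / 240"]) auto
qed

text \<open>By absorption k C(N,k) = N C(N-1,k-1), and N \<ge> 2k gives C(N-1,k-1) \<ge>
  ((N-1)/(k-1))^(k-1) \<ge> 2^(k-1) for k > 1. Of the four powers of k, two pay for the loss of the
  part k itself and two for the loss of the largest part.\<close>

lemma ex_binomial_ge_quartic:
  "\<exists>c>0. \<forall>N k. 1 \<le> k \<longrightarrow> 2 * k \<le> N \<longrightarrow> c * real N * real k ^ 4 \<le> real (N choose k)"
proof -
  obtain c where c: "c > 0" "\<And>k. k \<ge> 1 \<Longrightarrow> c * real k ^ 5 \<le> 2 ^ (k - 1)"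
    using ex_power5_le_exp2 by blast
  have "c * real N * real k ^ 4 \<le> real (N choose k)" if k: "1 \<le> k" "2 * k \<le> N" for N k
  proof -
    have "(2::nat) ^ (k - 1) \<le> (N - 1) choose (k - 1)"
    proof (cases "k = 1")
      case False
      have "(2::real) ^ (k - 1) \<le> (real (N - 1) / real (k - 1)) ^ (k - 1)"
        using k False by (intro power_mono) (auto simp: field_simps of_nat_diff)
      also have "\<dots> \<le> real ((N - 1) choose (k - 1))"
        using k by (intro binomial_ge_n_over_k_pow_k) auto
      finally have "real (2 ^ (k - 1)) \<le> real ((N - 1) choose (k - 1))" by simp
      then show ?thesis by (simp only: of_nat_le_iff)
    qed simp
    then have "real (2 ^ (k - 1)) \<le> real ((N - 1) choose (k - 1))" by (simp only: of_nat_le_iff)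
    then have "c * real k ^ 5 \<le> real ((N - 1) choose (k - 1))"
      using c(2)[OF k(1)] by (simp only: of_nat_power of_nat_numeral)
    then have "real N * (c * real k ^ 5) \<le> real N * real ((N - 1) choose (k - 1))"
      by (intro mult_left_mono) auto
    also have "\<dots> = real (k * (N choose k))"
      using k times_binomial_minus1_eq[of k N] by (simp flip: of_nat_mult)
    finally have "real k * (c * real N * real k ^ 4) \<le> real k * real (N choose k)"
      by (simp add: eval_nat_numeral mult_ac)
    then show ?thesis using k by simp
  qed
  then show ?thesis using c(1) by blast
qed

text \<open>Parts are added one at a time to the largest part \<open>a\<close>; each new binomial factor beats the
  loss \<open>B (f j)\<^sup>2\<close> together with the growth of the accumulated factor \<open>(a + \<Sum>f) (\<Sum>f)\<^sup>2\<close>.\<close>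

lemma multinomial_gain:
  fixes B :: real
  assumes B: "B \<ge> 1"
  obtains c :: real and N0 :: nat where "c > 0"
    and "\<And>S f a. finite S \<Longrightarrow> S \<noteq> {} \<Longrightarrow> N0 \<le> a \<Longrightarrow> (\<And>j. j \<in> S \<Longrightarrow> 1 \<le> f j \<and> f j \<le> a) \<Longrightarrow>
       c * real (a + sum f S) * (real (sum f S))\<^sup>2 * (\<Prod>j\<in>S. B * (real (f j))\<^sup>2)
         \<le> fact (a + sum f S) / (fact a * (\<Prod>j\<in>S. fact (f j)))"
proof -
  obtain c0 where c0: "c0 > 0" "\<And>N k. 1 \<le> k \<Longrightarrow> 2 * k \<le> N \<Longrightarrow> c0 * real N * real k ^ 4 \<le> real (N choose k)"
    using ex_binomial_ge_quartic by blast
  \<comment> \<open>Chosen so that c0 a \<ge> 8B. The 8 is 2 * 2^2, from a + t + k \<le> 2(a + t)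
    and (t + k)^2 \<le> (2tk)^2 in the induction step.\<close>
  define N0 where "N0 = nat \<lceil>8 * B / c0\<rceil>"
  have N0: "8 * B \<le> c0 * real a" if "N0 \<le> a" for a
  proof -
    have "8 * B / c0 \<le> real a" using that unfolding N0_def by linarith
    then show ?thesis using c0(1) by (simp add: field_simps)
  qed
  have "c0 / B * real (a + sum f S) * (real (sum f S))\<^sup>2 * (\<Prod>j\<in>S. B * (real (f j))\<^sup>2)
         \<le> fact (a + sum f S) / (fact a * (\<Prod>j\<in>S. fact (f j)))"
    if S: "finite S" "S \<noteq> {}" and a: "N0 \<le> a" and f: "\<And>j. j \<in> S \<Longrightarrow> 1 \<le> f j \<and> f j \<le> a"
    for S :: "'b set" and f :: "'b \<Rightarrow> nat" and a
    using S f
  proof (induction S rule: finite_ne_induct)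
    case (singleton j)
    define k where "k = f j"
    have k: "1 \<le> k" "k \<le> a" using singleton by (auto simp: k_def)
    have "c0 / B * real (a + k) * (real k)\<^sup>2 * (B * (real k)\<^sup>2) = c0 * real (a + k) * real k ^ 4"
      using B by (simp add: power2_eq_square eval_nat_numeral)
    also have "\<dots> \<le> real ((a + k) choose k)" using k by (intro c0) auto
    also have "\<dots> = fact (a + k) / (fact a * fact k)"
      using binomial_fact[of k "a + k", where ?'a=real] by (simp add: mult.commute)
    finally show ?case by (simp add: k_def)
  next
    case (insert j S)
    define k where "k = f j"
    define t where "t = sum f S"
    define P where "P = (\<Prod>j\<in>S. B * (real (f j))\<^sup>2)"
    define D where "D = (\<Prod>j\<in>S. fact (f j) :: real)"
    have k: "1 \<le> k" "k \<le> a" using insert by (auto simp: k_def)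
    obtain i where "i \<in> S" using insert by blast
    then have t: "1 \<le> t" unfolding t_def using insert by (metis insertI2 le_trans member_le_sum zero_le)
    have P0: "P \<ge> 0" unfolding P_def using B by (auto intro!: prod_nonneg)
    have D0: "D > 0" unfolding D_def by (auto intro!: prod_pos)
    have IH: "c0 / B * real (a + t) * (real t)\<^sup>2 * P \<le> fact (a + t) / (fact a * D)"
      unfolding t_def P_def D_def by (rule insert.IH) (use insert.prems in auto)
    have step: "B * (real k)\<^sup>2 * real (a + t + k) * (real (t + k))\<^sup>2 \<le>
        real (a + t) * (real t)\<^sup>2 * real ((a + t + k) choose k)"
    proof -
      have 1: "real (a + t + k) \<le> 2 * real (a + t)" using k by simp
      have "t + k \<le> 2 * t * k"
      proof -
        have "t \<le> t * k" "k \<le> t * k" using k t by auto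
        then show ?thesis by linarith
      qed
      then have "real (t + k) \<le> 2 * real t * real k" by (metis of_nat_le_iff of_nat_mult of_nat_numeral)
      then have 2: "(real (t + k))\<^sup>2 \<le> (2 * real t * real k)\<^sup>2" by (intro power_mono) auto
      have "8 * B * real k ^ 4 \<le> c0 * real (a + t + k) * real k ^ 4"
        using N0[of "a + t + k"] a by (intro mult_right_mono) auto
      also have "\<dots> \<le> real ((a + t + k) choose k)" using k by (intro c0) auto
      finally have 3: "8 * B * real k ^ 4 \<le> real ((a + t + k) choose k)" .
      have "B * (real k)\<^sup>2 * real (a + t + k) * (real (t + k))\<^sup>2
         \<le> B * (real k)\<^sup>2 * (2 * real (a + t)) * (2 * real t * real k)\<^sup>2"
        using 1 2 B by (intro mult_mono mult_nonneg_nonneg) auto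
      also have "\<dots> = real (a + t) * (real t)\<^sup>2 * (8 * B * real k ^ 4)"
        by (simp add: power2_eq_square eval_nat_numeral)
      also have "\<dots> \<le> real (a + t) * (real t)\<^sup>2 * real ((a + t + k) choose k)"
        using 3 by (intro mult_left_mono) auto
      finally show ?thesis .
    qed
    have "c0 / B * real (a + (t + k)) * (real (t + k))\<^sup>2 * (B * (real k)\<^sup>2 * P)
       = c0 / B * P * (B * (real k)\<^sup>2 * real (a + t + k) * (real (t + k))\<^sup>2)"
      by (simp add: mult_ac add_ac)
    also have "\<dots> \<le> c0 / B * P * (real (a + t) * (real t)\<^sup>2 * real ((a + t + k) choose k))"
      using step c0(1) B P0 by (intro mult_left_mono) auto
    also have "\<dots> = (c0 / B * real (a + t) * (real t)\<^sup>2 * P) * real ((a + t + k) choose k)"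
      by (simp add: mult_ac)
    also have "\<dots> \<le> fact (a + t) / (fact a * D) * real ((a + t + k) choose k)"
      using IH by (intro mult_right_mono) auto
    also have "\<dots> = fact (a + (t + k)) / (fact a * (fact k * D))"
      using binomial_fact[of k "a + t + k", where ?'a=real] D0 by (simp add: field_simps add_ac)
    finally show ?case
      using insert by (simp add: k_def t_def P_def D_def add_ac)
  qed
  then show ?thesis
    using that[of "c0 / B" N0] c0(1) B by fastforce
qed

section \<open>Pure exponents and the gain of each monomial\<close>

definition pure_exp :: "nat \<Rightarrow> nat \<Rightarrow> nat \<Rightarrow> nat" where
  "pure_exp m i = (\<lambda>_. 0)(i := m)"

definition pure_exps :: "nat \<Rightarrow> nat \<Rightarrow> (nat \<Rightarrow> nat) set" where
  "pure_exps m n = pure_exp m ` {..<n}"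

lemma exps_eq_supp_sum: "\<gamma> \<in> exps m n \<Longrightarrow> sum \<gamma> (exp_supp n \<gamma>) = m"
proof -
  assume g: "\<gamma> \<in> exps m n"
  have "sum \<gamma> (exp_supp n \<gamma>) = (\<Sum>j<n. \<gamma> j)"
    by (rule sum.mono_neutral_left) (auto simp: exp_supp_def)
  then show ?thesis using g by (simp add: exps_def)
qed

lemma pure_expsI: "\<gamma> \<in> exps m n \<Longrightarrow> i < n \<Longrightarrow> exp_supp n \<gamma> \<subseteq> {i} \<Longrightarrow> \<gamma> \<in> pure_exps m n"
proof -
  assume g: "\<gamma> \<in> exps m n" and i: "i < n" and sub: "exp_supp n \<gamma> \<subseteq> {i}"
  have z: "\<gamma> j = 0" if "j \<noteq> i" for j
    using that sub g by (cases "j < n") (auto simp: exp_supp_def exps_def)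
  have "(\<Sum>j<n. \<gamma> j) = (\<Sum>j\<in>{i}. \<gamma> j)"
    by (rule sum.mono_neutral_right) (use i z in auto)
  then have "\<gamma> i = m" using g by (simp add: exps_def)
  then have "\<gamma> = pure_exp m i" using z by (auto simp: pure_exp_def)
  then show ?thesis using i by (auto simp: pure_exps_def)
qed

lemma exp_gain_eq:
  fixes m n :: nat
  shows "multinom m n \<gamma> * loss_wt m n \<gamma> =
    fact m / (\<Prod>j\<in>exp_supp n \<gamma>. fact (\<gamma> j)) * (\<Prod>j\<in>exp_supp n \<gamma>. 1 / (64 * (real (fold_deg m (\<gamma> j)))\<^sup>2))"
proof -
  have "(\<Prod>j<n. fact (\<gamma> j) :: real) = (\<Prod>j\<in>exp_supp n \<gamma>. fact (\<gamma> j))"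
    by (rule prod.mono_neutral_right) (auto simp: exp_supp_def)
  moreover have "loss_wt m n \<gamma> = (\<Prod>j\<in>exp_supp n \<gamma>. if \<gamma> j = 0 then 1 else 1 / (64 * (real (fold_deg m (\<gamma> j)))\<^sup>2))"
    unfolding loss_wt_def by (rule prod.mono_neutral_right) (auto simp: exp_supp_def)
  moreover have "\<dots> = (\<Prod>j\<in>exp_supp n \<gamma>. 1 / (64 * (real (fold_deg m (\<gamma> j)))\<^sup>2))"
    by (rule prod.cong) (auto simp: exp_supp_def)
  ultimately show ?thesis by (simp add: multinom_def)
qed

text \<open>The factor \<open>1 / card\<close> is absorbed by doubling the loss of every part.\<close>

lemma exp_gain_ge:
  assumes "\<gamma> \<in> exps m n" "m \<ge> 1"
  shows "fact m / (\<Prod>j\<in>exp_supp n \<gamma>. fact (\<gamma> j)) / (\<Prod>j\<in>exp_supp n \<gamma>. 128 * (real (fold_deg m (\<gamma> j)))\<^sup>2)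
     \<le> multinom m n \<gamma> * loss_wt m n \<gamma> / card (exp_supp n \<gamma>)"
proof (cases "exp_supp n \<gamma> = {}")
  case False
  have fin: "finite (exp_supp n \<gamma>)" by (simp add: exp_supp_def)
  define q where "q = card (exp_supp n \<gamma>)"
  have q: "q > 0" using fin False by (simp add: q_def card_gt_0_iff)
  define X where "X = (\<Prod>j\<in>exp_supp n \<gamma>. 64 * (real (fold_deg m (\<gamma> j)))\<^sup>2)"
  have X: "X > 0" unfolding X_def using fold_deg_ge1[of m] by (auto intro!: prod_pos simp: Suc_le_eq)
  have "(\<Prod>j\<in>exp_supp n \<gamma>. 128 * (real (fold_deg m (\<gamma> j)))\<^sup>2) = (\<Prod>j\<in>exp_supp n \<gamma>. 2 * (64 * (real (fold_deg m (\<gamma> j)))\<^sup>2))"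
    by (simp add: mult.assoc[symmetric])
  also have "\<dots> = 2 ^ q * X" by (simp only: prod.distrib prod_constant q_def X_def)
  finally have 1: "(\<Prod>j\<in>exp_supp n \<gamma>. 128 * (real (fold_deg m (\<gamma> j)))\<^sup>2) = 2 ^ q * X" .
  have 2: "(\<Prod>j\<in>exp_supp n \<gamma>. 1 / (64 * (real (fold_deg m (\<gamma> j)))\<^sup>2)) = 1 / X"
    unfolding X_def by (simp add: prod_dividef)
  have "q \<le> 2 ^ q" using less_exp[of q] by simp
  then have "real q \<le> 2 ^ q" by (metis of_nat_le_iff of_nat_numeral of_nat_power)
  then have "real q * X \<le> 2 ^ q * X" using X by simp
  then have "fact m / (\<Prod>j\<in>exp_supp n \<gamma>. fact (\<gamma> j)) / (2 ^ q * X) \<le> fact m / (\<Prod>j\<in>exp_supp n \<gamma>. fact (\<gamma> j)) / (real q * X)"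
    using q X by (intro divide_left_mono divide_nonneg_nonneg prod_nonneg) auto
  then show ?thesis unfolding exp_gain_eq 1 2 q_def[symmetric] by (simp add: mult_ac)
next
  case True
  then have "m = 0" using exps_eq_supp_sum[OF assms(1)] by simp
  then show ?thesis using assms(2) by simp
qed


lemma prod_fact_fold_le:
  assumes "\<And>j. j \<in> S \<Longrightarrow> 1 \<le> \<gamma> j \<and> \<gamma> j \<le> N0"
  shows "(\<Prod>j\<in>S. fact (\<gamma> j)) * (\<Prod>j\<in>S. 128 * (real (fold_deg m (\<gamma> j)))\<^sup>2)
    \<le> (128 * (real N0)\<^sup>2 * fact N0) ^ card S"
proof -
  have "(\<Prod>j\<in>S. fact (\<gamma> j) * (128 * (real (fold_deg m (\<gamma> j)))\<^sup>2)) \<le> (\<Prod>j\<in>S. 128 * (real N0)\<^sup>2 * fact N0)"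
  proof (rule prod_mono)
    fix j assume "j \<in> S"
    then have j: "1 \<le> \<gamma> j" "\<gamma> j \<le> N0" using assms by auto
    then have "fold_deg m (\<gamma> j) \<le> N0" by (auto simp: fold_deg_def)
    then have "(real (fold_deg m (\<gamma> j)))\<^sup>2 \<le> (real N0)\<^sup>2" by (intro power_mono) auto
    moreover have "(fact (\<gamma> j) :: real) \<le> fact N0" using j by (intro fact_mono) auto
    ultimately have "fact (\<gamma> j) * (128 * (real (fold_deg m (\<gamma> j)))\<^sup>2) \<le> fact N0 * (128 * (real N0)\<^sup>2)"
      by (intro mult_mono) auto
    then show "0 \<le> fact (\<gamma> j) * (128 * (real (fold_deg m (\<gamma> j)))\<^sup>2) \<and>
        fact (\<gamma> j) * (128 * (real (fold_deg m (\<gamma> j)))\<^sup>2) \<le> 128 * (real N0)\<^sup>2 * fact N0"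
      by (simp add: mult_ac)
  qed
  then show ?thesis by (simp add: prod.distrib)
qed

text \<open>Two regimes for the largest part a. If a is large, \<open>multinomial_gain\<close>
  applies, and its factor (sum f)^2 pays for the loss of a itself, since \<open>fold_deg m a\<close>
  is at most t = m - a; this is where folding the degree matters. If a is bounded, factorials and
  losses together are at most E^m, which m! beats with a factor m to spare.\<close>

lemma ex_gain_non_pure:
  "\<exists>c>0. \<forall>m n \<gamma>. m \<ge> 1 \<longrightarrow> \<gamma> \<in> exps m n \<longrightarrow> \<gamma> \<notin> pure_exps m n \<longrightarrow>
     c * real m \<le> multinom m n \<gamma> * loss_wt m n \<gamma> / card (exp_supp n \<gamma>)"
proof -
  have "(1::real) \<le> 128" by simp
  then obtain c1 N0 where c1: "c1 > 0" and gain: "\<And>S (f :: nat \<Rightarrow> nat) a. finite S \<Longrightarrow> S \<noteq> {} \<Longrightarrow> N0 \<le> a \<Longrightarrow>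
       (\<And>j. j \<in> S \<Longrightarrow> 1 \<le> f j \<and> f j \<le> a) \<Longrightarrow>
       c1 * real (a + sum f S) * (real (sum f S))\<^sup>2 * (\<Prod>j\<in>S. 128 * (real (f j))\<^sup>2)
         \<le> fact (a + sum f S) / (fact a * (\<Prod>j\<in>S. fact (f j)))"
    by (rule multinomial_gain) blast
  define N1 where "N1 = max 1 N0"
  define E where "E = 128 * (real N1)\<^sup>2 * fact N1"
  have E: "E \<ge> 1"
  proof -
    have "1 \<le> (real N1)\<^sup>2" "(1::real) \<le> fact N1" by (auto simp: N1_def)
    then have "1 * 1 \<le> (128 * (real N1)\<^sup>2) * fact N1" by (intro mult_mono) auto
    then show ?thesis by (simp add: E_def)
  qed
  define c where "c = min (c1 / 128) (1 / (E * exp E))"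
  have c: "c > 0" using c1 E by (simp add: c_def)
  have "c * real m \<le> multinom m n \<gamma> * loss_wt m n \<gamma> / card (exp_supp n \<gamma>)"
    if m: "m \<ge> 1" and g: "\<gamma> \<in> exps m n" and np: "\<gamma> \<notin> pure_exps m n" for m n \<gamma>
  proof -
    define K where "K = exp_supp n \<gamma>"
    have fin: "finite K" by (simp add: K_def exp_supp_def)
    have sumK: "sum \<gamma> K = m" unfolding K_def by (rule exps_eq_supp_sum[OF g])
    have Kpos: "1 \<le> \<gamma> j" if "j \<in> K" for j using that by (simp add: K_def exp_supp_def)
    have "K \<noteq> {}" using sumK m by auto
    define a where "a = Max (\<gamma> ` K)"
    have "a \<in> \<gamma> ` K" unfolding a_def using fin \<open>K \<noteq> {}\<close> by (intro Max_in) auto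
    then obtain i where i: "i \<in> K" "\<gamma> i = a" by auto
    have le_a: "\<gamma> j \<le> a" if "j \<in> K" for j unfolding a_def using fin that by (intro Max_ge) auto
    define S where "S = K - {i}"
    have K_eq: "K = insert i S" "i \<notin> S" "finite S" using i fin by (auto simp: S_def)
    have "S \<noteq> {}"
    proof
      assume "S = {}"
      then have "exp_supp n \<gamma> \<subseteq> {i}" using K_eq by (simp add: K_def)
      moreover have "i < n" using i by (simp add: K_def exp_supp_def)
      ultimately show False using pure_expsI[OF g] np by blast
    qed
    define t where "t = sum \<gamma> S"
    have m_eq: "m = a + t" using sumK K_eq i by (simp add: t_def)
    define L where "L = (\<Prod>j\<in>K. 128 * (real (fold_deg m (\<gamma> j)))\<^sup>2)"
    define D where "D = (\<Prod>j\<in>K. fact (\<gamma> j) :: real)"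
    have L: "L > 0" unfolding L_def using fold_deg_ge1[of m] by (auto intro!: prod_pos simp: Suc_le_eq)
    have D: "D > 0" unfolding D_def by (auto intro!: prod_pos)
    have "c * real m \<le> fact m / D / L"
    proof (cases "N0 \<le> a")
      case True
      define P where "P = (\<Prod>j\<in>S. 128 * (real (\<gamma> j))\<^sup>2)"
      have P: "P \<ge> 0" unfolding P_def by (auto intro!: prod_nonneg)
      have t1: "1 \<le> t"
      proof -
        obtain j where j: "j \<in> S" using \<open>S \<noteq> {}\<close> by blast
        have "\<gamma> j \<le> t" unfolding t_def by (rule member_le_sum[OF j]) (use K_eq in auto)
        then show ?thesis using Kpos[of j] j K_eq by simp
      qed
      have D_eq: "D = fact a * (\<Prod>j\<in>S. fact (\<gamma> j))"
        unfolding D_def using K_eq i by simp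
      have "c1 * real m * (real t)\<^sup>2 * P \<le> fact m / D"
        unfolding m_eq t_def P_def D_eq
        by (rule gain) (use K_eq \<open>S \<noteq> {}\<close> True Kpos le_a in auto)
      moreover have "L \<le> 128 * (real t)\<^sup>2 * P"
      proof -
        have "fold_deg m a \<le> t" using t1 m_eq by (auto simp: fold_deg_def)
        then have 1: "128 * (real (fold_deg m a))\<^sup>2 \<le> 128 * (real t)\<^sup>2"
          by (auto intro!: power_mono)
        have 2: "(\<Prod>j\<in>S. 128 * (real (fold_deg m (\<gamma> j)))\<^sup>2) \<le> P"
          unfolding P_def
        proof (intro prod_mono conjI)
          fix j assume "j \<in> S"
          then have "fold_deg m (\<gamma> j) \<le> \<gamma> j" using Kpos[of j] K_eq by (auto simp: fold_deg_def)
          then show "128 * (real (fold_deg m (\<gamma> j)))\<^sup>2 \<le> 128 * (real (\<gamma> j))\<^sup>2"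
            by (auto intro!: power_mono)
        qed simp
        have "L = 128 * (real (fold_deg m a))\<^sup>2 * (\<Prod>j\<in>S. 128 * (real (fold_deg m (\<gamma> j)))\<^sup>2)"
          unfolding L_def using K_eq i by simp
        also have "\<dots> \<le> 128 * (real t)\<^sup>2 * P"
          using 1 2 by (intro mult_mono) (auto intro!: prod_nonneg)
        finally show ?thesis .
      qed
      then have "c1 / 128 * real m * L \<le> c1 / 128 * real m * (128 * (real t)\<^sup>2 * P)"
        using c1 by (intro mult_left_mono) auto
      moreover have "c1 / 128 * real m * (128 * (real t)\<^sup>2 * P) = c1 * real m * (real t)\<^sup>2 * P" by simp
      ultimately have "c1 / 128 * real m * L \<le> fact m / D" by linarith
      then have "c1 / 128 * real m \<le> fact m / D / L" by (simp only: pos_le_divide_eq[OF L])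
      moreover have "c * real m \<le> c1 / 128 * real m" by (intro mult_right_mono) (auto simp: c_def)
      ultimately show ?thesis by linarith
    next
      case False
      have "D * L \<le> E ^ card K"
        unfolding D_def L_def E_def
        by (rule prod_fact_fold_le) (use Kpos le_a False in \<open>force simp: N1_def\<close>)
      also have "\<dots> \<le> E ^ m"
      proof (rule power_increasing)
        have "card K = (\<Sum>j\<in>K. 1)" by simp
        also have "\<dots> \<le> sum \<gamma> K" by (rule sum_mono) (use Kpos in auto)
        finally show "card K \<le> m" using sumK by simp
      qed (use E in auto)
      finally have DL: "D * L \<le> E ^ m" .
      \<comment> \<open>One factor E and one factor m are split off so that E^(m-1) / (m-1)! \<le>
        exp E yields m! on the right.\<close>
      have "E ^ m * real m = E * real m * E ^ (m - 1)" using m by (cases m) auto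
      also have "\<dots> \<le> E * real m * (exp E * fact (m - 1))"
        using E by (intro mult_left_mono power_le_fact_exp) auto
      also have "\<dots> = E * exp E * fact m" using m by (simp add: fact_reduce[of m])
      finally have "E ^ m * real m \<le> E * exp E * fact m" .
      moreover have "D * L * real m \<le> E ^ m * real m" using DL by (intro mult_right_mono) auto
      ultimately have "D * L * real m \<le> E * exp E * fact m" by linarith
      then have "1 / (E * exp E) * real m \<le> fact m / D / L"
        using E D L by (simp add: field_simps)
      moreover have "c * real m \<le> 1 / (E * exp E) * real m" by (intro mult_right_mono) (auto simp: c_def)
      ultimately show ?thesis by linarith
    qed
    then show ?thesis
      using exp_gain_ge[OF g m] unfolding D_def L_def K_def by linarith
  qed
  then show ?thesis using c by blast
qed

lemma gain_pure:
  assumes "m \<ge> 1" "\<gamma> \<in> pure_exps m n"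
  shows "1 / 64 \<le> multinom m n \<gamma> * loss_wt m n \<gamma> / card (exp_supp n \<gamma>)"
proof -
  obtain i where i: "i < n" "\<gamma> = pure_exp m i" using assms by (auto simp: pure_exps_def)
  then have supp: "exp_supp n \<gamma> = {i}" using assms(1) by (auto simp: exp_supp_def pure_exp_def)
  show ?thesis unfolding exp_gain_eq supp using i(2) by (simp add: pure_exp_def fold_deg_def)
qed


text \<open>Pure exponents have only a constant gain, hence the first bound; it will be applied to
  slices of every degree. The second bound is the one responsible for 1 + C/m.\<close>

lemma ex_bw_sq_le:
  "\<exists>C>0. \<forall>m n a M. m \<ge> 1 \<longrightarrow>
     (\<forall>y. (\<Sum>j<n. cmod (y j) ^ (2 * m)) \<le> 1 \<longrightarrow> cmod (hpoly m n a y) \<le> M) \<longrightarrow>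
     bw_sq m n a \<le> C * M\<^sup>2 \<and>
     ((\<forall>\<gamma>\<in>pure_exps m n. a \<gamma> = 0) \<longrightarrow> bw_sq m n a \<le> C / real m * M\<^sup>2)"
proof -
  obtain c where c: "c > 0" and gain: "\<And>m n \<gamma>. m \<ge> 1 \<Longrightarrow> \<gamma> \<in> exps m n \<Longrightarrow> \<gamma> \<notin> pure_exps m n \<Longrightarrow>
     c * real m \<le> multinom m n \<gamma> * loss_wt m n \<gamma> / card (exp_supp n \<gamma>)"
    using ex_gain_non_pure by blast
  define d where "d = min c (1 / 64)"
  have d: "d > 0" "d \<le> c" "d \<le> 1 / 64" using c by (auto simp: d_def)
  have "bw_sq m n a \<le> exp 1 ^ 2 / d * M\<^sup>2 \<and>
     ((\<forall>\<gamma>\<in>pure_exps m n. a \<gamma> = 0) \<longrightarrow> bw_sq m n a \<le> exp 1 ^ 2 / d / real m * M\<^sup>2)"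
    if m: "m \<ge> 1" and bound: "\<And>y. (\<Sum>j<n. cmod (y j) ^ (2 * m)) \<le> 1 \<Longrightarrow> cmod (hpoly m n a y) \<le> M" for m n a M
  proof (intro conjI impI)
    have "d * bw_sq m n a \<le> (exp 1 * M)\<^sup>2"
    proof (rule bw_sq_le_of_gain[OF m bound])
      fix \<gamma> assume g: "\<gamma> \<in> exps m n"
      show "d \<le> multinom m n \<gamma> * loss_wt m n \<gamma> / card (exp_supp n \<gamma>)"
      proof (cases "\<gamma> \<in> pure_exps m n")
        case True
        then show ?thesis using gain_pure[OF m True] d by linarith
      next
        case False
        have "d * 1 \<le> c * real m" using d m by (intro mult_mono) auto
        then show ?thesis using gain[OF m g False] by linarith
      qed
    qed (use d in auto)
    then show "bw_sq m n a \<le> exp 1 ^ 2 / d * M\<^sup>2"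
      using d by (simp add: field_simps)
  next
    assume np: "\<forall>\<gamma>\<in>pure_exps m n. a \<gamma> = 0"
    have "c * real m * bw_sq m n a \<le> (exp 1 * M)\<^sup>2"
    proof (rule bw_sq_le_of_gain[OF m bound])
      fix \<gamma> assume g: "\<gamma> \<in> exps m n" "a \<gamma> \<noteq> 0"
      then show "c * real m \<le> multinom m n \<gamma> * loss_wt m n \<gamma> / card (exp_supp n \<gamma>)"
        using gain[OF m g(1)] np by blast
    qed (use c in auto)
    moreover have "d * (real m * bw_sq m n a) \<le> c * (real m * bw_sq m n a)"
      using d multinom_pos[of m n] unfolding bw_sq_def
      by (intro mult_right_mono mult_nonneg_nonneg sum_nonneg divide_nonneg_pos) auto
    ultimately have "d * (real m * bw_sq m n a) \<le> (exp 1 * M)\<^sup>2"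
      by (simp only: mult.assoc)
    then show "bw_sq m n a \<le> exp 1 ^ 2 / d / real m * M\<^sup>2"
      using d m by (simp add: field_simps)
  qed
  then show ?thesis using d by (intro exI[of _ "exp 1 ^ 2 / d"]) auto
qed

section \<open>Pure and mixed parts\<close>

lemma monom_val_pure_exp: "i < n \<Longrightarrow> monom_val n z (pure_exp m i) = z i ^ m"
proof -
  assume i: "i < n"
  have "monom_val n z (pure_exp m i) = (\<Prod>j<n. if j = i then z i ^ m else 1)"
    unfolding monom_val_def by (rule prod.cong) (auto simp: pure_exp_def)
  then show ?thesis using i by simp
qed

lemma inj_on_pure_exp: "m \<ge> 1 \<Longrightarrow> inj_on (pure_exp m) A"
proof (rule inj_onI)
  fix i j assume "m \<ge> 1" and eq: "pure_exp m i = pure_exp m j"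
  have "pure_exp m i i = pure_exp m j i" using eq by (rule fun_cong)
  then have "m = (if i = j then m else 0)" by (simp add: pure_exp_def)
  then show "i = j" using \<open>m \<ge> 1\<close> by (auto split: if_splits)
qed

lemma pure_exps_subset: "pure_exps m n \<subseteq> exps m n"
  by (auto simp: pure_exps_def exps_def pure_exp_def)

lemma sum_pure_exps: "m \<ge> 1 \<Longrightarrow> (\<Sum>\<gamma>\<in>pure_exps m n. f \<gamma>) = (\<Sum>i<n. f (pure_exp m i))"
  unfolding pure_exps_def by (simp add: sum.reindex inj_on_pure_exp o_def)

lemma multinom_pure: "i < n \<Longrightarrow> multinom m n (pure_exp m i) = 1"
proof -
  assume i: "i < n"
  have "(\<Prod>j<n. fact (pure_exp m i j) :: real) = (\<Prod>j<n. if j = i then fact m else 1)"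
    by (rule prod.cong) (auto simp: pure_exp_def)
  then show ?thesis using i by (simp add: multinom_def)
qed

lemma exps_dvd_imp_pure:
  assumes "m \<ge> 1" "\<gamma> \<in> exps m n" "\<forall>j<n. m dvd \<gamma> j"
  shows "\<gamma> \<in> pure_exps m n"
proof -
  have "(\<Sum>j<n. \<gamma> j) = m" using assms by (simp add: exps_def)
  then obtain i where i: "i < n" "\<gamma> i \<noteq> 0" using assms(1)
    by (metis lessThan_iff not_one_le_zero sum.neutral)
  then have "\<gamma> i = m" using assms exps_le[OF assms(2), of i] by (meson dvd_imp_le le_antisym not_gr_zero)
  have "exp_supp n \<gamma> \<subseteq> {i}"
  proof
    fix j assume j: "j \<in> exp_supp n \<gamma>"
    show "j \<in> {i}"
    proof (rule ccontr)
      assume "j \<notin> {i}"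
      then have "sum \<gamma> {i, j} \<le> (\<Sum>j<n. \<gamma> j)"
        using i j by (intro sum_mono2) (auto simp: exp_supp_def)
      moreover have "sum \<gamma> {i, j} = \<gamma> i + \<gamma> j" using \<open>j \<notin> {i}\<close> by simp
      ultimately show False using \<open>\<gamma> i = m\<close> \<open>(\<Sum>j<n. \<gamma> j) = m\<close> j by (simp add: exp_supp_def)
    qed
  qed
  then show ?thesis using pure_expsI[OF assms(2) i(1)] by blast
qed

text \<open>Averaging over \<open>m\<close>-th roots of unity in every variable kills all but the pure powers.\<close>

lemma sum_pure_coeffs_le:
  assumes m: "m \<ge> 1" and r: "\<And>j. 0 \<le> r j"
    and bound: "\<And>y. (\<And>j. cmod (y j) = r j) \<Longrightarrow> cmod (hpoly m n a y) \<le> M"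
  shows "(\<Sum>i<n. cmod (a (pure_exp m i)) * r i ^ m) \<le> M"
proof -
  \<comment> \<open>An m-th root of the conjugate phase of the i-th pure coefficient, so that all
    pure terms become nonnegative.\<close>
  define u where "u i = cis (- Arg (a (pure_exp m i)) / real m)" for i
  define z where "z i = of_real (r i) * u i" for i
  have cz: "cmod (z i) = r i" for i using r by (simp add: z_def u_def norm_mult)
  have az: "a (pure_exp m i) * z i ^ m = of_real (cmod (a (pure_exp m i)) * r i ^ m)" for i
  proof -
    have "u i ^ m = cis (- Arg (a (pure_exp m i)))"
      unfolding u_def using m by (simp only: Complex.DeMoivre) simp
    moreover have "a (pure_exp m i) = of_real (cmod (a (pure_exp m i))) * cis (Arg (a (pure_exp m i)))"
      using rcis_cmod_Arg[of "a (pure_exp m i)"] by (simp add: rcis_def)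
    ultimately have "a (pure_exp m i) * u i ^ m = of_real (cmod (a (pure_exp m i)))"
      by (metis (no_types, lifting) cis_mult cis_zero mult.assoc mult.right_neutral add.right_inverse)
    then show ?thesis by (simp add: z_def power_mult_distrib mult_ac)
  qed
  have "torus_avg m n (hpoly m n a) z = (\<Sum>\<gamma>\<in>exps m n. a \<gamma> * (if \<forall>j<n. m dvd \<gamma> j then monom_val n z \<gamma> else 0))"
    unfolding hpoly_def torus_avg_sum torus_avg_cmult using m by (simp add: torus_avg_monom)
  also have "\<dots> = (\<Sum>\<gamma>\<in>pure_exps m n. a \<gamma> * (if \<forall>j<n. m dvd \<gamma> j then monom_val n z \<gamma> else 0))"
    by (rule sum.mono_neutral_right) (use pure_exps_subset exps_dvd_imp_pure[OF m] in auto)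
  also have "\<dots> = (\<Sum>i<n. of_real (cmod (a (pure_exp m i)) * r i ^ m))"
    unfolding sum_pure_exps[OF m]
    by (rule sum.cong[OF refl]) (auto simp: pure_exp_def[of m] monom_val_pure_exp[unfolded pure_exp_def] az[unfolded pure_exp_def])
  also have "\<dots> = of_real (\<Sum>i<n. cmod (a (pure_exp m i)) * r i ^ m)" by simp
  finally have "\<bar>\<Sum>i<n. cmod (a (pure_exp m i)) * r i ^ m\<bar> = cmod (torus_avg m n (hpoly m n a) z)"
    by (simp only: norm_of_real)
  also have "\<dots> \<le> torus_avg m n (\<lambda>z. cmod (hpoly m n a z)) z" by (rule norm_torus_avg_le)
  also have "\<dots> \<le> M"
    by (rule torus_avg_le_bound) (use m bound cz in auto)
  finally show ?thesis by linarith
qed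

text \<open>The unit ball for finite exponents without the outer root. The case p = \<infinity> is
  reached at the end by inclusion of balls.\<close>

definition in_ball :: "real \<Rightarrow> nat \<Rightarrow> (nat \<Rightarrow> complex) \<Rightarrow> bool" where
  "in_ball p n y \<longleftrightarrow> (\<Sum>j<n. cmod (y j) powr p) \<le> 1"

lemma in_ball_mono:
  assumes "in_ball p n z" "p > 0" "\<And>j. j < n \<Longrightarrow> cmod (y j) \<le> cmod (z j)"
  shows "in_ball p n y"
proof -
  have "(\<Sum>j<n. cmod (y j) powr p) \<le> (\<Sum>j<n. cmod (z j) powr p)"
    using assms by (intro sum_mono powr_mono2) auto
  then show ?thesis using assms(1) by (simp add: in_ball_def)
qed

lemma in_ball_norm_le_1:
  assumes "in_ball p n z" "p > 0" "j < n"
  shows "cmod (z j) \<le> 1"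
proof (rule ccontr)
  assume "\<not> cmod (z j) \<le> 1"
  then have "1 < cmod (z j) powr p" using assms(2) by (simp add: gr_one_powr)
  also have "\<dots> \<le> (\<Sum>j<n. cmod (z j) powr p)" by (rule member_le_sum) (use assms in auto)
  finally show False using assms(1) by (simp add: in_ball_def)
qed

lemma in_ball_exponent_mono:
  assumes "in_ball q n y" "0 < q" "q \<le> p"
  shows "in_ball p n y"
proof -
  have "(\<Sum>j<n. cmod (y j) powr p) \<le> (\<Sum>j<n. cmod (y j) powr q)"
    using in_ball_norm_le_1[OF assms(1,2)] assms(3) by (intro sum_mono powr_mono') auto
  then show ?thesis using assms(1) by (simp add: in_ball_def)
qed

lemma in_ball_even: "m \<ge> 1 \<Longrightarrow> in_ball (2 * real m) n y \<longleftrightarrow> (\<Sum>j<n. cmod (y j) ^ (2 * m)) \<le> 1"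
proof -
  assume m: "m \<ge> 1"
  have "x powr (2 * real m) = x ^ (2 * m)" if "x \<ge> 0" for x :: real
    using that m powr_realpow[of x "2 * m"] by (cases "x = 0") auto
  then show ?thesis by (simp add: in_ball_def)
qed

definition pure_sq :: "nat \<Rightarrow> nat \<Rightarrow> ((nat \<Rightarrow> nat) \<Rightarrow> complex) \<Rightarrow> real" where
  "pure_sq m n a = (\<Sum>i<n. (cmod (a (pure_exp m i)))\<^sup>2)"

definition mixed_part :: "nat \<Rightarrow> nat \<Rightarrow> ((nat \<Rightarrow> nat) \<Rightarrow> complex) \<Rightarrow> (nat \<Rightarrow> nat) \<Rightarrow> complex" where
  "mixed_part m n a \<gamma> = (if \<gamma> \<in> pure_exps m n then 0 else a \<gamma>)"

lemma bw_sq_nonneg: "bw_sq m n a \<ge> 0"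
  unfolding bw_sq_def by (intro sum_nonneg divide_nonneg_pos multinom_pos) auto

lemma bw_sq_eq_0: "bw_sq m n a = 0 \<Longrightarrow> \<gamma> \<in> exps m n \<Longrightarrow> a \<gamma> = 0"
proof -
  assume 0: "bw_sq m n a = 0" and g: "\<gamma> \<in> exps m n"
  have "\<forall>\<gamma>\<in>exps m n. (cmod (a \<gamma>))\<^sup>2 / multinom m n \<gamma> = 0"
    using 0 unfolding bw_sq_def
    by (subst (asm) sum_nonneg_eq_0_iff) (auto intro!: divide_nonneg_pos multinom_pos)
  then show "a \<gamma> = 0" using g multinom_pos[of m n \<gamma>] by auto
qed

lemma bw_sq_split:
  assumes "m \<ge> 1"
  shows "bw_sq m n a = pure_sq m n a + bw_sq m n (mixed_part m n a)"
proof -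
  have "bw_sq m n a = (\<Sum>\<gamma>\<in>pure_exps m n. (cmod (a \<gamma>))\<^sup>2 / multinom m n \<gamma>)
      + (\<Sum>\<gamma>\<in>exps m n - pure_exps m n. (cmod (a \<gamma>))\<^sup>2 / multinom m n \<gamma>)"
    unfolding bw_sq_def by (subst sum.subset_diff[OF pure_exps_subset finite_exps]) (rule add.commute)
  also have "(\<Sum>\<gamma>\<in>pure_exps m n. (cmod (a \<gamma>))\<^sup>2 / multinom m n \<gamma>) = pure_sq m n a"
    unfolding sum_pure_exps[OF assms] pure_sq_def by (simp add: multinom_pure)
  also have "(\<Sum>\<gamma>\<in>exps m n - pure_exps m n. (cmod (a \<gamma>))\<^sup>2 / multinom m n \<gamma>) = bw_sq m n (mixed_part m n a)"
    unfolding bw_sq_def by (rule sum.mono_neutral_cong_left) (auto simp: mixed_part_def)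
  finally show ?thesis .
qed

lemma hpoly_split:
  assumes "m \<ge> 1"
  shows "hpoly m n (mixed_part m n a) z = hpoly m n a z - (\<Sum>i<n. a (pure_exp m i) * z i ^ m)"
proof -
  have "hpoly m n a z = (\<Sum>\<gamma>\<in>pure_exps m n. a \<gamma> * monom_val n z \<gamma>)
      + (\<Sum>\<gamma>\<in>exps m n - pure_exps m n. a \<gamma> * monom_val n z \<gamma>)"
    unfolding hpoly_def by (subst sum.subset_diff[OF pure_exps_subset finite_exps]) (rule add.commute)
  also have "(\<Sum>\<gamma>\<in>pure_exps m n. a \<gamma> * monom_val n z \<gamma>) = (\<Sum>i<n. a (pure_exp m i) * z i ^ m)"
    unfolding sum_pure_exps[OF assms] by (simp add: monom_val_pure_exp)
  also have "(\<Sum>\<gamma>\<in>exps m n - pure_exps m n. a \<gamma> * monom_val n z \<gamma>) = hpoly m n (mixed_part m n a) z"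
    unfolding hpoly_def by (rule sum.mono_neutral_cong_left) (auto simp: mixed_part_def)
  finally show ?thesis by simp
qed

lemma pure_coeffs_le_in_ball:
  assumes m: "m \<ge> 1" and p: "p > 0"
    and bound: "\<And>y. in_ball p n y \<Longrightarrow> cmod (hpoly m n a y) \<le> M"
    and z: "in_ball p n z"
  shows "(\<Sum>i<n. cmod (a (pure_exp m i)) * cmod (z i) ^ m) \<le> M"
proof (rule sum_pure_coeffs_le[OF m])
  fix y assume "\<And>j. cmod (y j) = cmod (z j)"
  then show "cmod (hpoly m n a y) \<le> M" by (intro bound in_ball_mono[OF z p]) simp
qed simp

text \<open>The pure part is bounded by M on the ball by the averaging argument, so subtracting it
  at most doubles the sup bound; squared, this is the 4 in the estimates that follow.\<close>

lemma mixed_part_bound: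
  assumes m: "m \<ge> 1" and p: "p > 0"
    and bound: "\<And>y. in_ball p n y \<Longrightarrow> cmod (hpoly m n a y) \<le> M"
    and z: "in_ball p n z"
  shows "cmod (hpoly m n (mixed_part m n a) z) \<le> 2 * M"
proof -
  have "cmod (\<Sum>i<n. a (pure_exp m i) * z i ^ m) \<le> (\<Sum>i<n. cmod (a (pure_exp m i)) * cmod (z i) ^ m)"
    by (rule order.trans[OF norm_sum]) (simp add: norm_mult norm_power)
  also have "\<dots> \<le> M" by (rule pure_coeffs_le_in_ball[OF m p bound z])
  finally have "cmod (\<Sum>i<n. a (pure_exp m i) * z i ^ m) \<le> M" .
  then show ?thesis
    unfolding hpoly_split[OF m] using bound[OF z] norm_triangle_ineq4[of "hpoly m n a z" "\<Sum>i<n. a (pure_exp m i) * z i ^ m"]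
    by linarith
qed

lemma mixed_bw_sq_le:
  assumes C: "\<And>m n a M. m \<ge> 1 \<Longrightarrow>
     (\<And>y. (\<Sum>j<n. cmod (y j) ^ (2 * m)) \<le> 1 \<Longrightarrow> cmod (hpoly m n a y) \<le> M) \<Longrightarrow>
     (\<forall>\<gamma>\<in>pure_exps m n. a \<gamma> = 0) \<Longrightarrow> bw_sq m n a \<le> C / real m * M\<^sup>2"
    and m: "m \<ge> 1" and p: "2 * real m \<le> p"
    and bound: "\<And>y. in_ball p n y \<Longrightarrow> cmod (hpoly m n a y) \<le> M"
  shows "bw_sq m n (mixed_part m n a) \<le> 4 * C / real m * M\<^sup>2"
proof -
  have "bw_sq m n (mixed_part m n a) \<le> C / real m * (2 * M)\<^sup>2"
  proof (rule C[OF m])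
    fix y :: "nat \<Rightarrow> complex" assume "(\<Sum>j<n. cmod (y j) ^ (2 * m)) \<le> 1"
    then have "in_ball p n y" using in_ball_even[OF m, of n y] p m in_ball_exponent_mono[of "2 * real m" n y p] by simp
    then show "cmod (hpoly m n (mixed_part m n a) y) \<le> 2 * M"
      using m p by (intro mixed_part_bound[OF m _ bound]) auto
  qed (simp add: mixed_part_def)
  then show ?thesis by (simp add: power_mult_distrib mult_ac)
qed

text \<open>The test point has \<open>r\<^sub>i\<^sup>p\<close> proportional to the squared coefficient of \<open>z\<^sub>i\<^sup>m\<close>.\<close>

lemma pure_sq_gain:
  assumes m: "m \<ge> 1" and p: "2 * real m \<le> p"
    and bound: "\<And>y. in_ball p n y \<Longrightarrow> cmod (hpoly m n a y) \<le> M"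
    and b: "\<And>i. i < n \<Longrightarrow> (cmod (a (pure_exp m i)))\<^sup>2 \<le> b" "b \<le> pure_sq m n a" "0 \<le> b"
  shows "pure_sq m n a + (1 - 2 * real m / p) * (pure_sq m n a - b) \<le> M\<^sup>2"
proof -
  define S where "S = pure_sq m n a"
  define c where "c i = cmod (a (pure_exp m i))" for i
  have p0: "p > 0" using m p by simp
  have S0: "S \<ge> 0" unfolding S_def pure_sq_def by (simp add: sum_nonneg)
  show ?thesis
  proof (cases "S = 0")
    case True
    then have "b = 0" using b by (simp add: S_def)
    then show ?thesis using True by (simp add: S_def)
  next
    case False
    then have S: "S > 0" using S0 by simp
    \<comment> \<open>At the test point the i-th term is sqrt(S) x_i^(1/2 + m/p) = sqrt(S)
      x_i^(1-\<eta>). The surplus x_i^(-\<eta>) is at least 1 + \<eta> (1 - x_i), so the gain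
      disappears only if one share x_i is close to 1.\<close>
    define \<eta> where "\<eta> = 1/2 - real m / p"
    have \<eta>: "\<eta> \<ge> 0" using p p0 by (simp add: \<eta>_def field_simps)
    define x where "x i = (c i)\<^sup>2 / S" for i
    have x0: "x i \<ge> 0" for i using S by (simp add: x_def)
    have x1: "(\<Sum>i<n. x i) = 1" unfolding x_def sum_divide_distrib[symmetric] using S
      by (simp add: S_def pure_sq_def c_def)
    define \<delta> where "\<delta> = 1 - b / S"
    have \<delta>: "\<delta> \<ge> 0" using b(2) S by (simp add: \<delta>_def S_def)
    have xb: "1 - x i \<ge> \<delta>" if "i < n" for i
      using b(1)[OF that] S by (simp add: \<delta>_def x_def c_def divide_right_mono)
    define z where "z i = complex_of_real (x i powr (1 / p))" for i
    have cz: "cmod (z i) = x i powr (1 / p)" for i by (simp add: z_def)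
    have "in_ball p n z" unfolding in_ball_def cz using p0 x0 x1 by (simp add: powr_powr)
    from pure_coeffs_le_in_ball[OF m p0 bound this]
    have le: "(\<Sum>i<n. c i * (x i powr (1 / p)) ^ m) \<le> M" by (simp add: c_def cz)
    have term_ge: "sqrt S * (x i * (1 + \<eta> * \<delta>)) \<le> c i * (x i powr (1 / p)) ^ m" if i: "i < n" for i
    proof (cases "c i = 0")
      case True
      then show ?thesis by (simp add: x_def)
    next
      case False
      have cp: "c i > 0" using False by (simp add: c_def)
      then have xp: "x i > 0" using S by (simp add: x_def)
      have ci: "c i = sqrt S * x i powr (1/2)"
        using S cp by (simp add: x_def powr_half_sqrt real_sqrt_divide)
      have "(x i powr (1 / p)) ^ m = x i powr (real m / p)" using xp by (simp add: powr_power)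
      then have "c i * (x i powr (1 / p)) ^ m = sqrt S * (x i powr (1/2) * x i powr (real m / p))"
        by (simp add: ci)
      also have "x i powr (1/2) * x i powr (real m / p) = x i * exp (- \<eta> * ln (x i))"
      proof -
        have "1/2 + real m / p = 1 + (- \<eta>)" by (simp add: \<eta>_def)
        then have "x i powr (1/2) * x i powr (real m / p) = x i powr (1 + (- \<eta>))"
          by (simp only: powr_add[symmetric])
        also have "\<dots> = x i * x i powr (- \<eta>)" using xp by (simp only: powr_add) simp
        also have "x i powr (- \<eta>) = exp (- \<eta> * ln (x i))" using xp by (simp add: powr_def)
        finally show ?thesis .
      qed
      finally have eq: "c i * (x i powr (1 / p)) ^ m = sqrt S * (x i * exp (- \<eta> * ln (x i)))" .
      have "1 + \<eta> * \<delta> \<le> 1 + \<eta> * (1 - x i)" using xb[OF i] \<eta> by (simp add: mult_left_mono)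
      also have "\<dots> \<le> 1 + (- \<eta> * ln (x i))"
      proof -
        have "1 - x i \<le> - ln (x i)" using ln_le_minus_one[OF xp] by simp
        then have "\<eta> * (1 - x i) \<le> \<eta> * (- ln (x i))" using \<eta> by (rule mult_left_mono)
        then show ?thesis by simp
      qed
      also have "\<dots> \<le> exp (- \<eta> * ln (x i))" by (rule exp_ge_add_one_self)
      finally show ?thesis unfolding eq using S xp by (intro mult_left_mono) auto
    qed
    have "sqrt S * (1 + \<eta> * \<delta>) = (\<Sum>i<n. sqrt S * (x i * (1 + \<eta> * \<delta>)))"
      unfolding sum_distrib_left[symmetric] sum_distrib_right[symmetric] x1 by simp
    also have "\<dots> \<le> M" by (rule order.trans[OF sum_mono le]) (use term_ge in auto)
    finally have "sqrt S * (1 + \<eta> * \<delta>) \<le> M" .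
    then have "(sqrt S * (1 + \<eta> * \<delta>))\<^sup>2 \<le> M\<^sup>2" using S \<eta> \<delta> by (intro power_mono) auto
    moreover have "S * (1 + 2 * \<eta> * \<delta>) \<le> (sqrt S * (1 + \<eta> * \<delta>))\<^sup>2"
      using S by (simp add: power_mult_distrib power2_sum)
    ultimately have "S * (1 + 2 * \<eta> * \<delta>) \<le> M\<^sup>2" by linarith
    moreover have "S * (1 + 2 * \<eta> * \<delta>) = S + (1 - 2 * real m / p) * (S - b)"
      using S by (simp add: \<eta>_def \<delta>_def field_simps)
    ultimately show ?thesis by (simp add: S_def)
  qed
qed

section \<open>Slices with respect to one variable\<close>

text \<open>The coefficient of z_j0^(m-k), a form of degree k in the other variables. It is kept as
  a form in all n variables, with value 0 on exponents involving j0, so that the estimates for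
  \<open>hpoly\<close> apply to it unchanged.\<close>

definition slice :: "nat \<Rightarrow> nat \<Rightarrow> ((nat \<Rightarrow> nat) \<Rightarrow> complex) \<Rightarrow> nat \<Rightarrow> (nat \<Rightarrow> nat) \<Rightarrow> complex" where
  "slice m j0 a k \<gamma> = (if \<gamma> j0 = 0 then a (\<gamma>(j0 := m - k)) else 0)"

lemma sum_exps_slices:
  assumes j0: "j0 < n"
  shows "(\<Sum>\<gamma>\<in>exps m n. f \<gamma>) = (\<Sum>k\<le>m. \<Sum>\<gamma>\<in>{\<gamma>\<in>exps k n. \<gamma> j0 = 0}. f (\<gamma>(j0 := m - k)))"
proof -
  have upd: "(\<Sum>j<n. (\<gamma>(j0 := x)) j) = x + (\<Sum>j\<in>{..<n} - {j0}. \<gamma> j)" for \<gamma> :: "nat \<Rightarrow> nat" and x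
    using j0 by (subst sum.remove[of _ j0]) auto
  have tot: "(\<Sum>j<n. \<gamma> j) = \<gamma> j0 + (\<Sum>j\<in>{..<n} - {j0}. \<gamma> j)" for \<gamma> :: "nat \<Rightarrow> nat"
    using j0 by (subst sum.remove[of _ j0]) auto
  have "(\<Sum>k\<le>m. \<Sum>\<gamma>\<in>{\<gamma>\<in>exps k n. \<gamma> j0 = 0}. f (\<gamma>(j0 := m - k))) =
      (\<Sum>(k, \<gamma>)\<in>(SIGMA k:{..m}. {\<gamma>\<in>exps k n. \<gamma> j0 = 0}). f (\<gamma>(j0 := m - k)))"
    by (subst sum.Sigma) auto
  also have "\<dots> = (\<Sum>\<gamma>\<in>exps m n. f \<gamma>)"
  proof (rule sum.reindex_bij_witness[of _ "\<lambda>\<gamma>. (m - \<gamma> j0, \<gamma>(j0 := 0))" "\<lambda>(k, \<gamma>). \<gamma>(j0 := m - k)"])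
    fix \<gamma> assume g: "\<gamma> \<in> exps m n"
    have le: "\<gamma> j0 \<le> m" using exps_le[OF g] .
    show "(m - \<gamma> j0, \<gamma>(j0 := 0)) \<in> (SIGMA k:{..m}. {\<gamma>\<in>exps k n. \<gamma> j0 = 0})"
      using g tot[of \<gamma>] upd[of \<gamma> 0] by (auto simp: exps_def)
    show "(case (m - \<gamma> j0, \<gamma>(j0 := 0)) of (k, \<gamma>) \<Rightarrow> \<gamma>(j0 := m - k)) = \<gamma>"
      using le by auto
  next
    fix p assume "p \<in> (SIGMA k:{..m}. {\<gamma>\<in>exps k n. \<gamma> j0 = 0})"
    then obtain k \<gamma> where p: "p = (k, \<gamma>)" "k \<le> m" "\<gamma> \<in> exps k n" "\<gamma> j0 = 0" by auto
    show "(case p of (k, \<gamma>) \<Rightarrow> \<gamma>(j0 := m - k)) \<in> exps m n"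
      using p j0 tot[of \<gamma>] upd[of \<gamma> "m - k"] by (auto simp: exps_def)
    show "(m - (case p of (k, \<gamma>) \<Rightarrow> \<gamma>(j0 := m - k)) j0, (case p of (k, \<gamma>) \<Rightarrow> \<gamma>(j0 := m - k))(j0 := 0)) = p"
      using p by auto
  qed auto
  finally show ?thesis by simp
qed

lemma sum_slice_cong:
  assumes "\<And>\<gamma>. \<gamma> \<in> exps k n \<Longrightarrow> \<gamma> j0 \<noteq> 0 \<Longrightarrow> g \<gamma> = 0"
    and "\<And>\<gamma>. \<gamma> \<in> exps k n \<Longrightarrow> \<gamma> j0 = 0 \<Longrightarrow> f \<gamma> = g \<gamma>"
  shows "(\<Sum>\<gamma>\<in>{\<gamma>\<in>exps k n. \<gamma> j0 = 0}. f \<gamma>) = (\<Sum>\<gamma>\<in>exps k n. g \<gamma>)"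
  by (rule sum.mono_neutral_cong_left) (use assms in auto)

lemma monom_val_upd_exp:
  assumes "j0 < n" "\<gamma> j0 = 0"
  shows "monom_val n z (\<gamma>(j0 := k)) = z j0 ^ k * monom_val n z \<gamma>"
proof -
  have "monom_val n z (\<gamma>(j0 := k)) = z j0 ^ k * (\<Prod>j\<in>{..<n} - {j0}. z j ^ \<gamma> j)"
    "monom_val n z \<gamma> = (\<Prod>j\<in>{..<n} - {j0}. z j ^ \<gamma> j)"
    unfolding monom_val_def using assms by (subst prod.remove[of _ j0]; simp)+
  then show ?thesis by simp
qed

text \<open>Multiplying all other variables by the same l makes the slices the coefficients of a
  one-variable polynomial in l, to which \<open>coeff_le_twice_defect\<close> applies.\<close>

lemma hpoly_slices:
  assumes j0: "j0 < n"
  shows "hpoly m n a (\<lambda>j. if j = j0 then u else l * z j) =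
    (\<Sum>k\<le>m. u ^ (m - k) * hpoly k n (slice m j0 a k) z * l ^ k)"
  unfolding hpoly_def
proof (rule trans[OF sum_exps_slices[OF j0] sum.cong[OF refl]])
  fix k assume "k \<in> {..m}"
  have "(\<Sum>\<gamma>\<in>{\<gamma>\<in>exps k n. \<gamma> j0 = 0}. a (\<gamma>(j0 := m - k)) *
        monom_val n (\<lambda>j. if j = j0 then u else l * z j) (\<gamma>(j0 := m - k)))
     = (\<Sum>\<gamma>\<in>exps k n. u ^ (m - k) * l ^ k * (slice m j0 a k \<gamma> * monom_val n z \<gamma>))"
  proof (rule sum_slice_cong)
    fix \<gamma> assume g: "\<gamma> \<in> exps k n" "\<gamma> j0 = 0"
    have "monom_val n (\<lambda>j. if j = j0 then u else l * z j) \<gamma> = monom_val n (\<lambda>j. l * z j) \<gamma>"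
      unfolding monom_val_def using g by (intro prod.cong) auto
    also have "\<dots> = l ^ k * monom_val n z \<gamma>" using g by (simp add: monom_val_scale exps_def)
    finally show "a (\<gamma>(j0 := m - k)) * monom_val n (\<lambda>j. if j = j0 then u else l * z j) (\<gamma>(j0 := m - k))
        = u ^ (m - k) * l ^ k * (slice m j0 a k \<gamma> * monom_val n z \<gamma>)"
      using g j0 by (simp add: monom_val_upd_exp slice_def)
  qed (simp add: slice_def)
  then show "(\<Sum>\<gamma>\<in>{\<gamma>\<in>exps k n. \<gamma> j0 = 0}. a (\<gamma>(j0 := m - k)) *
        monom_val n (\<lambda>j. if j = j0 then u else l * z j) (\<gamma>(j0 := m - k)))
     = u ^ (m - k) * (\<Sum>\<gamma>\<in>exps k n. slice m j0 a k \<gamma> * monom_val n z \<gamma>) * l ^ k"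
    by (simp add: sum_distrib_left sum_distrib_right mult_ac)
qed

lemma hpoly_scale:
  "hpoly k n a (\<lambda>j. c * z j) = c ^ k * hpoly k n a z"
  unfolding hpoly_def sum_distrib_left
  by (rule sum.cong[OF refl]) (simp add: monom_val_scale exps_def)

text \<open>For an exponent with m - k in position j0 the multinomial coefficient splits off C(m,k).
  The intermediate slices are therefore discounted by reciprocals of binomials, whose sum is
  O(1/m).\<close>

lemma bw_sq_slices:
  assumes j0: "j0 < n"
  shows "bw_sq m n a = (\<Sum>k\<le>m. bw_sq k n (slice m j0 a k) / real (m choose k))"
  unfolding bw_sq_def
proof (rule trans[OF sum_exps_slices[OF j0] sum.cong[OF refl]])
  fix k assume k: "k \<in> {..m}"
  have "(\<Sum>\<gamma>\<in>{\<gamma>\<in>exps k n. \<gamma> j0 = 0}. (cmod (a (\<gamma>(j0 := m - k))))\<^sup>2 / multinom m n (\<gamma>(j0 := m - k)))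
     = (\<Sum>\<gamma>\<in>exps k n. (cmod (slice m j0 a k \<gamma>))\<^sup>2 / multinom k n \<gamma> / real (m choose k))"
  proof (rule sum_slice_cong)
    fix \<gamma> assume g: "\<gamma> \<in> exps k n" "\<gamma> j0 = 0"
    have "(\<Prod>j<n. fact ((\<gamma>(j0 := m - k)) j) :: real) = fact (m - k) * (\<Prod>j\<in>{..<n} - {j0}. fact (\<gamma> j))"
      "(\<Prod>j<n. fact (\<gamma> j) :: real) = (\<Prod>j\<in>{..<n} - {j0}. fact (\<gamma> j))"
      using j0 g by (subst prod.remove[of _ j0]; simp)+
    then have "multinom m n (\<gamma>(j0 := m - k)) = multinom k n \<gamma> * real (m choose k)"
      using k binomial_fact[of k m, where ?'a=real] by (simp add: multinom_def)
    then show "(cmod (a (\<gamma>(j0 := m - k))))\<^sup>2 / multinom m n (\<gamma>(j0 := m - k)) =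
        (cmod (slice m j0 a k \<gamma>))\<^sup>2 / multinom k n \<gamma> / real (m choose k)"
      using g by (simp add: slice_def)
  qed (simp add: slice_def)
  then show "(\<Sum>\<gamma>\<in>{\<gamma>\<in>exps k n. \<gamma> j0 = 0}. (cmod (a (\<gamma>(j0 := m - k))))\<^sup>2 / multinom m n (\<gamma>(j0 := m - k)))
     = (\<Sum>\<gamma>\<in>exps k n. (cmod (slice m j0 a k \<gamma>))\<^sup>2 / multinom k n \<gamma>) / real (m choose k)"
    by (simp add: sum_divide_distrib)
qed

lemma exps_0: "exps 0 n = {\<lambda>_. 0}"
proof -
  have "\<gamma> = (\<lambda>_. 0)" if "\<gamma> \<in> exps 0 n" for \<gamma>
    using exps_le[OF that] by auto
  then show ?thesis by (auto simp: exps_def)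
qed

lemma hpoly_slice_0: "hpoly 0 n (slice m j0 a 0) z = a (pure_exp m j0)"
  by (simp add: hpoly_def exps_0 slice_def pure_exp_def monom_val_def fun_upd_def)

lemma bw_sq_slice_0: "bw_sq 0 n (slice m j0 a 0) = (cmod (a (pure_exp m j0)))\<^sup>2"
  by (simp add: bw_sq_def exps_0 slice_def pure_exp_def multinom_def fun_upd_def)

text \<open>The slice k = m is the restriction to z_j0 = 0 and carries all the other pure
  powers.\<close>

lemma pure_sq_slice_top:
  assumes "m \<ge> 1" "j0 < n"
  shows "pure_sq m n a = (cmod (a (pure_exp m j0)))\<^sup>2 + pure_sq m n (slice m j0 a m)"
proof -
  have "slice m j0 a m (pure_exp m i) = (if i = j0 then 0 else a (pure_exp m i))" for i
    using assms(1) by (auto simp: slice_def pure_exp_def fun_upd_twist intro!: arg_cong[of _ _ a])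
  then have "pure_sq m n (slice m j0 a m) = (\<Sum>i\<in>{..<n} - {j0}. (cmod (a (pure_exp m i)))\<^sup>2)"
    unfolding pure_sq_def by (intro sum.mono_neutral_cong_right) auto
  then show ?thesis
    unfolding pure_sq_def using assms(2) by (subst sum.remove[of _ j0]) auto
qed

text \<open>The quartic lower bound covers k \<le> m/2 and symmetry of the binomials the rest; two
  of the four powers of k already give summability.\<close>

lemma ex_sum_inverse_binomial_le:
  "\<exists>C>0. \<forall>m\<ge>1. (\<Sum>k=1..<m. 1 / real (m choose k)) \<le> C / real m"
proof -
  obtain c where c: "c > 0" "\<And>N k. 1 \<le> k \<Longrightarrow> 2 * k \<le> N \<Longrightarrow> c * real N * real k ^ 4 \<le> real (N choose k)"
    using ex_binomial_ge_quartic by blast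
  have "(\<Sum>k=1..<m. 1 / real (m choose k)) \<le> 4 / c / real m" if m: "m \<ge> 1" for m
  proof -
    obtain d where d: "m = Suc d" using m by (cases m) auto
    have small: "1 / real (m choose k) \<le> 1 / (c * real m) * (1 / (real k)\<^sup>2)" if "1 \<le> k" "2 * k \<le> m" for k
    proof -
      have "c * real m * (real k)\<^sup>2 \<le> c * real m * real k ^ 4"
        using that c(1) by (intro mult_left_mono power_increasing) auto
      also have "\<dots> \<le> real (m choose k)" using that by (intro c)
      finally have "1 / real (m choose k) \<le> 1 / (c * real m * (real k)\<^sup>2)"
        using that c(1) m by (intro divide_left_mono) (auto simp: zero_less_binomial_iff)
      then show ?thesis by simp
    qed
    have "(\<Sum>k=1..<m. 1 / real (m choose k)) \<le>
        (\<Sum>k=1..d. 1 / (c * real m) * (1 / (real k)\<^sup>2 + 1 / (real (Suc d - k))\<^sup>2))"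
      unfolding d atLeastLessThanSuc_atLeastAtMost
    proof (rule sum_mono)
      fix k assume k: "k \<in> {1..d}"
      have nn: "0 \<le> 1 / (c * real (Suc d)) * (1 / (real x)\<^sup>2)" for x using c(1) by simp
      show "1 / real (Suc d choose k) \<le> 1 / (c * real (Suc d)) * (1 / (real k)\<^sup>2 + 1 / (real (Suc d - k))\<^sup>2)"
      proof (cases "2 * k \<le> Suc d")
        case True
        have "1 / real (m choose k) \<le> 1 / (c * real m) * (1 / (real k)\<^sup>2)"
          using True k d by (intro small) auto
        then show ?thesis using nn[of "Suc d - k"] unfolding d distrib_left by linarith
      next
        case False
        have eq: "Suc d choose k = Suc d choose (Suc d - k)" using k by (intro binomial_symmetric) auto
        have "1 / real (m choose (Suc d - k)) \<le> 1 / (c * real m) * (1 / (real (Suc d - k))\<^sup>2)"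
          using False k d by (intro small) auto
        then show ?thesis using nn[of k] unfolding d distrib_left eq by linarith
      qed
    qed
    also have "\<dots> = 1 / (c * real m) * ((\<Sum>k=1..d. 1 / (real k)\<^sup>2) + (\<Sum>k=1..d. 1 / (real (Suc d - k))\<^sup>2))"
      by (simp only: sum_distrib_left[symmetric] sum.distrib)
    also have "(\<Sum>k=1..d. 1 / (real (Suc d - k))\<^sup>2) = (\<Sum>k=1..d. 1 / (real k)\<^sup>2)"
      by (rule sum.reindex_bij_witness[of _ "\<lambda>k. Suc d - k" "\<lambda>k. Suc d - k"]) auto
    also have "1 / (c * real m) * ((\<Sum>k=1..d. 1 / (real k)\<^sup>2) + (\<Sum>k=1..d. 1 / (real k)\<^sup>2)) \<le> 1 / (c * real m) * 4"
      using sum_inverse_squares_le[of d] c(1) by (intro mult_left_mono) auto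
    finally show ?thesis by simp
  qed
  then show ?thesis using c(1) by (intro exI[of _ "4 / c"]) auto
qed

text \<open>Near a dominant power \<open>z\<^sub>j\<^sub>0\<^sup>m\<close> one gives the other variables the share \<open>s\<close> of the
  \<open>p\<close>-th power budget and rotates their phases jointly.\<close>

lemma slice_bound:
  assumes p: "2 * real m \<le> p" and j0: "j0 < n" and k: "1 \<le> k" "k \<le> m"
    and bound: "\<And>y. in_ball p n y \<Longrightarrow> cmod (hpoly m n a y) \<le> M"
    and \<beta>: "\<beta> = cmod (a (pure_exp m j0))" "\<beta> > 0" "\<beta> \<le> M"
    and s: "0 < s" "s \<le> 1/2" "M\<^sup>2 - \<beta>\<^sup>2 \<le> s * \<beta>\<^sup>2"
    and z: "in_ball p n z"
  shows "cmod (hpoly k n (slice m j0 a k) z) \<le> 6 * \<beta> * sqrt s"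
proof -
  have p0: "p > 0" using p k by simp
  define u where "u = (1 - s) powr (1 / p)"
  define v where "v = s powr (1 / p)"
  have u0: "u > 0" and v0: "v > 0" using s by (auto simp: u_def v_def)
  define c where "c k = of_real u ^ (m - k) * hpoly k n (slice m j0 a k) (\<lambda>j. of_real v * z j)" for k
  have ck: "cmod (c k) = u ^ (m - k) * v ^ k * cmod (hpoly k n (slice m j0 a k) z)" for k
    unfolding c_def hpoly_scale using u0 v0 by (simp add: norm_mult norm_power)
  have upow: "u ^ i = (1 - s) powr (real i / p)" and vpow: "v ^ i = s powr (real i / p)" for i
    using s by (simp_all add: u_def v_def powr_power)
  have "cmod (c k) \<le> 2 * (M - cmod (c 0))"
  proof (rule coeff_le_twice_defect[OF k])
    fix l :: complex assume l: "cmod l = 1"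
    define y where "y = (\<lambda>j. if j = j0 then of_real u else l * (of_real v * z j))"
    have "(\<Sum>j<n. cmod (y j) powr p) = u powr p + (\<Sum>j\<in>{..<n} - {j0}. v powr p * cmod (z j) powr p)"
      using j0 u0 v0 by (subst sum.remove[of _ j0]) (auto simp: y_def norm_mult l powr_mult)
    also have "\<dots> \<le> u powr p + (\<Sum>j<n. v powr p * cmod (z j) powr p)"
      by (intro add_left_mono sum_mono2) auto
    also have "\<dots> = (1 - s) + s * (\<Sum>j<n. cmod (z j) powr p)"
      using s p0 by (simp add: u_def v_def powr_powr sum_distrib_left)
    also have "\<dots> \<le> (1 - s) + s * 1"
      using z s by (intro add_left_mono mult_left_mono) (auto simp: in_ball_def)
    finally have "in_ball p n y" by (simp add: in_ball_def)
    then have "cmod (hpoly m n a y) \<le> M" by (rule bound)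
    then show "cmod (\<Sum>j\<le>m. c j * l ^ j) \<le> M"
      unfolding y_def hpoly_slices[OF j0] c_def .
  qed
  also have "cmod (c 0) = (1 - s) powr (real m / p) * \<beta>"
    unfolding ck by (simp add: hpoly_slice_0 \<beta>(1) upow)
  \<comment> \<open>The defect is linear in s: m/p \<le> 1 gives |c_0| \<ge> (1 - s) \<beta>, and
    the hypothesis on M^2 - \<beta>^2 gives 2 (M - \<beta>) \<le> s \<beta>.\<close>
  also have "2 * (M - (1 - s) powr (real m / p) * \<beta>) \<le> 3 * s * \<beta>"
  proof -
    have "1 - s \<le> (1 - s) powr (real m / p)"
    proof -
      have "(1 - s) powr 1 \<le> (1 - s) powr (real m / p)"
        using s p p0 by (intro powr_mono') (auto simp: field_simps)
      then show ?thesis using s by simp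
    qed
    then have 1: "(1 - s) * \<beta> \<le> (1 - s) powr (real m / p) * \<beta>" using \<beta>(2) by simp
    have "(M - \<beta>) * (2 * \<beta>) \<le> (M - \<beta>) * (M + \<beta>)" using \<beta> by (intro mult_left_mono) auto
    also have "\<dots> \<le> s * \<beta>\<^sup>2" using s(3) by (simp add: power2_eq_square algebra_simps)
    finally have "(2 * (M - \<beta>)) * \<beta> \<le> (s * \<beta>) * \<beta>" by (simp add: power2_eq_square algebra_simps)
    then have "2 * (M - \<beta>) \<le> s * \<beta>" using \<beta>(2) by (rule mult_right_le_imp_le)
    then show ?thesis using 1 by (simp add: algebra_simps)
  qed
  finally have le: "u ^ (m - k) * v ^ k * cmod (hpoly k n (slice m j0 a k) z) \<le> 3 * s * \<beta>"
    unfolding ck .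
  define h where "h = cmod (hpoly k n (slice m j0 a k) z)"
  have "1/2 \<le> u ^ (m - k)"
  proof -
    have "(1 - s) powr 1 \<le> (1 - s) powr (real (m - k) / p)"
      using s p p0 k by (intro powr_mono') (auto simp: field_simps)
    then show ?thesis using s by (simp add: upow)
  qed
  \<comment> \<open>Since k/p \<le> 1/2, undoing the scaling by v costs at most 1/sqrt(s); a defect
    of order s therefore still leaves a bound of order sqrt(s).\<close>
  moreover have "sqrt s \<le> v ^ k"
  proof -
    have "s powr (1/2) \<le> s powr (real k / p)"
      using s p p0 k by (intro powr_mono') (auto simp: field_simps)
    then show ?thesis using s by (simp add: vpow powr_half_sqrt)
  qed
  ultimately have "1/2 * sqrt s * h \<le> u ^ (m - k) * v ^ k * h"
    using s u0 v0 by (intro mult_right_mono mult_mono) (auto simp: h_def)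
  also have "\<dots> \<le> 3 * s * \<beta>" using le by (simp add: h_def)
  also have "\<dots> = sqrt s * (3 * \<beta> * sqrt s)" using s by simp
  finally have "sqrt s * h \<le> sqrt s * (6 * \<beta> * sqrt s)" by simp
  then show ?thesis using s by (simp add: h_def)
qed

section \<open>Rigidity for homogeneous forms\<close>

text \<open>The quantifiers over m, n, a and M stay inside, so that a single C is absolute.\<close>

definition BW_const :: "real \<Rightarrow> bool" where
  "BW_const C \<longleftrightarrow> C > 0 \<and> (\<forall>m n a M. m \<ge> 1 \<longrightarrow>
     (\<forall>y. (\<Sum>j<n. cmod (y j) ^ (2 * m)) \<le> 1 \<longrightarrow> cmod (hpoly m n a y) \<le> M) \<longrightarrow>
     bw_sq m n a \<le> C * M\<^sup>2 \<and>
     ((\<forall>\<gamma>\<in>pure_exps m n. a \<gamma> = 0) \<longrightarrow> bw_sq m n a \<le> C / real m * M\<^sup>2))"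

lemma BW_constD:
  assumes "BW_const C" "m \<ge> 1"
    and "\<And>y. (\<Sum>j<n. cmod (y j) ^ (2 * m)) \<le> 1 \<Longrightarrow> cmod (hpoly m n a y) \<le> M"
  shows "bw_sq m n a \<le> C * M\<^sup>2"
    and "\<forall>\<gamma>\<in>pure_exps m n. a \<gamma> = 0 \<Longrightarrow> bw_sq m n a \<le> C / real m * M\<^sup>2"
proof -
  have "\<forall>y. (\<Sum>j<n. cmod (y j) ^ (2 * m)) \<le> 1 \<longrightarrow> cmod (hpoly m n a y) \<le> M"
    using assms(3) by (intro allI impI)
  note * = assms(1)[unfolded BW_const_def, THEN conjunct2, THEN spec, THEN spec, THEN spec, THEN spec,
      THEN mp, OF assms(2), THEN mp, OF this]
  show "bw_sq m n a \<le> C * M\<^sup>2" using * by (rule conjunct1)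
  show "bw_sq m n a \<le> C / real m * M\<^sup>2" if "\<forall>\<gamma>\<in>pure_exps m n. a \<gamma> = 0"
    using *[THEN conjunct2] that by (rule mp)
qed

lemma BW_const_bound:
  assumes "BW_const C" "m \<ge> 1" "2 * real m \<le> p"
    and bound: "\<And>y. in_ball p n y \<Longrightarrow> cmod (hpoly m n a y) \<le> M"
  shows "bw_sq m n a \<le> C * M\<^sup>2"
proof (rule BW_constD(1)[OF assms(1,2)])
  fix y :: "nat \<Rightarrow> complex" assume "(\<Sum>j<n. cmod (y j) ^ (2 * m)) \<le> 1"
  then have "in_ball (2 * real m) n y" using in_ball_even[OF assms(2)] by simp
  then have "in_ball p n y" by (rule in_ball_exponent_mono) (use assms(2,3) in auto)
  then show "cmod (hpoly m n a y) \<le> M" by (rule bound)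
qed

lemma BW_const_mixed:
  assumes "BW_const C" "m \<ge> 1" "2 * real m \<le> p"
    and bound: "\<And>y. in_ball p n y \<Longrightarrow> cmod (hpoly m n a y) \<le> M"
  shows "bw_sq m n (mixed_part m n a) \<le> 4 * C / real m * M\<^sup>2"
proof (rule mixed_bw_sq_le[OF _ assms(2,3) bound])
  fix m n a M
  assume "m \<ge> 1" "\<And>y. (\<Sum>j<n. cmod (y j) ^ (2 * m)) \<le> 1 \<Longrightarrow> cmod (hpoly m n a y) \<le> M"
    "\<forall>\<gamma>\<in>pure_exps m n. a \<gamma> = 0"
  then show "bw_sq m n a \<le> C / real m * M\<^sup>2" by (rule BW_constD(2)[OF assms(1)])
qed

lemma pure_sq_le:
  assumes m: "m \<ge> 1" and p: "2 * real m \<le> p"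
    and bound: "\<And>y. in_ball p n y \<Longrightarrow> cmod (hpoly m n a y) \<le> M"
  shows "pure_sq m n a \<le> M\<^sup>2"
proof -
  have "(cmod (a (pure_exp m i)))\<^sup>2 \<le> pure_sq m n a" if "i < n" for i
    unfolding pure_sq_def by (rule member_le_sum) (use that in auto)
  moreover have "0 \<le> pure_sq m n a" unfolding pure_sq_def by (rule sum_nonneg) simp
  ultimately have "pure_sq m n a + (1 - 2 * real m / p) * (pure_sq m n a - pure_sq m n a) \<le> M\<^sup>2"
    by (intro pure_sq_gain[OF m p bound] order.refl)
  then show ?thesis by simp
qed

lemma BW_const_at_2m:
  assumes C: "BW_const C" and m: "m \<ge> 1"
    and bound: "\<And>y. in_ball (2 * real m) n y \<Longrightarrow> cmod (hpoly m n a y) \<le> M"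
  shows "bw_sq m n a \<le> (1 + 4 * C / real m) * M\<^sup>2"
proof -
  have "pure_sq m n a \<le> M\<^sup>2" by (rule pure_sq_le[OF m order.refl bound])
  moreover have "bw_sq m n (mixed_part m n a) \<le> 4 * C / real m * M\<^sup>2"
    by (rule BW_const_mixed[OF C m order.refl bound])
  ultimately show ?thesis unfolding bw_sq_split[OF m, of n a] by (simp add: algebra_simps)
qed

text \<open>With \<open>E = M\<^sup>2 - b\<close>, where \<open>b\<close> is the largest squared pure coefficient, everything mixed
  is \<open>O(E / m)\<close> by the slice bound, while the pure gain forces \<open>S - b \<le> E / (1 + A / (3 m))\<close>.\<close>

lemma mixed_le_excess:
  assumes C: "BW_const C" and K: "K > 0" "(\<Sum>k=1..<m. 1 / real (m choose k)) \<le> K / real m"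
    and m: "m \<ge> 1" and p: "2 * real m \<le> p" and j0: "j0 < n"
    and bound: "\<And>y. in_ball p n y \<Longrightarrow> cmod (hpoly m n a y) \<le> M"
    and \<beta>: "\<beta> = cmod (a (pure_exp m j0))" "\<beta> > 0" "\<beta> \<le> M"
    and s: "0 < s" "s \<le> 1/2" "M\<^sup>2 - \<beta>\<^sup>2 \<le> s * \<beta>\<^sup>2"
  shows "bw_sq m n (mixed_part m n a) \<le> 36 * C * (K + 4) / real m * (s * \<beta>\<^sup>2)"
proof -
  define T where "T = (6 * \<beta> * sqrt s)\<^sup>2"
  have T: "T = 36 * (s * \<beta>\<^sup>2)" using s by (simp add: T_def power_mult_distrib)
  have T0: "T \<ge> 0" by (simp add: T_def)
  have C0: "C > 0" using C by (simp add: BW_const_def)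
  have sb: "cmod (hpoly k n (slice m j0 a k) z) \<le> 6 * \<beta> * sqrt s" if "1 \<le> k" "k \<le> m" "in_ball p n z" for k z
    using slice_bound[OF p j0 that(1,2) bound \<beta> s that(3)] .
  have low: "bw_sq k n (slice m j0 a k) \<le> C * T" if k: "1 \<le> k" "k \<le> m" for k
    unfolding T_def by (rule BW_const_bound[OF C k(1), of p]) (use p k sb in auto)
  \<comment> \<open>The binomial discount of the top slice is 1. Its mixed part is small by the 1/m
    bound instead, and its pure part cancels against the pure part of the whole form.\<close>
  have top: "bw_sq m n (mixed_part m n (slice m j0 a m)) \<le> 4 * C / real m * T"
    unfolding T_def by (rule BW_const_mixed[OF C m p]) (use m sb in auto)
  have "{..m} = insert 0 (insert m {1..<m})" using m by auto
  then have "bw_sq m n a = bw_sq 0 n (slice m j0 a 0) + bw_sq m n (slice m j0 a m)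
      + (\<Sum>k=1..<m. bw_sq k n (slice m j0 a k) / real (m choose k))"
    using m by (subst bw_sq_slices[OF j0]) simp
  then have "pure_sq m n a + bw_sq m n (mixed_part m n a) =
      pure_sq m n a + bw_sq m n (mixed_part m n (slice m j0 a m))
      + (\<Sum>k=1..<m. bw_sq k n (slice m j0 a k) / real (m choose k))"
    unfolding bw_sq_slice_0 bw_sq_split[OF m, of n a] bw_sq_split[OF m, of n "slice m j0 a m"]
      pure_sq_slice_top[OF m j0, of a] by simp
  then have "bw_sq m n (mixed_part m n a) = bw_sq m n (mixed_part m n (slice m j0 a m))
      + (\<Sum>k=1..<m. bw_sq k n (slice m j0 a k) / real (m choose k))" by simp
  also have "(\<Sum>k=1..<m. bw_sq k n (slice m j0 a k) / real (m choose k)) \<le> (\<Sum>k=1..<m. C * T * (1 / real (m choose k)))"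
    using low by (intro sum_mono) (auto simp: divide_right_mono)
  also have "\<dots> = C * T * (\<Sum>k=1..<m. 1 / real (m choose k))" by (simp only: sum_distrib_left)
  also have "\<dots> \<le> C * T * (K / real m)" using K(2) C0 T0 by (intro mult_left_mono) auto
  also note top
  finally have "bw_sq m n (mixed_part m n a) \<le> 4 * C / real m * T + C * T * (K / real m)" by simp
  also have "\<dots> = 36 * C * (K + 4) / real m * (s * \<beta>\<^sup>2)"
    unfolding T using m by (simp add: field_simps)
  finally show ?thesis .
qed

text \<open>A bootstrap in two rounds. The crude mixed bound and A \<ge> 96 C first force one pure
  coefficient to dominate, b \<ge> 3S/4. This makes the slice estimate available, and its bound for
  W in terms of the excess, with A \<ge> 432 C (K + 4), leaves no room for a positive
  excess.\<close>

lemma rigidity: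
  assumes C: "BW_const C" and K: "K > 0" "(\<Sum>k=1..<m. 1 / real (m choose k)) \<le> K / real m"
    and A: "A \<ge> 96 * C" "A \<ge> 432 * C * (K + 4)" and mA: "real m \<ge> A" "real m \<ge> 64 * C" and m: "m \<ge> 1"
    and p: "p = 2 * real m + A"
    and bound: "\<And>y. in_ball p n y \<Longrightarrow> cmod (hpoly m n a y) \<le> M" and M0: "M \<ge> 0"
    and le: "M\<^sup>2 \<le> bw_sq m n a" and pos: "bw_sq m n a > 0"
  shows "\<exists>j0<n. \<forall>\<gamma>\<in>exps m n. \<gamma> \<noteq> pure_exp m j0 \<longrightarrow> a \<gamma> = 0"
proof -
  have C0: "C > 0" using C by (simp add: BW_const_def)
  have A0: "A > 0" using A(1) C0 by linarith
  have pm: "2 * real m \<le> p" using A0 p by simp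
  define S where "S = pure_sq m n a"
  define W where "W = bw_sq m n (mixed_part m n a)"
  have SW: "bw_sq m n a = S + W" unfolding S_def W_def by (rule bw_sq_split[OF m])
  have W0: "W \<ge> 0" unfolding W_def by (rule bw_sq_nonneg)
  have W1: "W \<le> 4 * C / real m * M\<^sup>2" unfolding W_def by (rule BW_const_mixed[OF C m pm bound])
  have S1: "S \<le> M\<^sup>2" unfolding S_def by (rule pure_sq_le[OF m pm bound])
  have mpos: "real m > 0" using m by simp
  have q: "4 * C / real m \<le> 1 / 16" using mA(2) mpos by (simp add: field_simps)
  have "W \<le> 1 / 16 * M\<^sup>2" using W1 mult_right_mono[OF q, of "M\<^sup>2"] by simp
  then have M2: "15 * M\<^sup>2 \<le> 16 * S" using le SW by linarith
  then have M2': "M\<^sup>2 \<le> 2 * S" using S1 zero_le_power2[of M] by linarith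
  have "W \<le> S / 15" using \<open>W \<le> 1 / 16 * M\<^sup>2\<close> M2 by linarith
  then have Spos: "S > 0" using pos SW W0 by linarith
  have ne: "{..<n} \<noteq> {}" using Spos by (auto simp: S_def pure_sq_def)
  define B where "B = (\<lambda>i. (cmod (a (pure_exp m i)))\<^sup>2) ` {..<n}"
  define b where "b = Max B"
  have Bf: "finite B" "B \<noteq> {}" using ne by (auto simp: B_def)
  have "b \<in> B" unfolding b_def using Bf by (rule Max_in)
  then obtain j0 where j0: "j0 < n" "(cmod (a (pure_exp m j0)))\<^sup>2 = b" by (auto simp: B_def)
  have bi: "(cmod (a (pure_exp m i)))\<^sup>2 \<le> b" if "i < n" for i
    unfolding b_def using Bf that by (intro Max_ge) (auto simp: B_def)
  have b0: "b \<ge> 0" using j0(2) by (metis zero_le_power2)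
  have bS: "b \<le> S" unfolding j0(2)[symmetric] S_def pure_sq_def
    by (rule member_le_sum) (use j0 in auto)
  \<comment> \<open>A lower bound for the gain 1 - 2m/p = A/p, because m \<ge> A gives p \<le>
    3m.\<close>
  define t where "t = A / (3 * real m)"
  have t: "0 < t" "t \<le> 1/3" using A0 mA mpos by (auto simp: t_def field_simps)
  have gain: "S + t * (S - b) \<le> M\<^sup>2"
  proof -
    have "S + (1 - 2 * real m / p) * (S - b) \<le> M\<^sup>2"
      unfolding S_def by (rule pure_sq_gain[OF m pm bound bi]) (use bS b0 in \<open>auto simp: S_def\<close>)
    moreover have "t \<le> 1 - 2 * real m / p"
    proof -
      have "1 - 2 * real m / p = A / p" using p A0 mpos by (simp add: field_simps)
      moreover have "A / (3 * real m) \<le> A / p" using p A0 mA mpos by (intro divide_left_mono) auto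
      ultimately show ?thesis by (simp add: t_def)
    qed
    then have "t * (S - b) \<le> (1 - 2 * real m / p) * (S - b)" using bS by (intro mult_right_mono) auto
    ultimately show ?thesis by linarith
  qed
  \<comment> \<open>Here t (S - b) \<le> W \<le> 8 C S / m, that is A (S - b) / 3 \<le> 8 C S; the
    choice A \<ge> 96 C turns this into a quarter.\<close>
  have "S - b \<le> S / 4"
  proof -
    have "t * (S - b) \<le> W" using gain le SW by linarith
    also note W1
    also have "4 * C / real m * M\<^sup>2 \<le> 4 * C / real m * (2 * S)"
      using M2' C0 mpos by (intro mult_left_mono) auto
    finally have "(A * (S - b) / 3) / real m \<le> (8 * C * S) / real m"
      by (simp add: t_def)
    then have 1: "A * (S - b) / 3 \<le> 8 * C * S"
      using mpos mult_right_mono[of "A * (S - b) / 3 / real m" "8 * C * S / real m" "real m"] by simp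
    have "96 * C * (S - b) \<le> A * (S - b)"
      by (rule mult_right_mono) (use A bS in auto)
    then have "96 * C * (S - b) / 3 \<le> A * (S - b) / 3" by (rule divide_right_mono) simp
    from order.trans[OF this 1] have "96 * C * (S - b) / 3 \<le> 8 * C * S" .
    moreover have "96 * C * (S - b) / 3 = C * (32 * (S - b))" "8 * C * S = C * (8 * S)" by simp_all
    ultimately have "C * (32 * (S - b)) \<le> C * (8 * S)" by (simp only:)
    then have "32 * (S - b) \<le> 8 * S" using C0 by (rule mult_left_le_imp_le)
    then show ?thesis by simp
  qed
  then have b34: "b \<ge> 3/4 * S" by linarith
  then have bpos: "b > 0" using Spos by linarith
  define \<beta> where "\<beta> = cmod (a (pure_exp m j0))"
  have \<beta>2: "\<beta>\<^sup>2 = b" using j0 by (simp add: \<beta>_def)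
  have \<beta>pos: "\<beta> > 0" using \<beta>2 bpos by (auto simp: \<beta>_def)
  define E where "E = M\<^sup>2 - b"
  have E0: "E \<ge> 0" using S1 bS by (simp add: E_def)
  have \<beta>M: "\<beta> \<le> M" by (rule power2_le_imp_le[OF _ M0]) (use E0 \<beta>2 in \<open>simp add: E_def\<close>)
  \<comment> \<open>From M^2 \<le> 16 S / 15 and S \<le> 4b/3 one gets E \<le> 19 b / 45, so s = E/b
    is admissible in the slice estimate.\<close>
  have Eb: "E \<le> b / 2" unfolding E_def using M2 b34 Spos by linarith
  define D where "D = 36 * C * (K + 4) / real m"
  have D0: "D > 0" using C0 K mpos by (simp add: D_def)
  have Ws: "W \<le> D * (s * b)" if "0 < s" "s \<le> 1/2" "E \<le> s * b" for s
  proof -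
    have "M\<^sup>2 - \<beta>\<^sup>2 \<le> s * \<beta>\<^sup>2" unfolding \<beta>2 using that(3) by (simp only: E_def)
    from mixed_le_excess[OF C K m pm j0(1) bound \<beta>_def \<beta>pos \<beta>M that(1,2) this]
    show ?thesis unfolding W_def D_def \<beta>2 .
  qed
  have WE: "W \<le> D * E"
  proof (cases "E = 0")
    case False
    have "W \<le> D * (E / b * b)" 
    proof (rule Ws)
      show "0 < E / b" using E0 False bpos by simp
      show "E / b \<le> 1 / 2" using Eb bpos by (simp add: divide_le_eq)
    qed (use bpos in simp)
    then show ?thesis using bpos by simp
  next
    \<comment> \<open>The slice estimate requires s > 0, so s = E/b is excluded when E = 0. Every
      small positive s is then admissible, and one is chosen that would give W \<le> W/2.\<close>
    case True
    show ?thesis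
    proof (rule ccontr)
      assume "\<not> W \<le> D * E"
      then have Wp: "W > 0" using True by simp
      define s where "s = min (1/2) (W / (2 * D * b))"
      have s: "0 < s" "s \<le> 1/2" using Wp D0 bpos by (auto simp: s_def)
      have "W \<le> D * (s * b)" by (rule Ws[OF s]) (use True s bpos in simp)
      also have "\<dots> \<le> D * (W / (2 * D * b) * b)" using D0 bpos by (intro mult_left_mono mult_right_mono) (auto simp: s_def)
      also have "\<dots> = W / 2" using D0 bpos by simp
      finally show False using Wp by simp
    qed
  qed
  \<comment> \<open>Since 432 = 12 * 36, the hypothesis on A says 36 C (K + 4) \<le> A/12, and A /
    (12m) = t/4.\<close>
  have Dt: "D \<le> t / 4"
  proof -
    have "36 * C * (K + 4) \<le> A / 12" using A(2) by simp
    then have "D \<le> A / 12 / real m" unfolding D_def using mpos by (intro divide_right_mono) auto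
    then show ?thesis by (simp add: t_def)
  qed
  \<comment> \<open>The gain gives S - b \<le> E / (1 + t), and E \<le> (S - b) + W with W \<le> t E
    / 4. For E > 0 this would force (1 + t)(1 - t/4) \<le> 1, which fails for 0 < t \<le>
    1/3.\<close>
  have "E = 0"
  proof (rule ccontr)
    assume "E \<noteq> 0"
    then have Ep: "E > 0" using E0 by simp
    have 1: "(1 + t) * (S - b) \<le> E" using gain by (simp add: E_def algebra_simps)
    have "E \<le> (S - b) + W" using le SW by (simp add: E_def)
    also have "W \<le> t / 4 * E" using WE mult_right_mono[OF Dt E0] by linarith
    finally have "(1 - t / 4) * E \<le> S - b" by (simp add: algebra_simps)
    then have "(1 + t) * ((1 - t / 4) * E) \<le> (1 + t) * (S - b)" using t by (intro mult_left_mono) auto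
    then have "(1 + t) * (1 - t / 4) * E \<le> 1 * E" using 1 by (simp add: mult.assoc)
    then have "(1 + t) * (1 - t / 4) \<le> 1" using Ep by (rule mult_right_le_imp_le)
    then have "t * (3/4 - t / 4) \<le> 0" by (simp add: algebra_simps)
    moreover have "t * (3/4 - t / 4) > 0" using t by (intro mult_pos_pos) auto
    ultimately show False by linarith
  qed
  then have W_eq: "W = 0" using WE W0 by simp
  have Sb: "S = b" using \<open>E = 0\<close> S1 bS by (simp add: E_def)
  have "a \<gamma> = 0" if g: "\<gamma> \<in> exps m n" "\<gamma> \<noteq> pure_exp m j0" for \<gamma>
  proof (cases "\<gamma> \<in> pure_exps m n")
    case False
    then show ?thesis using bw_sq_eq_0[of m n "mixed_part m n a" \<gamma>] W_eq g by (simp add: W_def mixed_part_def)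
  next
    case True
    then obtain i where i: "i < n" "\<gamma> = pure_exp m i" by (auto simp: pure_exps_def)
    have "(\<Sum>i\<in>{j0, i}. (cmod (a (pure_exp m i)))\<^sup>2) \<le> S"
      unfolding S_def pure_sq_def using i j0 by (intro sum_mono2) auto
    moreover have "i \<noteq> j0" using i g by auto
    ultimately show ?thesis using Sb j0 i by simp
  qed
  then show ?thesis using j0 by blast
qed

section \<open>Translation to finitely supported coefficients\<close>

text \<open>\<open>Abs_poly_mapping\<close> is meaningful only on finitely supported functions; all
  members of \<open>exps m n\<close> are of this kind.\<close>

definition coeff_fun :: "cpoly \<Rightarrow> (nat \<Rightarrow> nat) \<Rightarrow> complex" where
  "coeff_fun P \<gamma> = Poly_Mapping.lookup P (Abs_poly_mapping \<gamma>)"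

lemma coeff_fun_lookup [simp]: "coeff_fun P (Poly_Mapping.lookup \<alpha>) = Poly_Mapping.lookup P \<alpha>"
  by (simp add: coeff_fun_def)

lemma prod_keys_eq:
  fixes \<alpha> :: multi_index
  assumes "Poly_Mapping.keys \<alpha> \<subseteq> {..<n}" "\<And>j. f j 0 = 1"
  shows "(\<Prod>j\<in>Poly_Mapping.keys \<alpha>. f j (Poly_Mapping.lookup \<alpha> j)) = (\<Prod>j<n. f j (Poly_Mapping.lookup \<alpha> j))"
  by (rule prod.mono_neutral_left) (use assms in \<open>auto simp: in_keys_iff\<close>)

lemma mi_degree_eq:
  assumes "Poly_Mapping.keys \<alpha> \<subseteq> {..<n}"
  shows "mi_degree \<alpha> = (\<Sum>j<n. Poly_Mapping.lookup \<alpha> j)"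
  unfolding mi_degree_def by (rule sum.mono_neutral_left) (use assms in \<open>auto simp: in_keys_iff\<close>)

lemma lookup_in_exps: "\<alpha> \<in> multi_indices m n \<Longrightarrow> Poly_Mapping.lookup \<alpha> \<in> exps m n"
  using mi_degree_eq[of \<alpha> n] by (auto simp: multi_indices_def exps_def in_keys_iff subset_iff)

lemma exps_eq_lookup_image: "exps m n = Poly_Mapping.lookup ` multi_indices m n"
proof (intro equalityI subsetI)
  fix \<gamma> assume g: "\<gamma> \<in> exps m n"
  have lt: "j < n" if "\<gamma> j \<noteq> 0" for j
    using g that unfolding exps_def by (cases "j < n") auto
  have "finite {j. \<gamma> j \<noteq> 0}"
    by (rule finite_subset[of _ "{..<n}"]) (use lt in auto)
  then have lk: "Poly_Mapping.lookup (Abs_poly_mapping \<gamma>) = \<gamma>" by (simp add: lookup_Abs_poly_mapping)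
  have ks: "Poly_Mapping.keys (Abs_poly_mapping \<gamma>) \<subseteq> {..<n}"
    using lt by (auto simp: in_keys_iff lk)
  have "Abs_poly_mapping \<gamma> \<in> multi_indices m n"
    using g mi_degree_eq[OF ks] ks by (simp add: multi_indices_def lk exps_def)
  then show "\<gamma> \<in> Poly_Mapping.lookup ` multi_indices m n" using lk by (intro image_eqI[of _ _ "Abs_poly_mapping \<gamma>"]) simp_all
qed (auto simp: lookup_in_exps)

lemma inj_on_lookup: "inj_on Poly_Mapping.lookup A"
  by (rule inj_onI) (rule poly_mapping_eqI, simp)

lemma sum_exps_eq: "(\<Sum>\<gamma>\<in>exps m n. f \<gamma>) = (\<Sum>\<alpha>\<in>multi_indices m n. f (Poly_Mapping.lookup \<alpha>))"
  unfolding exps_eq_lookup_image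
  by (simp add: sum.reindex[OF inj_on_lookup])

lemma finite_multi_indices: "finite (multi_indices m n)"
proof -
  have "finite (Poly_Mapping.lookup ` multi_indices m n)"
    using finite_exps[of m n] unfolding exps_eq_lookup_image .
  then show ?thesis by (rule finite_imageD[OF _ inj_on_lookup])
qed

lemma poly_eval_eq:
  assumes "P \<in> homogeneous_polys m n"
  shows "poly_eval P z = hpoly m n (coeff_fun P) z"
proof -
  have sub: "Poly_Mapping.keys P \<subseteq> multi_indices m n" using assms by (simp add: homogeneous_polys_def)
  have "hpoly m n (coeff_fun P) z = (\<Sum>\<alpha>\<in>multi_indices m n. Poly_Mapping.lookup P \<alpha> * mi_power z \<alpha>)"
    unfolding hpoly_def sum_exps_eq
    by (rule sum.cong[OF refl])
      (simp add: multi_indices_def mi_power_def monom_val_def prod_keys_eq[of _ n "\<lambda>j k. z j ^ k"])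
  also have "\<dots> = poly_eval P z"
    unfolding poly_eval_def
    by (rule sum.mono_neutral_right) (use sub finite_multi_indices in \<open>auto simp: in_keys_iff\<close>)
  finally show ?thesis by simp
qed

lemma bw_norm_eq:
  assumes "P \<in> homogeneous_polys m n"
  shows "bw_norm m P = sqrt (bw_sq m n (coeff_fun P))"
proof -
  have sub: "Poly_Mapping.keys P \<subseteq> multi_indices m n" using assms by (simp add: homogeneous_polys_def)
  have "bw_sq m n (coeff_fun P) =
      (\<Sum>\<alpha>\<in>multi_indices m n. real (mi_fact \<alpha>) / fact m * (cmod (Poly_Mapping.lookup P \<alpha>))\<^sup>2)"
    unfolding bw_sq_def sum_exps_eq
  proof (rule sum.cong[OF refl])
    fix \<alpha> assume "\<alpha> \<in> multi_indices m n"
    then have "real (mi_fact \<alpha>) = (\<Prod>j<n. fact (Poly_Mapping.lookup \<alpha> j))"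
      by (simp add: multi_indices_def mi_fact_def prod_keys_eq[of _ n "\<lambda>j k. fact k"])
    then show "(cmod (coeff_fun P (Poly_Mapping.lookup \<alpha>)))\<^sup>2 / multinom m n (Poly_Mapping.lookup \<alpha>) =
       real (mi_fact \<alpha>) / fact m * (cmod (Poly_Mapping.lookup P \<alpha>))\<^sup>2"
      by (simp add: multinom_def)
  qed
  also have "\<dots> = (\<Sum>\<alpha>\<in>Poly_Mapping.keys P. real (mi_fact \<alpha>) / fact m * (cmod (Poly_Mapping.lookup P \<alpha>))\<^sup>2)"
    by (rule sum.mono_neutral_right) (use sub finite_multi_indices in \<open>auto simp: in_keys_iff\<close>)
  finally show ?thesis by (simp add: bw_norm_def)
qed

lemma bw_norm_pos:
  assumes "P \<in> homogeneous_polys m n" "P \<noteq> 0"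
  shows "bw_norm m P > 0"
proof -
  obtain \<alpha> where \<alpha>: "\<alpha> \<in> Poly_Mapping.keys P" using assms(2) by (metis ex_in_conv keys_eq_empty)
  then have "\<alpha> \<in> multi_indices m n" using assms(1) by (auto simp: homogeneous_polys_def)
  then have "coeff_fun P (Poly_Mapping.lookup \<alpha>) \<noteq> 0" "Poly_Mapping.lookup \<alpha> \<in> exps m n"
    using \<alpha> by (auto simp: in_keys_iff lookup_in_exps)
  then have "bw_sq m n (coeff_fun P) \<noteq> 0" using bw_sq_eq_0 by blast
  then show ?thesis using bw_sq_nonneg[of m n "coeff_fun P"] by (simp add: bw_norm_eq[OF assms(1)])
qed

lemma lp_ball_iff:
  assumes "p > 0"
  shows "lp_norm (ereal p) n z \<le> 1 \<longleftrightarrow> in_ball p n z"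
proof -
  define x where "x = (\<Sum>i<n. cmod (z i) powr p)"
  have x: "x \<ge> 0" by (simp add: x_def sum_nonneg)
  have "x powr (1 / p) \<le> 1 \<longleftrightarrow> x \<le> 1"
  proof
    assume "x powr (1 / p) \<le> 1"
    then have "(x powr (1 / p)) powr p \<le> 1 powr p" using assms by (intro powr_mono2) auto
    then show "x \<le> 1" using x assms by (simp add: powr_powr)
  next
    assume "x \<le> 1"
    then have "x powr (1 / p) \<le> 1 powr (1 / p)" using x assms by (intro powr_mono2) auto
    then show "x powr (1 / p) \<le> 1" by simp
  qed
  then show ?thesis by (simp add: lp_norm_def in_ball_def x_def)
qed

text \<open>The condition n \<ge> 1 keeps \<open>Max\<close> away from the empty set.\<close>

lemma lp_ball_infinity:
  assumes "n \<ge> 1"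
  shows "lp_norm \<infinity> n z \<le> 1 \<longleftrightarrow> (\<forall>j<n. cmod (z j) \<le> 1)"
proof -
  have "0 \<in> {..<n}" using assms by simp
  then have "(\<lambda>i. cmod (z i)) ` {..<n} \<noteq> {}" by blast
  then show ?thesis by (auto simp: lp_norm_def)
qed

lemma lp_ball_coord_le:
  assumes "lp_norm p n z \<le> 1" "0 < p" "n \<ge> 1" "j < n"
  shows "cmod (z j) \<le> 1"
proof (cases p)
  case (real q)
  then show ?thesis using assms lp_ball_iff[of q n z] in_ball_norm_le_1[of q n z j] by simp
next
  case PInf
  then show ?thesis using assms lp_ball_infinity[of n z] by auto
qed (use assms in auto)

text \<open>Unit balls grow with the exponent, so a bound by the sup norm for p holds on the ball of
  any smaller finite exponent q. This reduces the whole range of p, including \<infinity>, to the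
  single exponent 2m + A.\<close>

lemma in_ball_imp_lp_ball:
  assumes "in_ball q n z" "0 < q" "ereal q \<le> p" "n \<ge> 1"
  shows "lp_norm p n z \<le> 1"
proof (cases p)
  case (real r)
  then show ?thesis using assms lp_ball_iff[of r n z] in_ball_exponent_mono[of q n z r] by simp
next
  case PInf
  then show ?thesis using assms lp_ball_infinity[of n z] in_ball_norm_le_1[of q n z] by auto
qed (use assms in auto)

lemma sup_norm_bdd_above:
  assumes "P \<in> homogeneous_polys m n" "0 < p" "n \<ge> 1"
  shows "bdd_above ((\<lambda>z. cmod (poly_eval P z)) ` {z. lp_norm p n z \<le> 1})"
proof (rule bdd_aboveI2)
  fix z assume "z \<in> {z. lp_norm p n z \<le> 1}"
  then have z: "cmod (z j) \<le> 1" if "j < n" for j using lp_ball_coord_le[of p n z j] assms that by simp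
  have mon: "cmod (monom_val n z \<gamma>) \<le> 1" for \<gamma>
  proof -
    have "monom_val n (\<lambda>j. cmod (z j)) \<gamma> \<le> 1"
      unfolding monom_val_def using z by (intro prod_le_1) (auto simp: power_le_one)
    then show ?thesis by (simp add: cmod_monom_val)
  qed
  have "cmod (poly_eval P z) \<le> (\<Sum>\<gamma>\<in>exps m n. cmod (coeff_fun P \<gamma>) * cmod (monom_val n z \<gamma>))"
    unfolding poly_eval_eq[OF assms(1)] hpoly_def by (rule order.trans[OF norm_sum]) (simp add: norm_mult)
  also have "\<dots> \<le> (\<Sum>\<gamma>\<in>exps m n. cmod (coeff_fun P \<gamma>) * 1)"
    by (intro sum_mono mult_left_mono mon) simp
  finally show "cmod (poly_eval P z) \<le> (\<Sum>\<gamma>\<in>exps m n. cmod (coeff_fun P \<gamma>) * 1)" .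
qed

lemma sup_norm_upper:
  assumes "P \<in> homogeneous_polys m n" "0 < p" "n \<ge> 1" "lp_norm p n z \<le> 1"
  shows "cmod (poly_eval P z) \<le> sup_norm p n P"
  unfolding sup_norm_def by (rule cSUP_upper[OF _ sup_norm_bdd_above[OF assms(1-3)]]) (use assms in auto)

lemma sup_norm_bounds_hpoly:
  assumes "P \<in> homogeneous_polys m n" "0 < q" "ereal q \<le> p" "n \<ge> 1" "in_ball q n y"
  shows "cmod (hpoly m n (coeff_fun P) y) \<le> sup_norm p n P"
proof -
  have "0 < p" using assms(2,3) by (metis ereal_less(2) order_less_le_trans)
  then show ?thesis
    using sup_norm_upper[OF assms(1) _ assms(4) in_ball_imp_lp_ball[OF assms(5,2,3,4)]]
    by (simp add: poly_eval_eq[OF assms(1)])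
qed

lemma in_ball_unit: "p > 0 \<Longrightarrow> j < n \<Longrightarrow> in_ball p n (\<lambda>i. if i = j then 1 else 0)"
  unfolding in_ball_def by (simp add: if_distrib[of "\<lambda>x. cmod x powr p"] cong: if_cong)

lemma sup_norm_nonneg:
  assumes "P \<in> homogeneous_polys m n" "0 < q" "ereal q \<le> p" "n \<ge> 1"
  shows "sup_norm p n P \<ge> 0"
proof -
  have "in_ball q n (\<lambda>_. 0)" by (simp add: in_ball_def)
  from order.trans[OF norm_ge_zero sup_norm_bounds_hpoly[OF assms this]] show ?thesis .
qed

lemma sup_norm_power:
  assumes "P \<in> homogeneous_polys m n" "0 < q" "ereal q \<le> p" "j < n"
    and ev: "\<And>z. poly_eval P z = c * z j ^ m"
  shows "sup_norm p n P = cmod c"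
proof (rule antisym)
  have n: "n \<ge> 1" and p: "0 < p" using assms(2-4) by (auto intro: order_less_le_trans[of 0 "ereal q"])
  let ?e = "\<lambda>i. if i = j then 1 else 0 :: complex"
  have e: "lp_norm p n ?e \<le> 1"
    by (rule in_ball_imp_lp_ball[OF in_ball_unit[OF assms(2,4)] assms(2,3) n])
  show "sup_norm p n P \<le> cmod c"
    unfolding sup_norm_def
  proof (rule cSUP_least)
    show "{z. lp_norm p n z \<le> 1} \<noteq> {}" using e by blast
    fix z assume "z \<in> {z. lp_norm p n z \<le> 1}"
    then have "cmod (z j) \<le> 1" using lp_ball_coord_le[of p n z j] p n assms(4) by simp
    then have "cmod c * cmod (z j) ^ m \<le> cmod c * 1" by (intro mult_left_mono power_le_one) auto
    then show "cmod (poly_eval P z) \<le> cmod c" by (simp add: ev norm_mult norm_power)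
  qed
  show "cmod c \<le> sup_norm p n P"
    using sup_norm_upper[OF assms(1) p n e] by (simp add: ev)
qed

definition power_poly :: "nat \<Rightarrow> nat \<Rightarrow> complex \<Rightarrow> cpoly" where
  "power_poly m j c = Poly_Mapping.single (Poly_Mapping.single j m) c"

lemma power_poly_props:
  assumes "m \<ge> 1" "c \<noteq> 0" "j < n"
  shows "power_poly m j c \<in> homogeneous_polys m n" "power_poly m j c \<noteq> 0"
    "poly_eval (power_poly m j c) z = c * z j ^ m" "bw_norm m (power_poly m j c) = cmod c"
proof -
  show "power_poly m j c \<in> homogeneous_polys m n"
    using assms by (auto simp: power_poly_def homogeneous_polys_def multi_indices_def mi_degree_def)
  have "Poly_Mapping.keys (power_poly m j c) \<noteq> {}" using assms by (simp add: power_poly_def)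
  then show "power_poly m j c \<noteq> 0" by (metis keys_zero)
  show "poly_eval (power_poly m j c) z = c * z j ^ m" "bw_norm m (power_poly m j c) = cmod c"
    using assms by (simp_all add: power_poly_def poly_eval_def mi_power_def bw_norm_def mi_fact_def)
qed

section \<open>Conclusion\<close>

text \<open>The rigidity statement describes P by its values; evaluation at a unit vector recovers
  the pure coefficient from them.\<close>

lemma hpoly_unit:
  assumes m: "m \<ge> 1" and j: "j < n"
  shows "hpoly m n a (\<lambda>i. if i = j then 1 else 0) = a (pure_exp m j)"
proof -
  have mem: "pure_exp m j \<in> exps m n" using pure_exps_subset[of m n] j by (auto simp: pure_exps_def)
  have "monom_val n (\<lambda>i. if i = j then 1 else 0) \<gamma> = (0::complex)"
    if g: "\<gamma> \<in> exps m n" "\<gamma> \<noteq> pure_exp m j" for \<gamma>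
  proof -
    have "\<exists>i<n. i \<noteq> j \<and> \<gamma> i \<noteq> 0"
    proof (rule ccontr)
      assume "\<not> ?thesis"
      then have z: "\<gamma> i = 0" if "i \<noteq> j" for i
        using that g(1) by (cases "i < n") (auto simp: exps_def)
      have "(\<Sum>i<n. \<gamma> i) = (\<Sum>i\<in>{j}. \<gamma> i)"
        by (rule sum.mono_neutral_right) (use j z in auto)
      then have "\<gamma> j = m" using g(1) by (simp add: exps_def)
      then have "\<gamma> = pure_exp m j" using z by (auto simp: pure_exp_def)
      then show False using g(2) by simp
    qed
    then obtain i where "i < n" "i \<noteq> j" "\<gamma> i \<noteq> 0" by blast
    then show ?thesis unfolding monom_val_def by (intro prod_zero) auto
  qed
  then have "hpoly m n a (\<lambda>i. if i = j then 1 else 0) =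
      (\<Sum>\<gamma>\<in>{pure_exp m j}. a \<gamma> * monom_val n (\<lambda>i. if i = j then 1 else 0) \<gamma>)"
    unfolding hpoly_def by (intro sum.mono_neutral_right) (use mem in auto)
  then show ?thesis using j by (simp add: monom_val_pure_exp)
qed

lemma C_BW_ge_1:
  assumes "m \<ge> 1" "0 < q" "ereal q \<le> p"
  shows "1 \<le> C_BW m p"
proof -
  define P where "P = power_poly m 0 1"
  have P: "P \<in> homogeneous_polys m 1" "P \<noteq> 0" "bw_norm m P = 1"
    using power_poly_props[of m 1 0 1] assms(1) by (simp_all add: P_def)
  have "sup_norm p 1 P = cmod 1"
    by (rule sup_norm_power[OF P(1) assms(2,3), of 0])
      (use power_poly_props(3)[of m 1 0 1] assms(1) in \<open>auto simp: P_def\<close>)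
  then have "1 = ereal (bw_norm m P / sup_norm p 1 P)" using P by simp
  also have "\<dots> \<le> (SUP P\<in>homogeneous_polys m 1 - {0}. ereal (bw_norm m P / sup_norm p 1 P))"
    by (rule SUP_upper) (use P in simp)
  also have "\<dots> \<le> C_BW m p"
    unfolding C_BW_def by (rule SUP_upper) simp
  finally show ?thesis .
qed

text \<open>The product form of the hypothesis needs no positivity of the sup norm: if it is 0, the
  quotient is 0 by convention and still at most B.\<close>

lemma C_BW_le:
  assumes "B \<ge> 0" "\<And>n P. n \<ge> 1 \<Longrightarrow> P \<in> homogeneous_polys m n \<Longrightarrow> P \<noteq> 0 \<Longrightarrow> 0 \<le> sup_norm p n P \<and> bw_norm m P \<le> B * sup_norm p n P"
  shows "C_BW m p \<le> ereal B"
  unfolding C_BW_def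
proof (intro SUP_least)
  fix n P assume "n \<in> {1::nat..}" and "P \<in> homogeneous_polys m n - {0}"
  then have "0 \<le> sup_norm p n P" "bw_norm m P \<le> B * sup_norm p n P" using assms(2)[of n P] by auto
  then have "bw_norm m P / sup_norm p n P \<le> B"
    using assms(1) by (cases "sup_norm p n P = 0") (auto simp: divide_le_eq)
  then show "ereal (bw_norm m P / sup_norm p n P) \<le> ereal B" by simp
qed

lemma bw_norm_le_at_2m:
  assumes C: "BW_const C" and m: "m \<ge> 1" and n: "n \<ge> 1" and P: "P \<in> homogeneous_polys m n"
  shows "bw_norm m P \<le> (1 + 4 * C / real m) * sup_norm (ereal (2 * real m)) n P"
proof -
  define M where "M = sup_norm (ereal (2 * real m)) n P"
  have M0: "M \<ge> 0" unfolding M_def by (rule sup_norm_nonneg[OF P _ order.refl n]) (use m in simp)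
  have "bw_sq m n (coeff_fun P) \<le> (1 + 4 * C / real m) * M\<^sup>2"
    by (rule BW_const_at_2m[OF C m]) (use sup_norm_bounds_hpoly[OF P _ order.refl n] m in \<open>auto simp: M_def\<close>)
  \<comment> \<open>A factor that is at least 1 is at most its square; this passes from squared
    norms to norms while keeping the form 1 + O(1/m).\<close>
  also have "\<dots> \<le> (1 + 4 * C / real m)\<^sup>2 * M\<^sup>2"
  proof (rule mult_right_mono)
    have "1 + 4 * C / real m \<ge> 1" using C by (simp add: BW_const_def)
    then show "1 + 4 * C / real m \<le> (1 + 4 * C / real m)\<^sup>2" by (simp add: self_le_power)
  qed simp
  finally have "bw_sq m n (coeff_fun P) \<le> ((1 + 4 * C / real m) * M)\<^sup>2" by (simp add: power_mult_distrib)
  then have "sqrt (bw_sq m n (coeff_fun P)) \<le> (1 + 4 * C / real m) * M"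
    using C M0 by (intro real_le_lsqrt) (auto simp: BW_const_def)
  then show ?thesis by (simp add: bw_norm_eq[OF P] M_def)
qed

text \<open>The hypothesis is a weak inequality so that one statement serves twice: it refutes a
  strict inequality, which gives the constant 1, and it identifies the polynomials with
  equality.\<close>

lemma power_if_sup_le_bw:
  assumes C: "BW_const C" and K: "K > 0" "(\<Sum>k=1..<m. 1 / real (m choose k)) \<le> K / real m"
    and A: "A \<ge> 96 * C" "A \<ge> 432 * C * (K + 4)" and mA: "real m \<ge> A" "real m \<ge> 64 * C" and m: "m \<ge> 1"
    and p: "ereal (2 * real m + A) \<le> p" and n: "n \<ge> 1"
    and P: "P \<in> homogeneous_polys m n" "P \<noteq> 0" and le: "sup_norm p n P \<le> bw_norm m P"
  shows "bw_norm m P = sup_norm p n P \<and> (\<exists>j<n. \<exists>c. c \<noteq> 0 \<and> (\<forall>z. poly_eval P z = c * z j ^ m))"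
proof -
  define a where "a = coeff_fun P"
  define q where "q = 2 * real m + A"
  have C0: "C > 0" using C by (simp add: BW_const_def)
  have q0: "q > 0" using C0 A(1) m by (simp add: q_def)
  have qp: "ereal q \<le> p" using p by (simp add: q_def)
  have M0: "sup_norm p n P \<ge> 0" by (rule sup_norm_nonneg[OF P(1) q0 qp n])
  have bwp: "bw_norm m P > 0" by (rule bw_norm_pos[OF P])
  have bw: "(bw_norm m P)\<^sup>2 = bw_sq m n a" by (simp add: bw_norm_eq[OF P(1)] a_def bw_sq_nonneg)
  have "\<exists>j0<n. \<forall>\<gamma>\<in>exps m n. \<gamma> \<noteq> pure_exp m j0 \<longrightarrow> a \<gamma> = 0"
  proof (rule rigidity[OF C K A mA m q_def _ M0])
    show "cmod (hpoly m n a y) \<le> sup_norm p n P" if "in_ball q n y" for y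
      unfolding a_def by (rule sup_norm_bounds_hpoly[OF P(1) q0 qp n that])
    show "(sup_norm p n P)\<^sup>2 \<le> bw_sq m n a" using le M0 by (simp add: power_mono flip: bw)
    show "bw_sq m n a > 0" using bwp by (simp flip: bw)
  qed
  then obtain j where j: "j < n" and z: "\<And>\<gamma>. \<gamma> \<in> exps m n \<Longrightarrow> \<gamma> \<noteq> pure_exp m j \<Longrightarrow> a \<gamma> = 0" by blast
  define c where "c = a (pure_exp m j)"
  have mem: "pure_exp m j \<in> exps m n" using pure_exps_subset[of m n] j by (auto simp: pure_exps_def)
  have ev: "poly_eval P z = c * z j ^ m" for z
  proof -
    have "poly_eval P z = (\<Sum>\<gamma>\<in>{pure_exp m j}. a \<gamma> * monom_val n z \<gamma>)"
      unfolding poly_eval_eq[OF P(1)] hpoly_def a_def[symmetric]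
      by (rule sum.mono_neutral_right) (use mem \<open>\<And>\<gamma>. \<gamma> \<in> exps m n \<Longrightarrow> \<gamma> \<noteq> pure_exp m j \<Longrightarrow> a \<gamma> = 0\<close> in auto)
    then show ?thesis using j by (simp add: monom_val_pure_exp c_def)
  qed
  have "bw_sq m n a = (\<Sum>\<gamma>\<in>{pure_exp m j}. (cmod (a \<gamma>))\<^sup>2 / multinom m n \<gamma>)"
    unfolding bw_sq_def by (rule sum.mono_neutral_right) (use mem z in auto)
  then have "bw_sq m n a = (cmod c)\<^sup>2" using j by (simp add: multinom_pure c_def)
  then have "bw_norm m P = cmod c" using bw_norm_eq[OF P(1)] by (simp add: a_def)
  moreover have "sup_norm p n P = cmod c" by (rule sup_norm_power[OF P(1) q0 qp j ev])
  moreover have "c \<noteq> 0" using bwp \<open>bw_norm m P = cmod c\<close> by auto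
  ultimately show ?thesis using j ev by auto
qed

text \<open>One inequality suffices for the converse, as the sup norm of c z_j^m is |c| and
  \<open>bw_norm\<close> never exceeds it in the regime considered.\<close>

lemma cmod_le_bw_norm_power:
  assumes m: "m \<ge> 1" and j: "j < n" and P: "P \<in> homogeneous_polys m n"
    and ev: "\<And>z. poly_eval P z = c * z j ^ m"
  shows "cmod c \<le> bw_norm m P"
proof -
  define a where "a = coeff_fun P"
  have "a (pure_exp m j) = c"
    using hpoly_unit[OF m j, of a] ev[of "\<lambda>i. if i = j then 1 else 0"] by (simp add: poly_eval_eq[OF P] a_def)
  moreover have "(cmod (a (pure_exp m j)))\<^sup>2 \<le> pure_sq m n a"
    unfolding pure_sq_def by (rule member_le_sum) (use j in auto)
  ultimately have "(cmod c)\<^sup>2 \<le> bw_sq m n a"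
    using bw_sq_split[OF m, of n a] bw_sq_nonneg[of m n "mixed_part m n a"] by simp
  then show ?thesis unfolding bw_norm_eq[OF P] a_def by (rule real_le_rsqrt)
qed

theorem theorem1:
  "(\<exists>C::real. C > 0 \<and>
      (\<forall>m::nat. m \<ge> 1 \<longrightarrow>
         1 \<le> C_BW m (ereal (2 * real m)) \<and>
         C_BW m (ereal (2 * real m)) \<le> ereal (1 + C / real m)))
   \<and>
   (\<exists>(A::real) (m0::nat). A > 0 \<and> m0 \<ge> 1 \<and>
      (\<forall>(m::nat) (p::ereal). m \<ge> m0 \<and> ereal (2 * real m + A) \<le> p \<longrightarrow>
         C_BW m p = 1 \<and>
         (\<forall>n::nat. n \<ge> 1 \<longrightarrow>
            (\<forall>P \<in> homogeneous_polys m n. P \<noteq> 0 \<longrightarrow>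
               (bw_norm m P = sup_norm p n P \<longleftrightarrow>
                (\<exists>j<n. \<exists>c::complex. c \<noteq> 0 \<and> (\<forall>z. poly_eval P z = c * z j ^ m)))))))"
proof -
  obtain C where C: "BW_const C" using ex_bw_sq_le unfolding BW_const_def by blast
  then have C0: "C > 0" by (simp add: BW_const_def)
  obtain K where K: "K > 0" "\<And>m. m \<ge> 1 \<Longrightarrow> (\<Sum>k=1..<m. 1 / real (m choose k)) \<le> K / real m"
    using ex_sum_inverse_binomial_le by blast
  have part1: "1 \<le> C_BW m (ereal (2 * real m)) \<and> C_BW m (ereal (2 * real m)) \<le> ereal (1 + 4 * C / real m)"
    if m: "m \<ge> 1" for m
  proof
    show "1 \<le> C_BW m (ereal (2 * real m))" by (rule C_BW_ge_1[OF m _ order.refl]) (use m in simp)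
    show "C_BW m (ereal (2 * real m)) \<le> ereal (1 + 4 * C / real m)"
    proof (rule C_BW_le)
      fix n P assume n: "n \<ge> 1" and P: "P \<in> homogeneous_polys m n"
      show "0 \<le> sup_norm (ereal (2 * real m)) n P \<and> bw_norm m P \<le> (1 + 4 * C / real m) * sup_norm (ereal (2 * real m)) n P"
        using bw_norm_le_at_2m[OF C m n P] sup_norm_nonneg[OF P _ order.refl n, of "2 * real m"] m by simp
    qed (use C0 in simp)
  qed
  define A where "A = max (96 * C) (432 * C * (K + 4))"
  define m0 where "m0 = nat \<lceil>max A (64 * C)\<rceil> + 1"
  have A: "A \<ge> 96 * C" "A \<ge> 432 * C * (K + 4)" by (simp_all add: A_def)
  have A0: "A > 0" using A(1) C0 by linarith
  have part2: "C_BW m p = 1 \<and> (\<forall>n\<ge>1. \<forall>P\<in>homogeneous_polys m n. P \<noteq> 0 \<longrightarrow>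
      (bw_norm m P = sup_norm p n P \<longleftrightarrow> (\<exists>j<n. \<exists>c. c \<noteq> 0 \<and> (\<forall>z. poly_eval P z = c * z j ^ m))))"
    if mm: "m \<ge> m0" and p: "ereal (2 * real m + A) \<le> p" for m p
  proof -
    have m: "m \<ge> 1" using mm by (simp add: m0_def)
    have "real m \<ge> max A (64 * C)" using mm unfolding m0_def by linarith
    then have mA: "real m \<ge> A" "real m \<ge> 64 * C" by auto
    have q0: "2 * real m + A > 0" using A0 by (simp add: add_nonneg_pos)
    note rig = power_if_sup_le_bw[OF C K(1) K(2)[OF m] A mA m p]
    have le: "bw_norm m P \<le> sup_norm p n P"
      if "n \<ge> 1" "P \<in> homogeneous_polys m n" "P \<noteq> 0" for n P
    proof (rule ccontr)
      assume "\<not> ?thesis"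
      then show False using rig[OF that] by simp
    qed
    have "C_BW m p \<le> ereal 1"
      by (rule C_BW_le) (use le sup_norm_nonneg[OF _ q0 p] in auto)
    then have "C_BW m p = 1" using C_BW_ge_1[OF m q0 p] by (simp add: one_ereal_def)
    moreover have "bw_norm m P = sup_norm p n P \<longleftrightarrow> (\<exists>j<n. \<exists>c. c \<noteq> 0 \<and> (\<forall>z. poly_eval P z = c * z j ^ m))"
      if n: "n \<ge> 1" and P: "P \<in> homogeneous_polys m n" "P \<noteq> 0" for n P
    proof
      assume "bw_norm m P = sup_norm p n P"
      then show "\<exists>j<n. \<exists>c. c \<noteq> 0 \<and> (\<forall>z. poly_eval P z = c * z j ^ m)"
        using rig[OF n P] by simp
    next
      assume "\<exists>j<n. \<exists>c. c \<noteq> 0 \<and> (\<forall>z. poly_eval P z = c * z j ^ m)"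
      then obtain j c where j: "j < n" and ev: "\<And>z. poly_eval P z = c * z j ^ m" by blast
      have "sup_norm p n P = cmod c" by (rule sup_norm_power[OF P(1) q0 p j ev])
      moreover have "cmod c \<le> bw_norm m P" by (rule cmod_le_bw_norm_power[OF m j P(1) ev])
      ultimately show "bw_norm m P = sup_norm p n P" using le[OF n P] by simp
    qed
    ultimately show ?thesis by blast
  qed
  show ?thesis
  proof (intro conjI)
    show "\<exists>C::real. C > 0 \<and> (\<forall>m::nat. m \<ge> 1 \<longrightarrow>
         1 \<le> C_BW m (ereal (2 * real m)) \<and> C_BW m (ereal (2 * real m)) \<le> ereal (1 + C / real m))"
      using part1 C0 by (intro exI[of _ "4 * C"]) simp
    show "\<exists>(A::real) (m0::nat). A > 0 \<and> m0 \<ge> 1 \<and>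
      (\<forall>(m::nat) (p::ereal). m \<ge> m0 \<and> ereal (2 * real m + A) \<le> p \<longrightarrow>
         C_BW m p = 1 \<and>
         (\<forall>n::nat. n \<ge> 1 \<longrightarrow>
            (\<forall>P \<in> homogeneous_polys m n. P \<noteq> 0 \<longrightarrow>
               (bw_norm m P = sup_norm p n P \<longleftrightarrow>
                (\<exists>j<n. \<exists>c::complex. c \<noteq> 0 \<and> (\<forall>z. poly_eval P z = c * z j ^ m))))))"
    proof (rule exI[of _ A], rule exI[of _ m0], intro conjI)
      show "A > 0" by (rule A0)
      show "m0 \<ge> 1" by (simp add: m0_def)
    qed (use part2 in blast)
  qed
qed

end
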